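(* Let $\Delta=\Phi^\varepsilon$ be one of $A^\varepsilon_{n-1}$ ($n\ge2$), $B^\varepsilon_n$ ($n\ge2$), $D^\varepsilon_n$ ($n\ge4$), let $Q$ be a $\Delta$ quiver, and let $M(Q)$ be the corresponding Boolean reflection monoid with generating set $S=\{s_i: i\in I\cup\{\varepsilon\}\}$. Let $\alpha\in\mathrm{Aut}(M(Q))$. Then $\alpha$ is an inner by diagram automorphism of $M(Q)$ if and only if there exists a finite sequence of mutations (at mutable vertices) preserving the underlying diagram $\Delta$ such that $\alpha(S)$ is obtained from $Q$ by these mutations; that is, the sequence, starting from $Q$ with the elements $s_i$ attached to its vertices, ends at a quiver with underlying diagram $\Delta$ whose set of attached elements is $\alpha(S)$. In particular, all reflections in $W(Q\setminus\{\varepsilon\})$ and all elements $gs_\varepsilon g^{-1}$ with $g\in W(Q\setminus\{\varepsilon\})$ occur as elements attached to vertices of quivers obtained from $Q$ by mutations.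
   Context: **Diagrams.** $A^\varepsilon_{n-1}$: path $1-2-\cdots-(n-1)-\varepsilon$. $B^\varepsilon_n$: path $0-1-\cdots-(n-1)-\varepsilon$ with the edge $0-1$ of weight $2$, all others of weight $1$. $D^\varepsilon_n$: path $2-3-\cdots-(n-1)-\varepsilon$ with two further vertices $0$ and $1$, each joined to $2$. The vertex $\varepsilon$ is frozen; $I$ is the set of the other (mutable) vertices. A $\Delta$ quiver is a quiver (orientation) with underlying diagram $\Delta$. **Mutation.** Quivers are finite, without loops or oriented 2-cycles, with positive integer weights on arrows, coming from skew-symmetrizable integer matrices $(b_{ij})$ (arrow $i\to j$ of weight $|b_{ij}b_{ji}|$ when $b_{ij}>0$). Mutation $\mu_k(Q)$ at a mutable vertex $k$: (i) reverse all arrows incident to $k$, keeping weights; (ii) for each oriented path $i\to k\to j$ with weights $a,b$, the weight $c$ of the edge between $i,j$ in $Q$ and the weight $c'$ of that edge in $\mu_k(Q)$ satisfy $\pm\sqrt c\pm\sqrt{c'}=\sqrt{ab}$, the sign of $\sqrt c$ (resp. $\sqrt{c'}$) being $+$ if $i,j,k$ form an oriented cycle in $Q$ (resp. $\mu_k(Q)$) and $-$ otherwise (weight $0$ means no edge); (iii) all other edges are unchanged. **The monoid $M(Q)$ for a $\Delta$ quiver $Q$.** It is the inverse monoid (identity $e$) generated by $s_i$, $i\in I\cup\{\varepsilon\}$, with relations: $s_i^2=e$ ($i\in I$), $s_\varepsilon^2=s_\varepsilon$; $(s_is_j)^{m_{ij}}=e$ for $i\ne j$ in $I$ with $m_{ij}=2,3,4$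 if $i,j$ are respectively not joined, joined with weight $1$, joined with weight $2$; $s_\varepsilon s_j=s_js_\varepsilon$ for $j\in I$ not joined to $\varepsilon$; $s_\varepsilon s_js_\varepsilon=s_js_\varepsilon s_js_\varepsilon=s_\varepsilon s_js_\varepsilon s_j$ for $j\in I$ joined to $\varepsilon$; for $B^\varepsilon_n$, additionally $s_0s_1\cdots s_{n-1}s_\varepsilon=s_1\cdots s_{n-1}s_\varepsilon$ and $s_\varepsilon s_{n-1}\cdots s_1s_0=s_\varepsilon s_{n-1}\cdots s_1$; for $D^\varepsilon_n$, additionally $s_0(s_2\cdots s_{n-1}s_\varepsilon)(s_\varepsilon s_{n-1}\cdots s_2)s_0=s_1(s_2\cdots s_{n-1}s_\varepsilon)(s_\varepsilon s_{n-1}\cdots s_2)s_1$. It is isomorphic to the Boolean reflection monoid $M(\Phi,\mathcal B)$, i.e. the monoid of all restrictions $g_X$ of elements $g$ of the Weyl group $W(\Phi)\subseteq GL(\mathbb R^n)$ (permutations, signed permutations, even signed permutations of the standard basis for $A_{n-1},B_n,D_n$) to coordinate subspaces $X$, under composition of partial maps. $W(Q\setminus\{\varepsilon\})$ denotes the unit group of $M(Q)$; it is the Weyl group $W(\Phi)$ generated by $\{s_i:i\in I\}$, and its reflections are the conjugates of the $s_i$, $i\in I$. **Mutation of attached elements.** If a quiver has elements $x_i\in M(Q)$ attached to its vertices $i\in I\cup\{\varepsilon\}$, then after mutation at a mutable vertex $k$ the attached elements are $x_i'=x_kx_ix_k$ if there is an arrow $i\to k$ (of any weight) before mutation, and $x_i'=x_i$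 otherwise (including $i=\varepsilon$). A sequence of mutations preserves the underlying diagram if its final quiver has the same underlying diagram, up to relabelling of mutable vertices, as the initial one. **Automorphisms.** An automorphism $\alpha$ of $M(Q)$ is inner if there is $g$ in the unit group with $\alpha(t)=gtg^{-1}$ for all $t$. A diagram automorphism is an automorphism induced by a permutation of the generators which is an automorphism of the weighted diagram $\Delta$ fixing $\varepsilon$. An inner by diagram automorphism is an element of the subgroup of $\mathrm{Aut}(M(Q))$ generated by inner automorphisms and diagram automorphisms. *)

theory Defs
  imports Complex_Main "HOL-Combinatorics.Permutations" "HOL-Algebra.Bij"
    "HOL-Algebra.Generated_Groups"
begin

section \<open>The weighted diagrams\<close>

text \<open>The parameter \<open>n\<close> is that of $A^\varepsilon_{n-1}$, $B^\varepsilon_n$ and $D^\varepsilon_n$.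
  In all three cases the frozen vertex $\varepsilon$ is encoded as the number \<open>n\<close>, so that the
  path $\cdots - (n-1) - \varepsilon$ becomes $\cdots - (n-1) - n$.\<close>

datatype diagram_type = TypeA | TypeB | TypeD

fun mutable :: "diagram_type \<Rightarrow> nat \<Rightarrow> nat set" where
  "mutable TypeA n = {1..<n}"
| "mutable TypeB n = {0..<n}"
| "mutable TypeD n = {0..<n}"

definition vertices :: "diagram_type \<Rightarrow> nat \<Rightarrow> nat set" where
  "vertices X n = insert n (mutable X n)"

text \<open>\<open>edge_up X n i j\<close> is the weight of the edge between \<open>i < j\<close>, each edge being listed once with
  its smaller endpoint first; \<open>diagram X n\<close> is the symmetric weight function (\<open>0\<close>: not joined).\<close>

fun edge_up :: "diagram_type \<Rightarrow> nat \<Rightarrow> nat \<Rightarrow> nat \<Rightarrow> nat" where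
  "edge_up TypeA n i j = (if 1 \<le> i \<and> j = i + 1 \<and> j \<le> n then 1 else 0)"
| "edge_up TypeB n i j = (if j = i + 1 \<and> j \<le> n then (if i = 0 then 2 else 1) else 0)"
| "edge_up TypeD n i j = (if (i = 0 \<and> j = 2) \<or> (1 \<le> i \<and> j = i + 1 \<and> j \<le> n) then 1 else 0)"

definition diagram :: "diagram_type \<Rightarrow> nat \<Rightarrow> nat \<Rightarrow> nat \<Rightarrow> nat" where
  "diagram X n i j = edge_up X n i j + edge_up X n j i"


section \<open>Quivers and their mutation\<close>

text \<open>\<open>Q i j\<close> is the weight of the arrow \<open>i \<rightarrow> j\<close>, with \<open>0\<close> meaning that there is no such arrow.\<close>

type_synonym quiver = "nat \<Rightarrow> nat \<Rightarrow> nat"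

definition skew_symmetrizable :: "nat set \<Rightarrow> (nat \<Rightarrow> nat \<Rightarrow> int) \<Rightarrow> bool" where
  "skew_symmetrizable V b \<longleftrightarrow>
     (\<exists>d :: nat \<Rightarrow> int. (\<forall>i\<in>V. d i > 0) \<and> (\<forall>i\<in>V. \<forall>j\<in>V. d i * b i j = - (d j * b j i)))"

text \<open>Skew-symmetrizability forces \<open>b i j\<close> and \<open>b j i\<close> to have opposite signs, so loops and
  oriented 2-cycles are excluded and all arrows have positive weight.\<close>

definition is_quiver :: "nat set \<Rightarrow> quiver \<Rightarrow> bool" where
  "is_quiver V Q \<longleftrightarrow> finite V \<and> (\<forall>i j. i \<notin> V \<or> j \<notin> V \<longrightarrow> Q i j = 0) \<and>
     (\<exists>b. skew_symmetrizable V b \<and>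
        (\<forall>i\<in>V. \<forall>j\<in>V. int (Q i j) = (if b i j > 0 then \<bar>b i j * b j i\<bar> else 0)))"

definition edge_weight :: "quiver \<Rightarrow> nat \<Rightarrow> nat \<Rightarrow> nat" where
  "edge_weight Q i j = Q i j + Q j i"

definition oriented_cycle :: "quiver \<Rightarrow> nat \<Rightarrow> nat \<Rightarrow> nat \<Rightarrow> bool" where
  "oriented_cycle Q i j k \<longleftrightarrow>
     (Q i j > 0 \<and> Q j k > 0 \<and> Q k i > 0) \<or> (Q j i > 0 \<and> Q k j > 0 \<and> Q i k > 0)"

definition signed_root :: "quiver \<Rightarrow> nat \<Rightarrow> nat \<Rightarrow> nat \<Rightarrow> real" where
  "signed_root Q i j k =
     (if oriented_cycle Q i j k then sqrt (edge_weight Q i j) else - sqrt (edge_weight Q i j))"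

text \<open>\<open>is_mutation V k Q Q'\<close> states that \<open>Q' = \<mu>\<^sub>k(Q)\<close>. The clause on signed roots determines both
  the weight and the direction of the edge between \<open>i\<close> and \<open>j\<close> in \<open>Q'\<close>: in \<open>Q'\<close> one has
  \<open>j \<rightarrow> k \<rightarrow> i\<close>, so a positive root means \<open>i \<rightarrow> j\<close> and a negative one \<open>j \<rightarrow> i\<close>.\<close>

definition is_mutation :: "nat set \<Rightarrow> nat \<Rightarrow> quiver \<Rightarrow> quiver \<Rightarrow> bool" where
  "is_mutation V k Q Q' \<longleftrightarrow> is_quiver V Q' \<and>
     (\<forall>i\<in>V. Q' i k = Q k i \<and> Q' k i = Q i k) \<and>
     (\<forall>i\<in>V. \<forall>j\<in>V. Q i k > 0 \<and> Q k j > 0 \<longrightarrow>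
        signed_root Q i j k + signed_root Q' i j k = sqrt (Q i k * Q k j)) \<and>
     (\<forall>i\<in>V - {k}. \<forall>j\<in>V - {k}.
        \<not> (Q i k > 0 \<and> Q k j > 0) \<and> \<not> (Q j k > 0 \<and> Q k i > 0) \<longrightarrow> Q' i j = Q i j)"

definition delta_quiver :: "diagram_type \<Rightarrow> nat \<Rightarrow> quiver \<Rightarrow> bool" where
  "delta_quiver X n Q \<longleftrightarrow> is_quiver (vertices X n) Q \<and>
     (\<forall>i\<in>vertices X n. \<forall>j\<in>vertices X n. edge_weight Q i j = diagram X n i j)"

text \<open>A permutation of the mutable vertices in the sense of \<open>permutes\<close> fixes $\varepsilon$.\<close>

definition has_underlying_diagram :: "diagram_type \<Rightarrow> nat \<Rightarrow> quiver \<Rightarrow> bool" where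
  "has_underlying_diagram X n Q \<longleftrightarrow>
     (\<exists>\<pi>. \<pi> permutes mutable X n \<and>
        (\<forall>i\<in>vertices X n. \<forall>j\<in>vertices X n. edge_weight Q (\<pi> i) (\<pi> j) = diagram X n i j))"


section \<open>Inverse monoids given by generators and relations\<close>

text \<open>The inverse monoid with generators \<open>V\<close> and relations \<open>R\<close> consists of words in generators and
  formal inverses modulo the congruence generated by \<open>R\<close> and Wagner's relations, which say that
  $u u^{-1} u = u$ and that elements $u u^{-1}$ and $v v^{-1}$ commute.\<close>

datatype letter = Gen nat | GenInv nat

type_synonym word = "letter list"

fun letter_inv :: "letter \<Rightarrow> letter" where
  "letter_inv (Gen i) = GenInv i"
| "letter_inv (GenInv i) = Gen i"

definition word_inv :: "word \<Rightarrow> word" where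
  "word_inv w = rev (map letter_inv w)"

definition words :: "nat set \<Rightarrow> word set" where
  "words V = lists (Gen ` V \<union> GenInv ` V)"

inductive pres_eq :: "nat set \<Rightarrow> (word \<times> word) set \<Rightarrow> word \<Rightarrow> word \<Rightarrow> bool" for V R where
  refl: "u \<in> words V \<Longrightarrow> pres_eq V R u u"
| sym: "pres_eq V R u v \<Longrightarrow> pres_eq V R v u"
| trans: "pres_eq V R u v \<Longrightarrow> pres_eq V R v w \<Longrightarrow> pres_eq V R u w"
| cong: "pres_eq V R u u' \<Longrightarrow> pres_eq V R v v' \<Longrightarrow> pres_eq V R (u @ v) (u' @ v')"
| rel: "(u, v) \<in> R \<Longrightarrow> u \<in> words V \<Longrightarrow> v \<in> words V \<Longrightarrow> pres_eq V R u v"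
| inv: "u \<in> words V \<Longrightarrow> pres_eq V R (u @ word_inv u @ u) u"
| idem_comm: "u \<in> words V \<Longrightarrow> v \<in> words V \<Longrightarrow>
    pres_eq V R (u @ word_inv u @ v @ word_inv v) (v @ word_inv v @ u @ word_inv u)"

definition word_class :: "nat set \<Rightarrow> (word \<times> word) set \<Rightarrow> word \<Rightarrow> word set" where
  "word_class V R u = {v. pres_eq V R u v}"

definition presented_inverse_monoid :: "nat set \<Rightarrow> (word \<times> word) set \<Rightarrow> word set monoid" where
  "presented_inverse_monoid V R =
     \<lparr>carrier = word_class V R ` words V,
      monoid.mult = (\<lambda>P P'. \<Union>u\<in>P. \<Union>v\<in>P'. word_class V R (u @ v)),
      one = word_class V R []\<rparr>"


section \<open>The monoid $M(Q)$\<close>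

text \<open>All relations of $M(Q)$ depend only on the underlying diagram of \<open>Q\<close>.\<close>

definition gens :: "nat list \<Rightarrow> word" where
  "gens = map Gen"

definition word_power :: "word \<Rightarrow> nat \<Rightarrow> word" where
  "word_power w m = concat (replicate m w)"

definition coxeter_exponent :: "diagram_type \<Rightarrow> nat \<Rightarrow> nat \<Rightarrow> nat \<Rightarrow> nat" where
  "coxeter_exponent X n i j =
     (if diagram X n i j = 0 then 2 else if diagram X n i j = 1 then 3 else 4)"

fun special_relations :: "diagram_type \<Rightarrow> nat \<Rightarrow> (word \<times> word) set" where
  "special_relations TypeA n = {}"
| "special_relations TypeB n =
     {(gens ([0..<n] @ [n]), gens ([1..<n] @ [n])),
      (gens ([n] @ rev [0..<n]), gens ([n] @ rev [1..<n]))}"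
| "special_relations TypeD n =
     {(gens ([0] @ ([2..<n] @ [n]) @ ([n] @ rev [2..<n]) @ [0]),
       gens ([1] @ ([2..<n] @ [n]) @ ([n] @ rev [2..<n]) @ [1]))}"

definition relations :: "diagram_type \<Rightarrow> nat \<Rightarrow> (word \<times> word) set" where
  "relations X n =
     {(gens [i, i], []) | i. i \<in> mutable X n} \<union>
     {(gens [n, n], gens [n])} \<union>
     {(word_power (gens [i, j]) (coxeter_exponent X n i j), []) | i j.
        i \<in> mutable X n \<and> j \<in> mutable X n \<and> i \<noteq> j} \<union>
     {(gens [n, j], gens [j, n]) | j. j \<in> mutable X n \<and> diagram X n j n = 0} \<union>
     {(gens [n, j, n], gens [j, n, j, n]) | j. j \<in> mutable X n \<and> diagram X n j n \<noteq> 0} \<union>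
     {(gens [j, n, j, n], gens [n, j, n, j]) | j. j \<in> mutable X n \<and> diagram X n j n \<noteq> 0} \<union>
     special_relations X n"

definition refl_monoid :: "diagram_type \<Rightarrow> nat \<Rightarrow> word set monoid" where
  "refl_monoid X n = presented_inverse_monoid (vertices X n) (relations X n)"

definition gen :: "diagram_type \<Rightarrow> nat \<Rightarrow> nat \<Rightarrow> word set" where
  "gen X n i = word_class (vertices X n) (relations X n) [Gen i]"

text \<open>The group $W(Q\setminus\{\varepsilon\})$ is the unit group \<open>Units (refl_monoid X n)\<close>.\<close>

definition reflections :: "diagram_type \<Rightarrow> nat \<Rightarrow> word set set" where
  "reflections X n =
     {g \<otimes>\<^bsub>refl_monoid X n\<^esub> gen X n i \<otimes>\<^bsub>refl_monoid X n\<^esub> inv\<^bsub>refl_monoid X n\<^esub> g | g i.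
        g \<in> Units (refl_monoid X n) \<and> i \<in> mutable X n}"


section \<open>Mutation of quivers with attached elements\<close>

definition mutate_elems ::
    "diagram_type \<Rightarrow> nat \<Rightarrow> nat \<Rightarrow> quiver \<Rightarrow> (nat \<Rightarrow> word set) \<Rightarrow> nat \<Rightarrow> word set" where
  "mutate_elems X n k Q x i =
     (if Q i k > 0 then x k \<otimes>\<^bsub>refl_monoid X n\<^esub> x i \<otimes>\<^bsub>refl_monoid X n\<^esub> x k else x i)"

inductive mutation_step ::
    "diagram_type \<Rightarrow> nat \<Rightarrow> quiver \<times> (nat \<Rightarrow> word set) \<Rightarrow> quiver \<times> (nat \<Rightarrow> word set) \<Rightarrow> bool"
  for X n where
  "k \<in> mutable X n \<Longrightarrow> is_mutation (vertices X n) k Q Q' \<Longrightarrow>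
     mutation_step X n (Q, x) (Q', mutate_elems X n k Q x)"

text \<open>\<open>mutates_to X n Q Q' x\<close>: some finite sequence of mutations at mutable vertices starting from
  \<open>Q\<close> with the generators attached ends at \<open>Q'\<close> with the elements \<open>x\<close> attached.\<close>

definition mutates_to ::
    "diagram_type \<Rightarrow> nat \<Rightarrow> quiver \<Rightarrow> quiver \<Rightarrow> (nat \<Rightarrow> word set) \<Rightarrow> bool" where
  "mutates_to X n Q Q' x \<longleftrightarrow> (mutation_step X n)\<^sup>*\<^sup>* (Q, gen X n) (Q', x)"


section \<open>Automorphisms\<close>

text \<open>\<open>auto M\<close> is the set of automorphisms of \<open>M\<close>, as extensional functions on the carrier, and
  \<open>AutoGroup M\<close> is $\mathrm{Aut}(M)$ with composition. A bijective multiplicative map preserves the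
  identity.\<close>

definition inner_automorphisms :: "diagram_type \<Rightarrow> nat \<Rightarrow> (word set \<Rightarrow> word set) set" where
  "inner_automorphisms X n =
     {\<alpha> \<in> auto (refl_monoid X n). \<exists>g\<in>Units (refl_monoid X n). \<forall>t\<in>carrier (refl_monoid X n).
        \<alpha> t = g \<otimes>\<^bsub>refl_monoid X n\<^esub> t \<otimes>\<^bsub>refl_monoid X n\<^esub> inv\<^bsub>refl_monoid X n\<^esub> g}"

definition diagram_automorphisms :: "diagram_type \<Rightarrow> nat \<Rightarrow> (word set \<Rightarrow> word set) set" where
  "diagram_automorphisms X n =
     {\<alpha> \<in> auto (refl_monoid X n). \<exists>\<pi>. \<pi> permutes mutable X n \<and>
        (\<forall>i\<in>vertices X n. \<forall>j\<in>vertices X n. diagram X n (\<pi> i) (\<pi> j) = diagram X n i j) \<and>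
        (\<forall>i\<in>vertices X n. \<alpha> (gen X n i) = gen X n (\<pi> i))}"

definition inner_by_diagram :: "diagram_type \<Rightarrow> nat \<Rightarrow> (word set \<Rightarrow> word set) \<Rightarrow> bool" where
  "inner_by_diagram X n \<alpha> \<longleftrightarrow>
     \<alpha> \<in> generate (AutoGroup (refl_monoid X n))
           (inner_automorphisms X n \<union> diagram_automorphisms X n)"

end

theory Submission
  imports Defs
begin

text \<open>The proof rests on two facts: mutations reach every conjugate of the generating set \<open>S\<close>, and the
monoid has no automorphisms of the relevant kind beyond the evident ones.

\<^bold>\<open>Reaching conjugates.\<close> The diagram is a tree, so mutating a \<open>\<Delta>\<close> quiver \<open>Q\<close> at \<open>k\<close> and then again
at \<open>k\<close> gives back \<open>Q\<close> (\<open>delta_quiver_mutation\<close>). The first mutation conjugates by \<open>x k\<close> the elements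
at the sources of arrows into \<open>k\<close>, the second one those at the targets of arrows out of \<open>k\<close>; all
other attached elements commute with \<open>x k\<close>. So the double mutation keeps \<open>Q\<close> and replaces
\<open>g S g\<^sup>-\<close> by \<open>g s\<^sub>k S s\<^sub>k g\<^sup>-\<close>, where \<open>g\<^sup>-\<close> is the inverse of \<open>g\<close>. Since the units are the words in
the \<open>s i\<close> with \<open>i\<close> mutable (\<open>Units_induct\<close>), every \<open>g S g\<^sup>-\<close> is attached to \<open>Q\<close> after finitely many
mutations (\<open>reach_conjugate\<close>). An inner by diagram automorphism maps \<open>S\<close> to some \<open>g S g\<^sup>-\<close>
(\<open>inner_diagram_image\<close>), which gives one implication and the final claims.

\<^bold>\<open>Recognising automorphisms.\<close> For the converse, let \<open>\<alpha>\<close> be an automorphism whose image of \<open>S\<close> is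
attached to some quiver in the mutation class. Mutations keep the elements at mutable vertices
among the reflections and the element at \<open>\<epsilon>\<close> among the \<open>n\<close> idempotents \<open>f 1, \<dots>, f n\<close> conjugate to
\<open>s n\<close> (\<open>mutation_elements\<close>). Automorphisms preserve units, so \<open>\<alpha>\<close> sends each \<open>s i\<close> with \<open>i\<close> mutable to
a reflection and \<open>s n\<close> to some \<open>f a\<close>. Composing \<open>\<alpha>\<close> with conjugations by simple transpositions makes it
fix every \<open>f a\<close> (\<open>inner_diagram_if_reflections\<close>). For \<open>i \<ge> 1\<close>, \<open>\<alpha> (s i)\<close> is then a reflection exchanging
\<open>f i\<close> and \<open>f (i + 1)\<close>, and at most two of these exist: \<open>s i\<close> and the element obtained from it by changing the sign
of the coordinate \<open>i + 1\<close> (\<open>adjacent_reflection\<close>). Sign changes are induced by inner by diagram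
automorphisms, so \<open>\<alpha>\<close> can be corrected at \<open>s 1, s 2, \<dots>\<close> in turn until it fixes all of them; it then
fixes \<open>s 0\<close> as well (\<open>fixes_s0\<close>) and is the identity (\<open>inner_diagram_if_fixes_f\<close>).

\<^bold>\<open>Controlling the reflections.\<close> The monoid is only given by a presentation. The left multiplications
\<open>L (s i)\<close> with \<open>1 \<le> i < n\<close>, together with one more involution \<open>d\<close> of the carrier, satisfy the Coxeter
relations of type \<open>B\<^sub>n\<close>; here \<open>d\<close> is the identity in type A, left multiplication by \<open>s 0\<close> in type B, and
the automorphism exchanging \<open>s 0\<close> and \<open>s 1\<close> in type D. From these relations alone the conjugates of
the generators can be listed (locale \<open>signed_chain\<close>), which bounds the reflections from above and
treats the three types together. To see that the listed elements are different, the monoid acts on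
signed points by \<open>rho\<close>; this action is a second instance of the same locale, and each reflection has
the same name in both (\<open>Ref_matched\<close>).\<close>

section \<open>Mutating twice at a vertex of a tree quiver\<close>

text \<open>The matrix mutation at \<open>k\<close> in the case that no path \<open>i \<rightarrow> k \<rightarrow> j\<close> has its ends joined: each such path
creates an arrow \<open>i \<rightarrow> j\<close>.\<close>

definition acyclic_mutation :: "nat \<Rightarrow> quiver \<Rightarrow> quiver" where
  "acyclic_mutation k Q i j =
     (if i = k \<or> j = k then Q j i else if Q i k > 0 \<and> Q k j > 0 then Q i k * Q k j else Q i j)"

lemma is_quiverE:
  assumes "is_quiver V Q"
  obtains b and d :: "nat \<Rightarrow> int" where "finite V" "\<And>i j. i \<notin> V \<or> j \<notin> V \<Longrightarrow> Q i j = 0"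
    "\<And>i. i \<in> V \<Longrightarrow> d i > 0"
    "\<And>i j. i \<in> V \<Longrightarrow> j \<in> V \<Longrightarrow> d i * b i j = - (d j * b j i)"
    "\<And>i j. i \<in> V \<Longrightarrow> j \<in> V \<Longrightarrow> int (Q i j) = (if b i j > 0 then \<bar>b i j * b j i\<bar> else 0)"
  using assms unfolding is_quiver_def skew_symmetrizable_def by blast

lemma is_quiver_cases:
  assumes "is_quiver V Q"
  shows "Q i i = 0" "Q i j > 0 \<Longrightarrow> Q j i = 0" "i \<notin> V \<Longrightarrow> Q i j = 0" "i \<notin> V \<Longrightarrow> Q j i = 0"
proof -
  obtain b d where fin: "finite V" and out: "\<And>i j. i \<notin> V \<or> j \<notin> V \<Longrightarrow> Q i j = 0"
    and d: "\<And>i. i \<in> V \<Longrightarrow> (d i :: int) > 0"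
    and sk: "\<And>i j. i \<in> V \<Longrightarrow> j \<in> V \<Longrightarrow> d i * b i j = - (d j * b j i)"
    and Q: "\<And>i j. i \<in> V \<Longrightarrow> j \<in> V \<Longrightarrow> int (Q i j) = (if b i j > 0 then \<bar>b i j * b j i\<bar> else 0)"
    using that by (rule is_quiverE[OF assms]) blast
  show "i \<notin> V \<Longrightarrow> Q i j = 0" "i \<notin> V \<Longrightarrow> Q j i = 0" using out by auto
  have neg: "b j i < 0" if "i \<in> V" "j \<in> V" "b i j > 0" for i j
  proof -
    have "d j * b j i < 0" using sk[of i j] d[of i] that mult_pos_pos[of "d i" "b i j"] by linarith
    then show ?thesis using d[of j] that by (simp add: mult_less_0_iff)
  qed
  show "Q i j = 0" if "Q j i > 0" for i j
  proof -
    have "j \<in> V" "i \<in> V" using that out[of j i] by auto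
    then show ?thesis using Q[of i j] Q[of j i] neg[of j i] that by (auto split: if_splits)
  qed
  then show "Q i i = 0" using neq0_conv by metis
qed

text \<open>The underlying matrix mutates by the usual rule \<open>b\<^sub>i\<^sub>j + [b\<^sub>i\<^sub>k]\<^sub>+ [b\<^sub>k\<^sub>j]\<^sub>+ - [b\<^sub>i\<^sub>k]\<^sub>- [b\<^sub>k\<^sub>j]\<^sub>-\<close>, and the same positive
diagonal symmetrizes the result.\<close>

lemma is_quiver_acyclic_mutation:
  assumes quiver: "is_quiver V Q" and k: "k \<in> V"
    and tree: "\<And>i j. Q i k > 0 \<Longrightarrow> Q k j > 0 \<Longrightarrow> Q i j = 0 \<and> Q j i = 0"
  shows "is_quiver V (acyclic_mutation k Q)"
proof -
  obtain b d where fin: "finite V" and out: "\<And>i j. i \<notin> V \<or> j \<notin> V \<Longrightarrow> Q i j = 0"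
    and d: "\<And>i. i \<in> V \<Longrightarrow> (d i :: int) > 0"
    and sk: "\<And>i j. i \<in> V \<Longrightarrow> j \<in> V \<Longrightarrow> d i * b i j = - (d j * b j i)"
    and Q: "\<And>i j. i \<in> V \<Longrightarrow> j \<in> V \<Longrightarrow> int (Q i j) = (if b i j > 0 then \<bar>b i j * b j i\<bar> else 0)"
    using that by (rule is_quiverE[OF quiver]) blast
  have neg: "b j i < 0 \<longleftrightarrow> b i j > 0" if "i \<in> V" "j \<in> V" for i j
  proof -
    have "d j * b j i < 0 \<longleftrightarrow> d i * b i j > 0" using sk[of i j] that by linarith
    then show ?thesis using d[of j] d[of i] that by (simp add: mult_less_0_iff zero_less_mult_iff)
  qed
  have pos: "Q i j > 0 \<longleftrightarrow> b i j > 0" if "i \<in> V" "j \<in> V" for i j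
  proof -
    have "\<bar>b i j * b j i\<bar> > 0" if "b i j > 0"
      using neg[of i j] that \<open>i \<in> V\<close> \<open>j \<in> V\<close> by auto
    then have "int (Q i j) > 0 \<longleftrightarrow> b i j > 0"
      unfolding Q[OF that] by (cases "b i j > 0") simp_all
    then show ?thesis by simp
  qed
  \<comment> \<open>the matrix mutation rule, which keeps the symmetrizer \<open>d\<close>\<close>
  define b' where "b' i j = (if i = k \<or> j = k then - b i j
    else if b i k > 0 \<and> b k j > 0 then b i k * b k j
    else if b i k < 0 \<and> b k j < 0 then - (b i k * b k j) else b i j)" for i j
  have bz: "b i j = 0" if "i \<in> V" "j \<in> V" "b i k > 0 \<and> b k j > 0 \<or> b i k < 0 \<and> b k j < 0" for i j
  proof -
    have "Q i j = 0 \<and> Q j i = 0"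
      using tree[of i j] tree[of j i] that k neg[of i k] neg[of k i] neg[of j k] neg[of k j]
      by (auto simp: pos)
    then show ?thesis using pos[of i j] pos[of j i] neg[of i j] neg[of j i] that by auto
  qed
  have sk': "d i * b' i j = - (d j * b' j i)" if V: "i \<in> V" "j \<in> V" for i j
  proof (cases "i = k \<or> j = k")
    case True
    then show ?thesis using sk[OF V] by (auto simp: b'_def)
  next
    case False
    have eq: "d i * (b i k * b k j) = d j * (b j k * b k i)"
    proof -
      have "d i * (b i k * b k j) = - (d k * b k i) * b k j" using sk[of i k] V k
        by (metis mult.assoc)
      also have "\<dots> = - (d k * b k j) * b k i" by simp
      also have "\<dots> = d j * b j k * b k i" using sk[of j k] V k by simp
      finally show ?thesis by simp
    qed
    show ?thesis
      using False neg[of i k] neg[of k i] neg[of j k] neg[of k j] eq sk[OF V] V k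
      by (auto simp: b'_def)
  qed
  have Q': "int (acyclic_mutation k Q i j) = (if b' i j > 0 then \<bar>b' i j * b' j i\<bar> else 0)"
    if V: "i \<in> V" "j \<in> V" for i j
  proof -
    consider "i = k \<or> j = k" | "i \<noteq> k" "j \<noteq> k" "b i k > 0" "b k j > 0"
      | "i \<noteq> k" "j \<noteq> k" "b i k < 0" "b k j < 0"
      | "i \<noteq> k" "j \<noteq> k" "\<not> (b i k > 0 \<and> b k j > 0)" "\<not> (b i k < 0 \<and> b k j < 0)" by blast
    then show ?thesis
    proof cases
      case 1
      then show ?thesis using V k Q[of j i] neg[of i j] neg[of j i]
        by (auto simp: acyclic_mutation_def b'_def mult.commute)
    next
      case 2
      have n: "b k i < 0" "b j k < 0" using 2 neg V k by auto
      have "int (acyclic_mutation k Q i j) = \<bar>b i k * b k i\<bar> * \<bar>b k j * b j k\<bar>"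
        using 2 V k Q[of i k] Q[of k j] pos by (simp add: acyclic_mutation_def)
      then show ?thesis using 2 n
        by (simp add: b'_def abs_mult mult.assoc mult.left_commute mult.commute)
    next
      case 3
      have n: "b k i > 0" "b j k > 0" using 3 neg V k by auto
      have "acyclic_mutation k Q i j = Q i j" using 3 V k pos by (simp add: acyclic_mutation_def)
      then show ?thesis using 3 n Q[of i j] bz[of i j] V mult_neg_neg[of "b i k" "b k j"]
        by (simp add: b'_def)
    next
      case 4
      have "acyclic_mutation k Q i j = Q i j" using 4 V k pos by (auto simp: acyclic_mutation_def)
      moreover have "b' i j = b i j" "b' j i = b j i"
        using 4 neg[of i k] neg[of k i] neg[of j k] neg[of k j] V k by (auto simp: b'_def)
      ultimately show ?thesis using Q V by simp
    qed
  qed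
  show ?thesis
    unfolding is_quiver_def skew_symmetrizable_def
  proof (intro conjI allI impI exI[of _ b'] exI[of _ d] ballI)
    show "acyclic_mutation k Q i j = 0" if "i \<notin> V \<or> j \<notin> V" for i j
      using that k out[of i j] out[of i k] out[of k j] out[of j i]
      by (auto simp: acyclic_mutation_def)
    show "d i * b' i j = - (d j * b' j i)" if "i \<in> V" "j \<in> V" for i j
      using that by (rule sk')
    show "int (acyclic_mutation k Q i j) = (if b' i j > 0 then \<bar>b' i j * b' j i\<bar> else 0)"
      if "i \<in> V" "j \<in> V" for i j
      using that by (rule Q')
  qed (use fin d in auto)
qed

text \<open>Mutating forward, the root of the weight between \<open>i\<close> and \<open>j\<close> grows from \<open>0\<close> to \<open>\<surd>(a b)\<close>, because in the
new quiver \<open>i, j, k\<close> form an oriented cycle; mutating back, the same equation is read for the path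
\<open>j \<rightarrow> k \<rightarrow> i\<close>.\<close>

lemma mutation_there_and_back:
  assumes quiver: "is_quiver V Q" and k: "k \<in> V"
    and tree: "\<And>i j. Q i k > 0 \<Longrightarrow> Q k j > 0 \<Longrightarrow> Q i j = 0 \<and> Q j i = 0"
  shows "is_mutation V k Q (acyclic_mutation k Q)" "is_mutation V k (acyclic_mutation k Q) Q"
proof -
  note c = is_quiver_cases[OF quiver]
  let ?Q' = "acyclic_mutation k Q"
  have roots: "signed_root Q i j k + signed_root ?Q' i j k = sqrt (Q i k * Q k j)"
    "signed_root Q j i k + signed_root ?Q' j i k = sqrt (Q i k * Q k j)"
    if "Q i k > 0" "Q k j > 0" for i j
  proof -
    have z: "Q i j = 0" "Q j i = 0" "Q j k = 0" "Q k i = 0" "i \<noteq> k" "j \<noteq> k"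
      using tree[OF that] c(2)[of i k] c(2)[of k j] c(1)[of k] that by auto
    then show "signed_root Q i j k + signed_root ?Q' i j k = sqrt (Q i k * Q k j)"
      "signed_root Q j i k + signed_root ?Q' j i k = sqrt (Q i k * Q k j)"
      using that
      by (auto simp: signed_root_def edge_weight_def oriented_cycle_def acyclic_mutation_def)
  qed
  show "is_mutation V k Q ?Q'"
    unfolding is_mutation_def
  proof (intro conjI ballI impI)
    show "is_quiver V ?Q'" by (rule is_quiver_acyclic_mutation[OF assms])
    show "signed_root Q i j k + signed_root ?Q' i j k = sqrt (Q i k * Q k j)"
      if "Q i k > 0 \<and> Q k j > 0" for i j using roots(1)[of i j] that by simp
  qed (auto simp: acyclic_mutation_def)
  show "is_mutation V k ?Q' Q"
    unfolding is_mutation_def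
  proof (intro conjI ballI impI)
    show "signed_root ?Q' i j k + signed_root Q i j k = sqrt (?Q' i k * ?Q' k j)"
      if "?Q' i k > 0 \<and> ?Q' k j > 0" for i j
      using roots(2)[of j i] that by (simp add: acyclic_mutation_def mult.commute)
  qed (use quiver in \<open>auto simp: acyclic_mutation_def\<close>)
qed

text \<open>A path of length two never closes to a triangle because the vertices carry a level that changes by
exactly one along each edge.\<close>

lemma diagram_level:
  "\<exists>c. \<forall>i j. diagram X n i j \<noteq> 0 \<longrightarrow> (c i :: nat) = c j + 1 \<or> c j = c i + 1"
  by (rule exI[of _ "\<lambda>i. if X = TypeD \<and> i = 0 then 1 else i"], cases X)
     (auto simp: diagram_def split: if_split_asm)

lemma diagram_no_triangle:
  assumes "diagram X n i k \<noteq> 0" "diagram X n k j \<noteq> 0"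
  shows "diagram X n i j = 0"
proof (rule ccontr)
  obtain c :: "nat \<Rightarrow> nat" where c: "\<And>i j. diagram X n i j \<noteq> 0 \<Longrightarrow> c i = c j + 1 \<or> c j = c i + 1"
    using diagram_level by metis
  assume "diagram X n i j \<noteq> 0"
  then show False using c[OF assms(1)] c[OF assms(2)] c[of i j] by presburger
qed

lemma delta_quiver_mutation:
  assumes Q: "delta_quiver X n Q" and k: "k \<in> vertices X n"
  shows "is_mutation (vertices X n) k Q (acyclic_mutation k Q)"
    and "is_mutation (vertices X n) k (acyclic_mutation k Q) Q"
proof -
  have q: "is_quiver (vertices X n) Q"
    and w: "\<And>i j. i \<in> vertices X n \<Longrightarrow> j \<in> vertices X n \<Longrightarrow> Q i j + Q j i = diagram X n i j"
    using Q unfolding delta_quiver_def edge_weight_def by auto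
  have "Q i j = 0 \<and> Q j i = 0" if "Q i k > 0" "Q k j > 0" for i j
  proof -
    have V: "i \<in> vertices X n" "j \<in> vertices X n" using that is_quiver_cases(3,4)[OF q] by force+
    then have "diagram X n i k \<noteq> 0" "diagram X n k j \<noteq> 0"
      using w[of i k] w[of k j] k that by auto
    then show ?thesis using diagram_no_triangle[of X n i k j] w[of i j] V by simp
  qed
  from mutation_there_and_back[OF q k this]
  show "is_mutation (vertices X n) k Q (acyclic_mutation k Q)"
    and "is_mutation (vertices X n) k (acyclic_mutation k Q) Q" by auto
qed

section \<open>Signed transpositions in Coxeter groups of type B\<close>

text \<open>The Coxeter relations of type \<open>B\<^sub>n\<close> for maps of a set into itself: \<open>s 1, \<dots>, s (n - 1)\<close> form the simple
chain and \<open>d\<close> is the generator at its end, joined to \<open>s 1\<close> by the double edge. The identity is allowed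
for \<open>d\<close>, so that a symmetric group is an instance as well.\<close>

locale signed_chain =
  fixes n :: nat and s :: "nat \<Rightarrow> 'a \<Rightarrow> 'a" and d :: "'a \<Rightarrow> 'a"
  assumes s_invol: "1 \<le> i \<Longrightarrow> i < n \<Longrightarrow> s i (s i x) = x"
    and s_comm: "1 \<le> i \<Longrightarrow> i + 1 < j \<Longrightarrow> j < n \<Longrightarrow> s i (s j x) = s j (s i x)"
    and s_braid: "1 \<le> i \<Longrightarrow> i + 1 < n \<Longrightarrow>
      s i (s (i + 1) (s i x)) = s (i + 1) (s i (s (i + 1) x))"
    and d_invol: "d (d x) = x"
    and d_comm: "2 \<le> i \<Longrightarrow> i < n \<Longrightarrow> d (s i x) = s i (d x)"
    and d_s1: "1 < n \<Longrightarrow> d (s 1 (d (s 1 x))) = s 1 (d (s 1 (d x)))"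
begin

lemma s_comm': "1 \<le> i \<Longrightarrow> i < n \<Longrightarrow> 1 \<le> j \<Longrightarrow> j < n \<Longrightarrow> i + 1 < j \<or> j + 1 < i \<Longrightarrow>
    s i (s j x) = s j (s i x)"
  using s_comm by metis

lemma conj_far:
  assumes base: "\<And>i x. m < i \<Longrightarrow> i < n \<Longrightarrow> s i (y m x) = y m (s i x)"
    and step: "\<And>a x. m \<le> a \<Longrightarrow> a < n \<Longrightarrow> y (Suc a) x = s a (y a (s a x))"
    and "1 \<le> m" "m \<le> a" "a < i" "i < n"
  shows "s i (y a x) = y a (s i x)"
  using \<open>m \<le> a\<close> \<open>a < i\<close>
proof (induction a arbitrary: x rule: nat_induct_at_least)
  case base
  then show ?case using assms(1) \<open>i < n\<close> by auto
next
  case (Suc a)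
  then show ?case using \<open>1 \<le> m\<close> \<open>i < n\<close> by (simp add: step s_comm'[of i a])
qed

text \<open>A family obtained by conjugating \<open>y m\<close> along the chain is permuted by the chain as its indices are. The
braid relation enters for \<open>y (i + 2)\<close>, the conjugate of \<open>y i\<close> by \<open>s (i + 1) s i\<close>: there \<open>s i\<close> passes to
the right of this product and becomes \<open>s (i + 1)\<close>, which commutes with \<open>y i\<close>. Both the sign changes and,
for fixed \<open>a\<close>, the transpositions of \<open>a\<close> and \<open>b\<close> are such families.\<close>

lemma conj_step:
  assumes base: "\<And>i x. m < i \<Longrightarrow> i < n \<Longrightarrow> s i (y m x) = y m (s i x)"
    and step: "\<And>a x. m \<le> a \<Longrightarrow> a < n \<Longrightarrow> y (Suc a) x = s a (y a (s a x))"
    and "1 \<le> m" "m \<le> a" "a \<le> n" "m \<le> i" "i < n"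
  shows "s i (y a (s i x)) = y (transpose i (Suc i) a) x"
  using \<open>m \<le> a\<close> \<open>a \<le> n\<close>
proof (induction a arbitrary: x rule: nat_induct_at_least)
  case base
  then show ?case
    using conj_far[OF assms(1,2), of m i] step[of m] s_invol[of i] assms by (cases "i = m") auto
next
  case (Suc a)
  have ya: "y (Suc a) x = s a (y a (s a x))" for x using Suc step by auto
  consider "i + 1 < a" | "i + 1 = a" | "i = a" | "i = Suc a" | "i > Suc a" by linarith
  then show ?case
  proof cases
    case 1
    then have c: "s i (s a x) = s a (s i x)" for x using Suc s_comm'[of i a] assms by auto
    have IH: "s i (y a (s i x)) = y a x" for x using 1 Suc by simp
    have "s i (y (Suc a) (s i x)) = s a (s i (y a (s i (s a x))))"
      by (simp only: ya c)
    then show ?thesis using 1 by (simp add: IH ya)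
  next
    case 2
    have yi: "y a x = s i (y i (s i x))" for x using 2 step[of i] assms by auto
    have far: "s a (y i x) = y i (s a x)" for x
      using conj_far[OF assms(1,2), of i a] 2 Suc assms by auto
    have braid: "s i (s a (s i x)) = s a (s i (s a x))" for x
      using s_braid[of i] 2 Suc assms by auto
    have "s i (y (Suc a) (s i x)) = s i (s a (s i (y i (s i (s a (s i x))))))"
      by (simp add: ya yi)
    also have "\<dots> = s a (s i (s a (s a (y i (s i (s a x))))))"
      by (simp only: braid far)
    also have "\<dots> = y (Suc a) x"
      using assms Suc by (simp add: ya yi s_invol)
    finally show ?thesis using 2 by auto
  next
    case 3
    then show ?thesis using ya assms by (simp add: s_invol)
  next
    case 4
    then show ?thesis using step[of "Suc a"] Suc assms by simp
  next
    case 5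
    then show ?thesis using conj_far[OF assms(1,2), of "Suc a" i] s_invol assms Suc by simp
  qed
qed

text \<open>The transposition of \<open>a\<close> and \<open>b\<close> for \<open>a < b\<close>, as a conjugate of \<open>s a\<close> along the chain.\<close>

fun swap_lt :: "nat \<Rightarrow> nat \<Rightarrow> 'a \<Rightarrow> 'a" where
  "swap_lt a 0 = id"
| "swap_lt a (Suc b) = (if b \<le> a then s a else s b \<circ> swap_lt a b \<circ> s b)"

definition swap :: "nat \<Rightarrow> nat \<Rightarrow> 'a \<Rightarrow> 'a" where
  "swap a b = swap_lt (min a b) (max a b)"

lemma swap_sym: "swap a b = swap b a"
  by (simp add: swap_def min.commute max.commute)

lemma swap_Suc: "swap a (Suc a) = s a"
  by (simp add: swap_def)

lemma swap_step: "a < b \<Longrightarrow> swap a (Suc b) x = s b (swap a b (s b x))"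
  by (simp add: swap_def)

text \<open>The transposition of \<open>a\<close> and \<open>b\<close> is defined by moving \<open>b\<close>; it can also be reached by moving \<open>a\<close>. For
\<open>b = a + 2\<close> this is the braid relation, and further steps commute with \<open>s a\<close>.\<close>

lemma swap_shift:
  assumes "1 \<le> a" "a + 2 \<le> b" "b \<le> n"
  shows "s a (swap a b (s a x)) = swap (Suc a) b x"
  using assms(2,3)
proof (induction b arbitrary: x rule: nat_induct_at_least)
  case base
  then show ?case
    using s_braid[of a] \<open>1 \<le> a\<close> swap_step[of a "Suc a"] by (simp add: swap_Suc s_invol)
next
  case (Suc b)
  then have c: "s a (s b x) = s b (s a x)" for x using s_comm'[of a b] assms by auto
  have IH: "s a (swap a b (s a x)) = swap (Suc a) b x" for x using Suc by simp
  have "s a (swap a (Suc b) (s a x)) = s a (s b (swap a b (s b (s a x))))"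
    using Suc swap_step[of a b] by simp
  also have "\<dots> = s b (s a (swap a b (s a (s b x))))"
    by (simp only: c)
  finally show ?case using IH Suc swap_step[of "Suc a" b] by simp
qed

lemma swap_conj_lt:
  assumes ab: "1 \<le> a" "a < b" "b \<le> n" and i: "1 \<le> i" "i < n"
  shows "s i (swap a b (s i x)) = swap (transpose i (Suc i) a) (transpose i (Suc i) b) x"
proof -
  consider "Suc i < a" | "Suc i = a" | "i = a" "b = Suc a" | "i = a" "a + 2 \<le> b" | "a < i"
    using ab by linarith
  then show ?thesis
  proof cases
    case 1
    have "s i (swap a b (s i x)) = swap a b x" for x using Suc_leI[OF \<open>a < b\<close>] \<open>b \<le> n\<close>
    proof (induction b arbitrary: x rule: nat_induct_at_least)
      case base
      then show ?case using 1 i s_comm[of i a] s_invol[of i] by (simp add: swap_Suc)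
    next
      case (Suc b)
      then have b: "a < b" "Suc b \<le> n" and IH: "s i (swap a b (s i x)) = swap a b x" for x
        by auto
      have c: "s i (s b x) = s b (s i x)" for x using s_comm[of i b] i 1 b by simp
      have "s i (swap a (Suc b) (s i x)) = s i (s b (swap a b (s b (s i x))))"
        using b by (simp add: swap_step)
      also have "\<dots> = s b (s i (swap a b (s i (s b x))))" by (simp only: c)
      finally show ?case
        using b by (simp add: IH swap_step)
    qed
    then show ?thesis using 1 ab by simp
  next
    case 2
    then have "swap a b x = s i (swap i b (s i x))" for x
      using swap_shift[of i b] ab i by auto
    then show ?thesis using 2 ab i by (simp add: s_invol)
  next
    case 3
    then show ?thesis using i by (simp add: swap_Suc s_invol swap_sym[of "Suc a" a])
  next
    case 4
    then show ?thesis using ab swap_shift[of a b] by simp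
  next
    case 5
    have "s i (swap a b (s i x)) = swap a (transpose i (Suc i) b) x"
    proof (rule conj_step[where m = "Suc a"])
      show "s i (swap a (Suc a) x) = swap a (Suc a) (s i x)" if "Suc a < i" "i < n" for i x
        using that ab s_comm[of a i] by (simp add: swap_Suc)
    qed (use 5 ab i in \<open>auto simp: swap_step\<close>)
    then show ?thesis using 5 ab by simp
  qed
qed

lemma swap_conj:
  assumes "1 \<le> a" "a \<le> n" "1 \<le> b" "b \<le> n" "a \<noteq> b" "1 \<le> i" "i < n"
  shows "s i (swap a b (s i x)) = swap (transpose i (Suc i) a) (transpose i (Suc i) b) x"
  using swap_conj_lt[of a b i x] swap_conj_lt[of b a i x] assms
  by (cases "a < b") (auto simp: swap_sym)

text \<open>The sign change of the coordinate \<open>a\<close>; the value at \<open>0\<close> is a default.\<close>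

fun neg :: "nat \<Rightarrow> 'a \<Rightarrow> 'a" where
  "neg 0 = id"
| "neg (Suc a) = (if a = 0 then d else s a \<circ> neg a \<circ> s a)"

lemma neg_1: "neg (Suc 0) = d"
  by simp

lemma neg_step: "1 \<le> a \<Longrightarrow> neg (Suc a) x = s a (neg a (s a x))"
  by simp

declare neg.simps(2) [simp del]

lemma neg_conj:
  assumes "1 \<le> a" "a \<le> n" "1 \<le> i" "i < n"
  shows "s i (neg a (s i x)) = neg (transpose i (Suc i) a) x"
  by (rule conj_step[where m = 1]) (use assms in \<open>auto simp: neg_step neg_1 d_comm\<close>)

lemma neg_invol:
  assumes "1 \<le> a" "a \<le> n"
  shows "neg a (neg a x) = x"
  using assms
  by (induction a arbitrary: x rule: nat_induct_at_least) (auto simp: neg_1 neg_step d_invol s_invol)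

text \<open>For \<open>a = 2\<close> this is the relation of length four between \<open>d\<close> and \<open>s 1\<close>; conjugation by \<open>s a\<close> with
\<open>a \<ge> 2\<close> then carries it along the chain.\<close>

lemma d_neg_comm:
  assumes "1 \<le> a" "a \<le> n"
  shows "d (neg a x) = neg a (d x)"
  using assms
proof (induction a arbitrary: x rule: nat_induct_at_least)
  case base
  then show ?case by (simp add: neg_1)
next
  case (Suc a)
  show ?case
  proof (cases "a = 1")
    case True
    then show ?thesis using d_s1 Suc by (simp add: neg_1 neg_step)
  next
    case False
    then show ?thesis using Suc d_comm[of a] by (simp add: neg_step)
  qed
qed

lemma d_swap:
  assumes "2 \<le> a" "a < b" "b \<le> n"
  shows "d (swap a b (d x)) = swap a b x"
  using Suc_leI[OF assms(2)] assms(3)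
proof (induction b arbitrary: x rule: nat_induct_at_least)
  case base
  then show ?case using assms d_comm[of a] by (simp add: swap_Suc d_invol)
next
  case (Suc b)
  then have c: "d (s b x) = s b (d x)" for x using assms by (simp add: d_comm)
  have "d (swap a (Suc b) (d x)) = d (s b (swap a b (s b (d x))))"
    using Suc by (simp add: swap_step)
  also have "\<dots> = s b (d (swap a b (d (s b x))))" by (simp only: c)
  finally show ?case using Suc by (simp add: swap_step)
qed

lemma neg_swap_disjoint:
  assumes "1 \<le> c" "c \<le> n" "1 \<le> a" "a \<le> n" "1 \<le> b" "b \<le> n" "a \<noteq> b" "c \<noteq> a" "c \<noteq> b"
  shows "neg c (swap a b (neg c x)) = swap a b x"
  using assms
proof (induction c arbitrary: a b x rule: nat_induct_at_least)
  case base
  then show ?case using d_swap[of a b x] d_swap[of b a x]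
    by (cases "a < b") (auto simp: neg_1 swap_sym)
next
  case (Suc c)
  let ?a = "transpose c (Suc c) a" and ?b = "transpose c (Suc c) b"
  have *: "s c (swap a b (s c x)) = swap ?a ?b x" for x using swap_conj[of a b c] Suc by simp
  have *: "s c (swap ?a ?b (s c x)) = swap a b x"
      "neg c (swap ?a ?b (neg c x)) = swap ?a ?b x" for x
  proof -
    show "s c (swap ?a ?b (s c x)) = swap a b x"
      using *[of "s c x", symmetric] s_invol Suc by simp
    show "neg c (swap ?a ?b (neg c x)) = swap ?a ?b x"
      by (rule Suc.IH) (use Suc in \<open>auto simp: transpose_def\<close>)
  qed
  have **: "swap ?a ?b x = s c (swap a b (s c x))" for x using swap_conj[of a b c] Suc by simp
  have "neg (Suc c) (swap a b (neg (Suc c) x)) = s c (neg c (s c (swap a b (s c (neg c (s c x))))))"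
    using Suc by (simp add: neg_step)
  also have "\<dots> = swap a b x" by (simp only: **[symmetric] *)
  finally show ?case .
qed

text \<open>Conjugating a transposition by the sign change of either of its two points gives the same element. For
the pair \<open>(1, 2)\<close> this is the relation of length four, and the chain moves this pair to any other.\<close>

lemma neg_swap_sym:
  assumes "1 \<le> a" "a \<le> n" "1 \<le> b" "b \<le> n" "a \<noteq> b"
  shows "neg a (swap a b (neg a x)) = neg b (swap a b (neg b x))"
proof -
  let ?P = "\<lambda>a b. \<forall>x. neg a (swap a b (neg a x)) = neg b (swap a b (neg b x))"
  have move: "?P (transpose i (Suc i) a) (transpose i (Suc i) b)"
    if "?P a b" "1 \<le> a" "a \<le> n" "1 \<le> b" "b \<le> n" "a \<noteq> b" "1 \<le> i" "i < n" for a b i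
  proof
    fix x
    let ?t = "transpose i (Suc i)"
    have eqs: "neg (?t a) x = s i (neg a (s i x))" "neg (?t b) x = s i (neg b (s i x))"
      "swap (?t a) (?t b) x = s i (swap a b (s i x))" "s i (s i x) = x" for x
      using that neg_conj[of a i x] neg_conj[of b i x] swap_conj[of a b i x] s_invol[of i x] by auto
    show "neg (?t a) (swap (?t a) (?t b) (neg (?t a) x)) =
        neg (?t b) (swap (?t a) (?t b) (neg (?t b) x))"
      by (simp only: eqs that(1))
  qed
  have P1: "?P 1 b" if "2 \<le> b" "b \<le> n" for b
    using that
  proof (induction b rule: nat_induct_at_least)
    case base
    then have inv: "s 1 (s 1 x) = x" for x using s_invol[of 1] by simp
    have "s 1 (d (s 1 (d (s 1 x)))) = d (s 1 (d x))" for x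
    proof -
      have "s 1 (d (s 1 (d (s 1 x)))) = d (s 1 (d (s 1 (s 1 x))))"
        using d_s1[of "s 1 x"] base by simp
      then show ?thesis by (simp only: inv)
    qed
    moreover have "neg 2 x = s 1 (d (s 1 x))" for x
      using neg_step[of 1] by (simp add: neg_1 numeral_2_eq_2)
    moreover have "swap 1 2 = s 1" using swap_Suc[of 1] by (simp add: numeral_2_eq_2)
    moreover have "neg 1 = d" by (simp add: neg_1)
    ultimately show ?case by (simp only: inv simp_thms)
  next
    case (Suc b)
    then show ?case using move[of 1 b b] by simp
  qed
  have P: "?P a b" if "1 \<le> a" "a < b" "b \<le> n" for a b
    using that
  proof (induction a rule: nat_induct_at_least)
    case base
    then show ?case using P1[of b] by simp
  next
    case (Suc a)
    then show ?case using move[of a b a] by simp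
  qed
  show ?thesis
    using P[of a b] P[of b a] assms by (cases "a < b") (auto simp: swap_sym)
qed

text \<open>The reflection in \<open>e\<^sub>a - e\<^sub>b\<close> if \<open>p\<close> holds and in \<open>e\<^sub>a + e\<^sub>b\<close> otherwise.\<close>

definition sswap :: "bool \<Rightarrow> nat \<Rightarrow> nat \<Rightarrow> 'a \<Rightarrow> 'a" where
  "sswap p a b = (if p then swap a b else neg a \<circ> swap a b \<circ> neg a)"

lemma sswap_sym:
  assumes "1 \<le> a" "a \<le> n" "1 \<le> b" "b \<le> n" "a \<noteq> b"
  shows "sswap p a b = sswap p b a"
  using neg_swap_sym[OF assms] by (auto simp: sswap_def swap_sym[of b a])

lemma sswap_conj:
  assumes "1 \<le> a" "a \<le> n" "1 \<le> b" "b \<le> n" "a \<noteq> b" "1 \<le> i" "i < n"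
  shows "s i (sswap p a b (s i x)) = sswap p (transpose i (Suc i) a) (transpose i (Suc i) b) x"
proof -
  let ?t = "transpose i (Suc i)"
  have eqs: "neg (?t a) x = s i (neg a (s i x))"
    "swap (?t a) (?t b) x = s i (swap a b (s i x))" "s i (s i x) = x" for x
    using assms neg_conj[of a i x] swap_conj[of a b i x] s_invol[of i x] by auto
  show ?thesis by (simp add: sswap_def eqs)
qed

lemma sswap_d:
  assumes "1 \<le> a" "a \<le> n" "1 \<le> b" "b \<le> n" "a \<noteq> b"
  shows "d (sswap p a b (d x)) = sswap (p = (a \<noteq> 1 \<and> b \<noteq> 1)) a b x"
proof -
  have one: "d (sswap p 1 b (d x)) = sswap (\<not> p) 1 b x" if "2 \<le> b" "b \<le> n" for b x
    using that by (simp add: sswap_def neg_1 d_invol)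
  have none: "d (sswap p a b (d x)) = sswap p a b x"
    if "2 \<le> a" "a \<le> n" "2 \<le> b" "b \<le> n" "a \<noteq> b" for a b x
  proof -
    have "d (swap a b (d x)) = swap a b x" for x
      using d_swap[of a b x] d_swap[of b a x] that by (cases "a < b") (auto simp: swap_sym)
    moreover have c: "d (neg a x) = neg a (d x)" for x using that d_neg_comm[of a] by simp
    have "d (neg a (swap a b (neg a (d x)))) = neg a (d (swap a b (d (neg a x))))"
      by (simp only: c)
    ultimately show ?thesis by (simp add: sswap_def)
  qed
  consider "a = 1" | "b = 1" | "a \<noteq> 1" "b \<noteq> 1" by blast
  then show ?thesis
  proof cases
    case 1
    then show ?thesis using one[of b x] assms by simp
  next
    case 2
    then show ?thesis using one[of a x] assms sswap_sym[of a b] by simp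
  next
    case 3
    then show ?thesis using none[of a b x] assms by simp
  qed
qed

text \<open>The counterpart of \<open>conj_step\<close> for a family growing downwards from \<open>y n\<close>. It reduces to that lemma once
\<open>y 1\<close> is known to commute with \<open>s 2, \<dots>, s (n - 1)\<close>; for \<open>y a\<close> and \<open>s (a + 1)\<close> this is a braid
relation, as \<open>y (a + 2)\<close> commutes with \<open>s a\<close>.\<close>

lemma conj_down:
  assumes base: "\<And>i x. 1 \<le> i \<Longrightarrow> i + 1 < n \<Longrightarrow> s i (y n x) = y n (s i x)"
    and step: "\<And>a x. 1 \<le> a \<Longrightarrow> a < n \<Longrightarrow> y a x = s a (y (Suc a) (s a x))"
    and "1 \<le> a" "a \<le> n" "1 \<le> i" "i < n"
  shows "s i (y a (s i x)) = y (transpose i (Suc i) a) x"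
proof (rule conj_step[where m = 1])
  have low: "s i (y a x) = y a (s i x)" if "1 \<le> i" "i + 1 < a" "a \<le> n" for i a x
    using \<open>a \<le> n\<close> that(1,2)
  proof (induction a arbitrary: x rule: inc_induct)
    case base
    then show ?case using assms(1) by simp
  next
    case (step a)
    then show ?case using s_comm[of i a] assms(2)[of a] by simp
  qed
  have high: "s i (y a x) = y a (s i x)" if "1 \<le> a" "a < i" "i < n" for i a x
  proof -
    have "a \<le> i - 1" using that by simp
    then show ?thesis using that
    proof (induction a arbitrary: x rule: inc_induct)
      case base
      obtain a where i: "i = Suc a" using \<open>1 \<le> a\<close> \<open>a < i\<close> by (cases i) auto
      have a: "1 \<le> a" "Suc a < n" using base i by auto
      have y: "y a x = s a (s i (y (Suc i) (s i (s a x))))" for x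
      proof -
        have "y a x = s a (y i (s a x))" for x
          using assms(2)[of a] a unfolding i by simp
        moreover have "y i x = s i (y (Suc i) (s i x))" for x
          using assms(2)[of i] a i by simp
        ultimately show ?thesis by simp
      qed
      have far: "s a (y (Suc i) x) = y (Suc i) (s a x)" for x
        by (rule low) (use a i in simp_all)
      have braid: "s i (s a (s i x)) = s a (s i (s a x))" for x
        using s_braid[of a x] a unfolding i by simp
      have "s i (y a x) = s i (s a (s i (y (Suc i) (s i (s a x)))))" by (simp add: y)
      also have "\<dots> = s a (s i (y (Suc i) (s a (s i (s a x)))))" by (simp only: braid far)
      also have "\<dots> = s a (s i (y (Suc i) (s i (s a (s i x)))))" by (simp only: braid)
      also have "\<dots> = y a (s i x)" by (simp add: y)
      finally show ?case by (simp add: i)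
    next
      case (step a)
      then have "s i (s a x) = s a (s i x)" for x using s_comm[of a i] by simp
      then show ?case using step assms(2)[of a] by simp
    qed
  qed
  show "s i (y 1 x) = y 1 (s i x)" if "1 < i" "i < n" for i x
    using high[of 1 i] that by simp
  show "y (Suc a) x = s a (y a (s a x))" if "1 \<le> a" "a < n" for a x
    using that step by (simp add: s_invol)
qed (use assms in auto)

end

section \<open>Presented inverse monoids\<close>

lemma words_Nil [simp]: "[] \<in> words V"
  by (simp add: words_def)

lemma words_Cons [simp]: "x # u \<in> words V \<longleftrightarrow> x \<in> Gen ` V \<union> GenInv ` V \<and> u \<in> words V"
  by (simp add: words_def)

lemma words_append [simp]: "u @ v \<in> words V \<longleftrightarrow> u \<in> words V \<and> v \<in> words V"
  by (simp add: words_def)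

lemma words_word_inv: "u \<in> words V \<Longrightarrow> word_inv u \<in> words V"
  by (induction u) (auto simp: word_inv_def)

lemma words_gens [simp]: "gens xs \<in> words V \<longleftrightarrow> set xs \<subseteq> V"
  by (induction xs) (auto simp: gens_def)

lemma pres_eq_words: "pres_eq V R u v \<Longrightarrow> u \<in> words V \<and> v \<in> words V"
  by (induction rule: pres_eq.induct) (auto simp: words_word_inv)

locale inverse_presentation =
  fixes V :: "nat set" and R :: "(word \<times> word) set"
begin

abbreviation "cl \<equiv> word_class V R"
abbreviation "PM \<equiv> presented_inverse_monoid V R"

lemma cl_eq_iff:
  assumes "u \<in> words V"
  shows "cl u = cl v \<longleftrightarrow> pres_eq V R u v"
proof
  assume "cl u = cl v"
  then have "u \<in> cl v" using pres_eq.refl[OF assms, of R] by (auto simp: word_class_def)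
  then show "pres_eq V R u v" by (simp add: word_class_def pres_eq.sym)
next
  assume uv: "pres_eq V R u v"
  have "pres_eq V R u w \<longleftrightarrow> pres_eq V R v w" for w
    using pres_eq.trans[OF uv, of w] pres_eq.trans[OF pres_eq.sym[OF uv], of w] by blast
  then show "cl u = cl v" by (simp add: word_class_def)
qed

lemma carrier_PM: "carrier PM = cl ` words V"
  by (simp add: presented_inverse_monoid_def)

lemma cl_in_carrier [simp]: "u \<in> words V \<Longrightarrow> cl u \<in> carrier PM"
  by (simp add: carrier_PM)

lemma cl_mult [simp]:
  assumes "u \<in> words V" "v \<in> words V"
  shows "cl u \<otimes>\<^bsub>PM\<^esub> cl v = cl (u @ v)"
proof -
  have "cl (u' @ v') = cl (u @ v)" if "u' \<in> cl u" "v' \<in> cl v" for u' v'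
  proof -
    have "pres_eq V R (u @ v) (u' @ v')"
      using that by (auto simp: word_class_def intro: pres_eq.cong)
    then show ?thesis using cl_eq_iff[of "u @ v" "u' @ v'"] assms by simp
  qed
  moreover have "u \<in> cl u" "v \<in> cl v"
    using assms by (auto simp: word_class_def intro: pres_eq.refl)
  ultimately have "(\<Union>u'\<in>cl u. \<Union>v'\<in>cl v. cl (u' @ v')) = cl (u @ v)"
    by blast
  then show ?thesis by (simp add: presented_inverse_monoid_def)
qed

lemma one_PM: "\<one>\<^bsub>PM\<^esub> = cl []"
  by (simp add: presented_inverse_monoid_def)

lemma monoid_PM: "monoid PM"
proof (rule monoidI)
  have rep: "\<exists>u\<in>words V. x = cl u" if "x \<in> carrier PM" for x
    using that unfolding carrier_PM by blast
  fix x y z assume xyz: "x \<in> carrier PM" "y \<in> carrier PM" "z \<in> carrier PM"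
  obtain u where u: "u \<in> words V" "x = cl u" using rep[OF xyz(1)] by blast
  obtain v where v: "v \<in> words V" "y = cl v" using rep[OF xyz(2)] by blast
  obtain w where w: "w \<in> words V" "z = cl w" using rep[OF xyz(3)] by blast
  show "x \<otimes>\<^bsub>PM\<^esub> y \<in> carrier PM" "\<one>\<^bsub>PM\<^esub> \<otimes>\<^bsub>PM\<^esub> x = x" "x \<otimes>\<^bsub>PM\<^esub> \<one>\<^bsub>PM\<^esub> = x"
    "x \<otimes>\<^bsub>PM\<^esub> y \<otimes>\<^bsub>PM\<^esub> z = x \<otimes>\<^bsub>PM\<^esub> (y \<otimes>\<^bsub>PM\<^esub> z)"
    unfolding u v w one_PM using u v w by simp_all
qed (simp add: one_PM)

lemma cl_rep:
  assumes "P \<in> carrier PM"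
  shows "(SOME u. u \<in> P) \<in> words V" "cl (SOME u. u \<in> P) = P"
proof -
  obtain w where w: "w \<in> words V" "P = cl w" using assms by (auto simp: carrier_PM)
  then have "w \<in> P" by (auto simp: word_class_def intro: pres_eq.refl)
  then have "pres_eq V R w (SOME u. u \<in> P)"
    using w by (metis mem_Collect_eq someI word_class_def)
  then show "(SOME u. u \<in> P) \<in> words V" "cl (SOME u. u \<in> P) = P"
    using w cl_eq_iff pres_eq_words by (auto intro: pres_eq.sym)
qed

text \<open>In an inverse monoid both involutions and idempotents are their own inverses. The idempotent case needs
Wagner's second relation, here for \<open>u u\<^sup>-\<close> and \<open>u\<^sup>- u\<close>.\<close>

lemma cl_GenInv:
  assumes i: "i \<in> V" and sq: "cl [Gen i, Gen i] = cl [] \<or> cl [Gen i, Gen i] = cl [Gen i]"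
  shows "cl [GenInv i] = cl [Gen i]"
proof -
  interpret monoid PM by (rule monoid_PM)
  define a b where "a = cl [Gen i]" and "b = cl [GenInv i]"
  have ab [simp]: "a \<in> carrier PM" "b \<in> carrier PM" using i by (auto simp: a_def b_def)
  have aba: "a \<otimes>\<^bsub>PM\<^esub> b \<otimes>\<^bsub>PM\<^esub> a = a" and bab: "b \<otimes>\<^bsub>PM\<^esub> a \<otimes>\<^bsub>PM\<^esub> b = b"
    using pres_eq.inv[of "[Gen i]" V R] pres_eq.inv[of "[GenInv i]" V R] i
    by (auto simp: a_def b_def cl_eq_iff word_inv_def)
  have comm: "a \<otimes>\<^bsub>PM\<^esub> b \<otimes>\<^bsub>PM\<^esub> (b \<otimes>\<^bsub>PM\<^esub> a) = b \<otimes>\<^bsub>PM\<^esub> a \<otimes>\<^bsub>PM\<^esub> (a \<otimes>\<^bsub>PM\<^esub> b)"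
    using pres_eq.idem_comm[of "[Gen i]" V "[GenInv i]" R] i
    by (auto simp: a_def b_def cl_eq_iff word_inv_def)
  have "a \<otimes>\<^bsub>PM\<^esub> a = \<one>\<^bsub>PM\<^esub> \<or> a \<otimes>\<^bsub>PM\<^esub> a = a" using sq i by (auto simp: a_def one_PM)
  then have "b = a"
  proof
    assume sq: "a \<otimes>\<^bsub>PM\<^esub> a = \<one>\<^bsub>PM\<^esub>"
    have "b = (a \<otimes>\<^bsub>PM\<^esub> a) \<otimes>\<^bsub>PM\<^esub> b \<otimes>\<^bsub>PM\<^esub> (a \<otimes>\<^bsub>PM\<^esub> a)" by (simp add: sq)
    also have "\<dots> = a \<otimes>\<^bsub>PM\<^esub> (a \<otimes>\<^bsub>PM\<^esub> b \<otimes>\<^bsub>PM\<^esub> a) \<otimes>\<^bsub>PM\<^esub> a" by (simp add: m_assoc)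
    also have "\<dots> = a" by (simp add: aba sq)
    finally show ?thesis .
  next
    assume sq: "a \<otimes>\<^bsub>PM\<^esub> a = a"
    (* b = (b a)(a b) = (a b)(b a), an expression that absorbs a on both sides *)
    have b: "b = (b \<otimes>\<^bsub>PM\<^esub> a) \<otimes>\<^bsub>PM\<^esub> (a \<otimes>\<^bsub>PM\<^esub> b)"
    proof -
      have "(b \<otimes>\<^bsub>PM\<^esub> a) \<otimes>\<^bsub>PM\<^esub> (a \<otimes>\<^bsub>PM\<^esub> b) = b \<otimes>\<^bsub>PM\<^esub> (a \<otimes>\<^bsub>PM\<^esub> a) \<otimes>\<^bsub>PM\<^esub> b"
        by (simp add: m_assoc)
      then show ?thesis by (simp add: sq bab)
    qed
    then have b': "b = a \<otimes>\<^bsub>PM\<^esub> b \<otimes>\<^bsub>PM\<^esub> (b \<otimes>\<^bsub>PM\<^esub> a)" by (simp add: comm)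
    have l: "a \<otimes>\<^bsub>PM\<^esub> b = b"
    proof -
      have "a \<otimes>\<^bsub>PM\<^esub> b = a \<otimes>\<^bsub>PM\<^esub> (a \<otimes>\<^bsub>PM\<^esub> b \<otimes>\<^bsub>PM\<^esub> (b \<otimes>\<^bsub>PM\<^esub> a))"
        by (rule arg_cong[OF b'])
      also have "\<dots> = (a \<otimes>\<^bsub>PM\<^esub> a) \<otimes>\<^bsub>PM\<^esub> b \<otimes>\<^bsub>PM\<^esub> (b \<otimes>\<^bsub>PM\<^esub> a)"
        by (simp only: m_assoc ab m_closed)
      finally show ?thesis unfolding sq b'[symmetric] .
    qed
    have r: "b \<otimes>\<^bsub>PM\<^esub> a = b"
    proof -
      have "b \<otimes>\<^bsub>PM\<^esub> a = (a \<otimes>\<^bsub>PM\<^esub> b \<otimes>\<^bsub>PM\<^esub> (b \<otimes>\<^bsub>PM\<^esub> a)) \<otimes>\<^bsub>PM\<^esub> a"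
        by (rule arg_cong[OF b', of "\<lambda>t. t \<otimes>\<^bsub>PM\<^esub> a"])
      also have "\<dots> = a \<otimes>\<^bsub>PM\<^esub> b \<otimes>\<^bsub>PM\<^esub> (b \<otimes>\<^bsub>PM\<^esub> (a \<otimes>\<^bsub>PM\<^esub> a))"
        by (simp only: m_assoc ab m_closed)
      finally show ?thesis unfolding sq b'[symmetric] .
    qed
    show ?thesis using aba unfolding l r .
  qed
  then show ?thesis by (simp add: a_def b_def)
qed

end

fun letter_map :: "(nat \<Rightarrow> nat) \<Rightarrow> letter \<Rightarrow> letter" where
  "letter_map f (Gen i) = Gen (f i)"
| "letter_map f (GenInv i) = GenInv (f i)"

context inverse_presentation
begin

lemma words_letter_map:
  assumes "\<And>i. i \<in> V \<Longrightarrow> f i \<in> V" "u \<in> words V"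
  shows "map (letter_map f) u \<in> words V"
  using assms(2) by (induction u) (auto simp: assms(1))

lemma word_inv_letter_map: "word_inv (map (letter_map f) u) = map (letter_map f) (word_inv u)"
proof -
  have "letter_inv (letter_map f x) = letter_map f (letter_inv x)" for x by (cases x) auto
  then show ?thesis by (simp add: word_inv_def rev_map)
qed

text \<open>A renaming of the generators induces an endomorphism as soon as it respects the defining relations,
since Wagner's relations are stable under any renaming.\<close>

lemma pres_eq_letter_map:
  assumes f: "\<And>i. i \<in> V \<Longrightarrow> f i \<in> V"
    and R: "\<And>u v. (u, v) \<in> R \<Longrightarrow> u \<in> words V \<Longrightarrow> v \<in> words V \<Longrightarrow>
      pres_eq V R (map (letter_map f) u) (map (letter_map f) v)"
    and "pres_eq V R u v"
  shows "pres_eq V R (map (letter_map f) u) (map (letter_map f) v)"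
  using assms(3)
proof (induction rule: pres_eq.induct)
  case (sym u v)
  then show ?case by (blast intro: pres_eq.sym)
next
  case (trans u v w)
  then show ?case by (blast intro: pres_eq.trans)
next
  case (inv u)
  then show ?case using pres_eq.inv[of "map (letter_map f) u"] words_letter_map[of f u] f
    by (simp add: word_inv_letter_map)
next
  case (idem_comm u v)
  then show ?case
    using pres_eq.idem_comm[of "map (letter_map f) u" V "map (letter_map f) v"]
      words_letter_map[of f u] words_letter_map[of f v] f
    by (simp add: word_inv_letter_map)
qed (simp_all add: R pres_eq.refl pres_eq.cong words_letter_map f)

lemma lift_cl:
  assumes "\<And>u v. pres_eq V R u v \<Longrightarrow> f u = f v" "u \<in> words V"
  shows "f (SOME w. w \<in> cl u) = f u"
proof -
  have "pres_eq V R u (SOME w. w \<in> cl u)"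
    using cl_rep(2)[of "cl u"] cl_eq_iff[OF assms(2)] assms(2) by (metis cl_in_carrier)
  then show ?thesis using assms(1) by simp
qed

end

section \<open>The automorphism group of a monoid\<close>

lemma (in monoid) auto_closed: "\<alpha> \<in> auto G \<Longrightarrow> x \<in> carrier G \<Longrightarrow> \<alpha> x \<in> carrier G"
  by (auto simp: auto_def hom_def)

lemma (in monoid) auto_mult:
  "\<alpha> \<in> auto G \<Longrightarrow> x \<in> carrier G \<Longrightarrow> y \<in> carrier G \<Longrightarrow> \<alpha> (x \<otimes> y) = \<alpha> x \<otimes> \<alpha> y"
  by (auto simp: auto_def hom_def)

lemma (in monoid) auto_inj:
  "\<alpha> \<in> auto G \<Longrightarrow> x \<in> carrier G \<Longrightarrow> y \<in> carrier G \<Longrightarrow> \<alpha> x = \<alpha> y \<longleftrightarrow> x = y"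
  by (auto simp: auto_def Bij_def bij_betw_def inj_on_def)

lemma (in monoid) auto_surj: "\<alpha> \<in> auto G \<Longrightarrow> \<alpha> ` carrier G = carrier G"
  by (auto simp: auto_def Bij_def bij_betw_def)

lemma (in monoid) auto_one:
  assumes "\<alpha> \<in> auto G"
  shows "\<alpha> \<one> = \<one>"
proof -
  obtain y where y: "y \<in> carrier G" "\<alpha> y = \<one>" by (metis auto_surj[OF assms] image_iff one_closed)
  have "\<alpha> \<one> = \<alpha> \<one> \<otimes> \<alpha> y" using y auto_closed[OF assms] by simp
  also have "\<dots> = \<alpha> y" using y auto_mult[OF assms, of \<one> y] by simp
  finally show ?thesis using y by simp
qed

lemma (in monoid) auto_Units:
  assumes "\<alpha> \<in> auto G" "g \<in> Units G"
  shows "\<alpha> g \<in> Units G" "\<alpha> (inv g) = inv (\<alpha> g)"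
proof -
  have "\<alpha> g \<otimes> \<alpha> (inv g) = \<one>" "\<alpha> (inv g) \<otimes> \<alpha> g = \<one>" "\<alpha> g \<in> carrier G" "\<alpha> (inv g) \<in> carrier G"
    using assms auto_closed[OF assms(1)] auto_one[OF assms(1)]
      auto_mult[OF assms(1), of g "inv g"] auto_mult[OF assms(1), of "inv g" g]
    by auto
  then show "\<alpha> g \<in> Units G" "\<alpha> (inv g) = inv (\<alpha> g)"
    by (auto simp: Units_def intro!: inv_unique' bexI[of _ "\<alpha> (inv g)"])
qed

text \<open>The theory of automorphism groups extends from groups to monoids: the inverse of a bijective
multiplicative map is multiplicative.\<close>

lemma (in monoid) subgroup_auto_monoid: "subgroup (auto G) (BijGroup (carrier G))"
proof (rule subgroup.intro)
  show "auto G \<subseteq> carrier (BijGroup (carrier G))"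
    by (force simp add: auto_def BijGroup_def)
  show "x \<otimes>\<^bsub>BijGroup (carrier G)\<^esub> y \<in> auto G" if "x \<in> auto G" "y \<in> auto G" for x y
    using that
    by (auto simp: BijGroup_def auto_def compose_Bij) (auto simp: hom_def compose_def Pi_iff)
  show "\<one>\<^bsub>BijGroup (carrier G)\<^esub> \<in> auto G"
    by (auto simp: BijGroup_def auto_def hom_def id_Bij)
  show "inv\<^bsub>BijGroup (carrier G)\<^esub> x \<in> auto G" if "x \<in> auto G" for x
  proof -
    have x: "x \<in> Bij (carrier G)" "x \<in> hom G G" using that by (auto simp: auto_def)
    have "inv_into (carrier G) x (a \<otimes> b) = inv_into (carrier G) x a \<otimes> inv_into (carrier G) x b"
      if "a \<in> carrier G" "b \<in> carrier G" for a b
      by (rule Bij_inv_into_lemma[of "carrier G" x]) (use x that in \<open>auto simp: hom_def\<close>)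
    then show ?thesis
      using x by (auto simp: auto_def inv_BijGroup restrict_inv_into_Bij hom_def Bij_inv_into_mem
        simp del: restrict_apply intro!: restrictI) (auto simp: Bij_inv_into_mem)
  qed
qed

lemma (in monoid) group_AutoGroup: "group (AutoGroup G)"
  by (simp add: AutoGroup_def subgroup.subgroup_is_group subgroup_auto_monoid group_BijGroup)

lemma (in monoid) AutoGroup_simps:
  "carrier (AutoGroup G) = auto G"
  "\<one>\<^bsub>AutoGroup G\<^esub> = (\<lambda>x\<in>carrier G. x)"
  "\<alpha> \<in> auto G \<Longrightarrow> \<beta> \<in> auto G \<Longrightarrow> \<alpha> \<otimes>\<^bsub>AutoGroup G\<^esub> \<beta> = compose (carrier G) \<alpha> \<beta>"
  by (auto simp: AutoGroup_def BijGroup_def auto_def)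

lemma (in monoid) auto_compose: "\<alpha> \<in> auto G \<Longrightarrow> \<beta> \<in> auto G \<Longrightarrow> compose (carrier G) \<alpha> \<beta> \<in> auto G"
  using group.is_monoid[OF group_AutoGroup, THEN monoid.m_closed, of \<alpha> \<beta>]
  by (simp add: AutoGroup_simps)

lemma (in monoid) auto_eqI:
  "\<alpha> \<in> auto G \<Longrightarrow> \<beta> \<in> auto G \<Longrightarrow> (\<And>x. x \<in> carrier G \<Longrightarrow> \<alpha> x = \<beta> x) \<Longrightarrow> \<alpha> = \<beta>"
  by (auto simp: auto_def Bij_def intro: extensionalityI)

lemma (in monoid) autoI:
  assumes "\<alpha> \<in> extensional (carrier G)" "\<And>x. x \<in> carrier G \<Longrightarrow> \<alpha> x \<in> carrier G"
    "\<And>x y. x \<in> carrier G \<Longrightarrow> y \<in> carrier G \<Longrightarrow> \<alpha> (x \<otimes> y) = \<alpha> x \<otimes> \<alpha> y"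
    "\<And>x. x \<in> carrier G \<Longrightarrow> \<beta> x \<in> carrier G \<and> \<alpha> (\<beta> x) = x \<and> \<beta> (\<alpha> x) = x"
  shows "\<alpha> \<in> auto G"
proof -
  have "bij_betw \<alpha> (carrier G) (carrier G)"
    by (rule bij_betw_byWitness[where f' = \<beta>]) (use assms in auto)
  then show ?thesis using assms by (auto simp: auto_def hom_def Bij_def)
qed

section \<open>The action on signed points\<close>

text \<open>A signed point is a nonzero integer, \<open>-p\<close> being the negative of \<open>p\<close>, and \<open>0\<close> stands for an undefined
value. Partial signed permutations thus become odd maps on the integers that fix \<open>0\<close>.\<close>

definition point_swap :: "nat \<Rightarrow> int \<Rightarrow> int" where
  "point_swap i p =
     (if p = int i then int i + 1 else if p = int i + 1 then int i
      else if p = - int i then - int i - 1 else if p = - int i - 1 then - int i else p)"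

definition point_neg :: "int \<Rightarrow> int" where
  "point_neg p = (if \<bar>p\<bar> = 1 then - p else p)"

definition point_kill :: "nat \<Rightarrow> int \<Rightarrow> int" where
  "point_kill j p = (if \<bar>p\<bar> = int j then 0 else p)"

text \<open>In type D the generator \<open>s 0\<close> is the reflection in \<open>e\<^sub>1 + e\<^sub>2\<close>, written as the conjugate of \<open>s 1\<close> by the
sign change of the first coordinate.\<close>

definition point_gen :: "diagram_type \<Rightarrow> nat \<Rightarrow> nat \<Rightarrow> int \<Rightarrow> int" where
  "point_gen X n i = (if i = n then point_kill n else if i \<noteq> 0 then point_swap i else
     (case X of TypeA \<Rightarrow> id | TypeB \<Rightarrow> point_neg
        | TypeD \<Rightarrow> point_neg \<circ> point_swap 1 \<circ> point_neg))"

fun letter_index :: "letter \<Rightarrow> nat" where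
  "letter_index (Gen i) = i"
| "letter_index (GenInv i) = i"

text \<open>Formal inverses are evaluated like the generators, because each generator acts as an involution or as
the identity of a subset.\<close>

definition point_word :: "diagram_type \<Rightarrow> nat \<Rightarrow> word \<Rightarrow> int \<Rightarrow> int" where
  "point_word X n = foldr (\<lambda>x. point_gen X n (letter_index x))"

lemma point_word_simps [simp]:
  "point_word X n [] p = p"
  "point_word X n (x # u) p = point_gen X n (letter_index x) (point_word X n u p)"
  "point_word X n (u @ v) p = point_word X n u (point_word X n v p)"
  by (simp_all add: point_word_def)

lemma point_word_inv_Cons:
  "point_word X n (word_inv (x # u)) p =
     point_word X n (word_inv u) (point_gen X n (letter_index x) p)"
  by (cases x) (simp_all add: word_inv_def)

lemma point_swap_invol: "1 \<le> i \<Longrightarrow> point_swap i (point_swap i p) = p"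
  by (auto simp: point_swap_def)

lemma point_neg_invol: "point_neg (point_neg p) = p"
  by (simp add: point_neg_def)

lemma point_swap_comm:
  "i + 1 < j \<Longrightarrow> point_swap i (point_swap j p) = point_swap j (point_swap i p)"
  by (auto simp: point_swap_def)

lemma point_swap_braid:
  assumes "1 \<le> i"
  shows "point_swap i (point_swap (i + 1) (point_swap i p)) =
    point_swap (i + 1) (point_swap i (point_swap (i + 1) p))"
proof -
  consider "p = int i" | "p = int i + 1" | "p = int i + 2"
    | "p = - int i" | "p = - int i - 1" | "p = - int i - 2"
    | "p \<notin> {int i, int i + 1, int i + 2, - int i, - int i - 1, - int i - 2}" by blast
  then show ?thesis using assms by cases (simp_all add: point_swap_def)
qed

lemma point_neg_comm: "2 \<le> i \<Longrightarrow> point_neg (point_swap i p) = point_swap i (point_neg p)"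
  by (auto simp: point_swap_def point_neg_def)

lemma point_neg_swap1:
  "point_neg (point_swap 1 (point_neg (point_swap 1 p))) =
     point_swap 1 (point_neg (point_swap 1 (point_neg p)))"
proof -
  consider "p = 1" | "p = 2" | "p = -1" | "p = -2" | "p \<notin> {1, 2, -1, -2}" by blast
  then show ?thesis by cases (simp_all add: point_swap_def point_neg_def)
qed

lemma point_swap_kill:
  assumes "1 \<le> m"
  shows "point_swap m (point_kill (Suc m) (point_swap m p)) = point_kill m p"
proof -
  consider "p = int m" | "p = int m + 1" | "p = - int m" | "p = - int m - 1"
    | "p \<notin> {int m, int m + 1, - int m, - int m - 1}" by blast
  then show ?thesis using assms by cases (auto simp: point_swap_def point_kill_def)
qed

definition point_d :: "diagram_type \<Rightarrow> int \<Rightarrow> int" where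
  "point_d X = (if X = TypeA then id else point_neg)"

lemma signed_chain_points: "signed_chain n point_swap (point_d X)"
proof
  show "point_swap i (point_swap j x) = point_swap j (point_swap i x)" if "i + 1 < j" for i j x
    using that by (rule point_swap_comm)
  show "point_swap i (point_swap (i + 1) (point_swap i x)) =
      point_swap (i + 1) (point_swap i (point_swap (i + 1) x))" if "1 \<le> i" for i x
    using that by (rule point_swap_braid)
  show "point_d X (point_swap 1 (point_d X (point_swap 1 x))) =
      point_swap 1 (point_d X (point_swap 1 (point_d X x)))" for x
    using point_neg_swap1 by (simp add: point_d_def)
qed (auto simp: point_d_def point_swap_invol point_neg_invol point_neg_comm)

lemma point_gen_zero: "i \<in> vertices X n \<Longrightarrow> point_gen X n i 0 = 0"
  by (cases X) (auto simp: point_gen_def vertices_def point_swap_def point_kill_def point_neg_def)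

lemma point_gen_invol:
  "i \<in> mutable X n \<Longrightarrow> point_gen X n i (point_gen X n i p) = p"
  by (cases X) (auto simp: point_gen_def point_swap_invol point_neg_invol)

text \<open>The set \<open>A\<close> is the range of the partial permutation \<open>u\<close>, and \<open>u u\<^sup>-\<close> acts as the identity of \<open>A\<close>. Wagner's
relations for the action follow at once from this description.\<close>

lemma point_word_proj:
  assumes "u \<in> words (vertices X n)"
  shows "\<exists>A. (\<forall>p. point_word X n u (point_word X n (word_inv u) p) = (if p \<in> A then p else 0)) \<and>
    (\<forall>p. point_word X n u p \<notin> A \<longrightarrow> point_word X n u p = 0)"
  using assms
proof (induction u)
  case Nil
  show ?case by (rule exI[of _ UNIV]) (simp add: word_inv_def)
next
  case (Cons x u)
  then obtain A where
      A: "\<And>p. point_word X n u (point_word X n (word_inv u) p) = (if p \<in> A then p else 0)"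
    and u: "\<And>p. point_word X n u p \<notin> A \<Longrightarrow> point_word X n u p = 0" by auto
  define i where "i = letter_index x"
  have i: "i \<in> vertices X n" using Cons.prems by (auto simp: i_def)
  show ?case
  proof (cases "i = n")
    case True
    show ?thesis
      by (rule exI[of _ "{p \<in> A. \<bar>p\<bar> \<noteq> int n}"])
         (auto simp: point_word_inv_Cons A True point_gen_def point_kill_def i_def[symmetric]
            dest: u split: if_splits)
  next
    case False
    then have m: "i \<in> mutable X n" using i by (auto simp: vertices_def)
    show ?thesis
      by (rule exI[of _ "{p. point_gen X n i p \<in> A}"])
         (auto simp: point_word_inv_Cons A i_def[symmetric] point_gen_zero[OF i]
            point_gen_invol[OF m] dest: u)
  qed
qed

text \<open>The relations specific to types B and D hold because \<open>s 1 \<cdots> s (n - 1) s n\<close> has no value \<open>\<plusminus>1\<close>, so that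
a sign change of the first coordinate after it has no effect, and because the conjugates of \<open>s n\<close> are the
maps killing one coordinate, which do not see signs.\<close>

lemma point_word_relations:
  assumes n: "2 \<le> n" "X = TypeD \<Longrightarrow> 4 \<le> n" and "(u, v) \<in> relations X n"
  shows "point_word X n u p = point_word X n v p"
proof -
  have gens: "point_word X n (gens xs) p = foldr (point_gen X n) xs p" for xs p
    by (induction xs) (auto simp: gens_def)
  have swap: "point_gen X n i = point_swap i" if "1 \<le> i" "i < n" for i
    using that by (simp add: point_gen_def)
  have less: "i < n" if "i \<in> mutable X n" for i using that by (cases X) auto
  have comm: "point_gen X n i (point_gen X n j p) = point_gen X n j (point_gen X n i p)"
    if "i \<in> mutable X n" "j \<in> mutable X n" "i < j" "diagram X n i j = 0" for i j p
  proof (cases "i = 0")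
    case False
    then have "i + 1 < j" using that less[of j] by (cases X; cases "j = i + 1") (auto simp: diagram_def)
    then show ?thesis using False less[of i] less[of j] that point_swap_comm[of i j p]
      by (simp add: point_gen_def)
  next
    case True
    have "X = TypeB \<and> 2 \<le> j \<or> X = TypeD \<and> (j = 1 \<or> 3 \<le> j)"
    proof (cases X)
      case TypeB
      then have "j \<noteq> 1" using that True n by (auto simp: diagram_def)
      then show ?thesis using that True TypeB by auto
    next
      case TypeD
      then have "j \<noteq> 2" using that True n by (auto simp: diagram_def)
      then show ?thesis using that True TypeD by auto
    qed (use that True in auto)
    then show ?thesis
      using True point_neg_swap1[of p] less[of j] that n point_swap_comm[of 1 j "point_neg p"]
      by (auto simp: point_gen_def point_neg_comm)
  qed
  have braid: "point_gen X n i (point_gen X n j (point_gen X n i p)) =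
      point_gen X n j (point_gen X n i (point_gen X n j p))"
    if "i \<in> mutable X n" "j \<in> mutable X n" "i < j" "diagram X n i j = 1" for i j p
  proof (cases "i = 0")
    case False
    then have "j = i + 1" using that less[of j] by (cases X) (auto simp: diagram_def split: if_splits)
    then show ?thesis using False less[of i] less[of j] that
      by (simp add: point_gen_def point_swap_braid[of i, simplified])
  next
    case True
    have "X = TypeD \<and> j = 2"
      using that True by (cases X) (auto simp: diagram_def split: if_splits)
    then show ?thesis using True point_swap_braid[of 1 "point_neg p"] n
      by (simp add: point_gen_def point_neg_invol point_neg_comm numeral_2_eq_2 flip: point_neg_comm)
  qed
  have braid4: "point_gen X n i (point_gen X n j (point_gen X n i (point_gen X n j p))) =
      point_gen X n j (point_gen X n i (point_gen X n j (point_gen X n i p)))"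
    if "i \<in> mutable X n" "j \<in> mutable X n" "i < j" "diagram X n i j \<noteq> 0" "diagram X n i j \<noteq> 1"
    for i j p
  proof -
    have "X = TypeB \<and> i = 0 \<and> j = 1"
      using that by (cases X) (auto simp: diagram_def split: if_splits)
    then show ?thesis using point_neg_swap1[of p] n by (simp add: point_gen_def)
  qed
  have abs_swap: "\<bar>point_swap i p\<bar> = transpose (int i) (int i + 1) \<bar>p\<bar>" for i p
    by (auto simp: point_swap_def transpose_def)
  \<comment> \<open>conjugating \<open>s n\<close> by \<open>s m \<cdots> s (n - 1)\<close> moves the killed coordinate from \<open>n\<close> to \<open>m\<close>\<close>
  have kill: "foldr (point_gen X n) [m..<n] (point_kill n (foldr (point_gen X n) (rev [m..<n]) p)) =
      point_kill m p" if "1 \<le> m" "m \<le> n" for m p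
    using \<open>m \<le> n\<close> \<open>1 \<le> m\<close>
  proof (induction m arbitrary: p rule: inc_induct)
    case (step m)
    then show ?case using point_swap_kill[of m p] by (simp add: upt_conv_Cons swap)
  qed simp
  \<comment> \<open>\<open>\<plusminus>1\<close> could only be the image of \<open>\<plusminus>n\<close>, where \<open>s n\<close> has no value\<close>
  have up: "\<bar>foldr (point_gen X n) [1..<n] (point_kill n p)\<bar> \<noteq> 1" for p
  proof -
    have "\<bar>p\<bar> = int m" if "\<bar>foldr (point_gen X n) [1..<m] p\<bar> = 1" "1 \<le> m" "m \<le> n" for m p
      using \<open>1 \<le> m\<close> that(1,3)
    proof (induction m arbitrary: p rule: nat_induct_at_least)
      case (Suc m)
      then have "\<bar>point_gen X n m p\<bar> = int m" by simp
      then show ?case using Suc by (auto simp: swap abs_swap transpose_eq_iff)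
    qed simp
    from this[of n "point_kill n p"] n show ?thesis
      by (auto simp: point_kill_def split: if_splits)
  qed
  have down: "\<bar>foldr (point_gen X n) (rev [1..<n]) p\<bar> = int n" if "\<bar>p\<bar> = 1" for p
  proof -
    have "\<bar>foldr (point_gen X n) (rev [1..<m]) p\<bar> = int m" if "1 \<le> m" "m \<le> n" for m
      using that
    proof (induction m rule: nat_induct_at_least)
      case (Suc m)
      then show ?case by (simp add: swap abs_swap)
    qed (use \<open>\<bar>p\<bar> = 1\<close> in simp)
    then show ?thesis using n by simp
  qed
  have spec: "point_word X n u p = point_word X n v p" if "(u, v) \<in> special_relations X n"
  proof (cases X)
    case TypeA
    then show ?thesis using that by simp
  next
    case TypeB
    have 0: "[0..<n] = 0 # [1..<n]" using n by (simp add: upt_conv_Cons)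
    have g0: "point_gen X n 0 = point_neg" and gn: "point_gen X n n = point_kill n"
      using TypeB n by (auto simp: point_gen_def)
    have e1: "point_neg q = q" if "\<bar>q\<bar> \<noteq> 1" for q using that by (simp add: point_neg_def)
    have e2: "point_kill n (foldr (point_gen X n) (rev [1..<n]) (point_neg p)) =
        point_kill n (foldr (point_gen X n) (rev [1..<n]) p)"
      using down[of p] down[of "- p"] by (cases "\<bar>p\<bar> = 1") (auto simp: point_neg_def point_kill_def)
    from that consider "u = gens ([0..<n] @ [n])" "v = gens ([1..<n] @ [n])"
      | "u = gens ([n] @ rev [0..<n])" "v = gens ([n] @ rev [1..<n])"
      unfolding TypeB by auto
    then show ?thesis using up[of p] e2 by cases (simp_all add: gens 0 g0 gn e1)
  next
    case TypeD
    have 0: "point_gen X n 0 = point_neg \<circ> point_swap 1 \<circ> point_neg"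
      and gn: "point_gen X n n = point_kill n"
      using TypeD n by (auto simp: point_gen_def)
    have "point_kill n (point_kill n p) = point_kill n p" for p by (simp add: point_kill_def)
    moreover have "point_gen X n 0 (point_kill 2 (point_gen X n 0 p)) =
        point_swap 1 (point_kill 2 (point_swap 1 p))"
    proof -
      have c: "point_neg (point_kill 2 (point_neg q)) = point_kill 2 q"
        "point_neg (point_kill 1 (point_neg q)) = point_kill 1 q" for q
        by (auto simp: point_neg_def point_kill_def)
      have k: "point_swap 1 (point_kill 2 (point_swap 1 q)) = point_kill 1 q" for q
        using point_swap_kill[of 1 q] by (simp add: numeral_2_eq_2)
      show ?thesis by (simp only: 0 o_apply c k)
    qed
    moreover have "u = gens ([0] @ ([2..<n] @ [n]) @ ([n] @ rev [2..<n]) @ [0])"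
      "v = gens ([1] @ ([2..<n] @ [n]) @ ([n] @ rev [2..<n]) @ [1])"
      using that unfolding TypeD by simp_all
    ultimately show ?thesis
      using kill[of 2 "point_gen X n 0 p"] kill[of 2 "point_swap 1 p"] n
      by (simp add: gens gn swap del: upt_Suc)
  qed
  have near: "i = n - 1" if "i \<in> mutable X n" "diagram X n i n \<noteq> 0" for i
    using that n by (cases X) (auto simp: diagram_def split: if_splits)
  have far: "i + 1 < n" if "i \<in> mutable X n" "diagram X n i n = 0" for i
  proof -
    have "diagram X n (n - 1) n \<noteq> 0" using n by (cases X) (auto simp: diagram_def)
    then have "i \<noteq> n - 1" using that by metis
    then show ?thesis using less[OF that(1)] by simp
  qed
  have invol: "point_gen X n i (point_gen X n i p) = p" if "i \<in> mutable X n" for i p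
    using that by (rule point_gen_invol)
  have cox: "point_word X n (word_power (gens [i, j]) (coxeter_exponent X n i j)) p = p"
    if "i \<in> mutable X n" "j \<in> mutable X n" "i \<noteq> j" for i j p
  proof -
    have sym: "diagram X n i j = diagram X n j i" by (simp add: diagram_def)
    show ?thesis
    proof (cases "diagram X n i j = 0")
      case True
      then show ?thesis using comm[of i j] comm[of j i] that sym
        by (cases "i < j")
           (auto simp: coxeter_exponent_def word_power_def numeral_eq_Suc gens_def invol)
    next
      case False
      note nz = False
      show ?thesis
      proof (cases "diagram X n i j = 1")
        case True
        then have "point_gen X n i (point_gen X n j (point_gen X n i p)) =
            point_gen X n j (point_gen X n i (point_gen X n j p))" for p
          using braid[of i j p] braid[of j i p] that sym by (cases "i < j") auto
        then show ?thesis using True that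
          by (simp add: coxeter_exponent_def word_power_def numeral_eq_Suc gens_def invol)
      next
        case False
        then have "point_gen X n i (point_gen X n j (point_gen X n i (point_gen X n j p))) =
            point_gen X n j (point_gen X n i (point_gen X n j (point_gen X n i p)))" for p
          using braid4[of i j p] braid4[of j i p] that sym nz by (cases "i < j") auto
        then show ?thesis using False nz that
          by (simp add: coxeter_exponent_def word_power_def numeral_eq_Suc gens_def invol)
      qed
    qed
  qed
  have gn: "point_gen X n n = point_kill n" by (simp add: point_gen_def)
  have abs_neg: "\<bar>point_neg p\<bar> = \<bar>p\<bar>" for p by (simp add: point_neg_def)
  have kill_far: "point_kill n (point_gen X n j p) = point_gen X n j (point_kill n p)"
    if "j \<in> mutable X n" "diagram X n j n = 0" for j p
  proof -
    have "\<bar>point_gen X n j p\<bar> = int n \<longleftrightarrow> \<bar>p\<bar> = int n"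
    proof (cases "j = 0")
      case True
      then show ?thesis using that(1) n
        by (cases X) (auto simp: point_gen_def abs_neg abs_swap transpose_eq_iff)
    next
      case False
      then show ?thesis using far[OF that] by (auto simp: swap abs_swap transpose_eq_iff)
    qed
    moreover have "point_gen X n j 0 = 0"
      using that(1) by (simp add: point_gen_zero vertices_def)
    ultimately show ?thesis by (simp add: point_kill_def)
  qed
  have kill_near: "point_kill n (point_gen X n j (point_kill n p)) =
      point_gen X n j (point_kill n (point_gen X n j (point_kill n p)))" (is ?near1)
    "point_gen X n j (point_kill n (point_gen X n j (point_kill n p))) =
      point_kill n (point_gen X n j (point_kill n (point_gen X n j p)))" (is ?near2)
    if "j \<in> mutable X n" "diagram X n j n \<noteq> 0" for j p
  proof -
    have j: "n = Suc j" "1 \<le> j" using near[OF that] n by auto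
    have g: "point_gen X n j = point_swap j" using swap[of j] j by simp
    have k: "point_swap j (point_kill n (point_swap j q)) = point_kill j q" for q
      using point_swap_kill[of j q] j by simp
    have l: "point_kill n (point_swap j q) = point_swap j (point_kill j q)" for q
      using arg_cong[OF k[of q], of "point_swap j"] j(2) by (simp add: point_swap_invol)
    have "point_swap j q = q" if "\<bar>q\<bar> \<noteq> int j" "\<bar>q\<bar> \<noteq> int j + 1" for q
      using that by (auto simp: point_swap_def)
    then have "point_swap j (point_kill j (point_kill n p)) = point_kill j (point_kill n p)"
      using j by (simp add: point_kill_def)
    then show ?near1 by (simp only: g k) (simp only: l)
    show ?near2 by (simp only: g k) (auto simp: point_kill_def)
  qed
  have kill2: "point_kill n (point_kill n p) = point_kill n p" by (simp add: point_kill_def)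
  from assms(3) consider
      (invol) i where "i \<in> mutable X n" "u = gens [i, i]" "v = []"
    | (idem) "u = gens [n, n]" "v = gens [n]"
    | (coxeter) i j where "i \<in> mutable X n" "j \<in> mutable X n" "i \<noteq> j"
        "u = word_power (gens [i, j]) (coxeter_exponent X n i j)" "v = []"
    | (far) j where "j \<in> mutable X n" "diagram X n j n = 0" "u = gens [n, j]" "v = gens [j, n]"
    | (near1) j where "j \<in> mutable X n" "diagram X n j n \<noteq> 0"
        "u = gens [n, j, n]" "v = gens [j, n, j, n]"
    | (near2) j where "j \<in> mutable X n" "diagram X n j n \<noteq> 0"
        "u = gens [j, n, j, n]" "v = gens [n, j, n, j]"
    | (special) "(u, v) \<in> special_relations X n"
    unfolding relations_def by blast
  then show ?thesis
  proof cases
    case invol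
    then show ?thesis by (simp add: gens point_gen_invol)
  next
    case idem
    then show ?thesis by (simp add: gens gn kill2)
  next
    case coxeter
    then show ?thesis using cox[of i j p] by simp
  next
    case far
    then show ?thesis by (simp add: gens gn kill_far)
  next
    case near1
    then show ?thesis using kill_near(1)[of j p] by (simp add: gens gn)
  next
    case near2
    then show ?thesis using kill_near(2)[of j p] by (simp add: gens gn)
  next
    case special
    then show ?thesis by (rule spec)
  qed
qed

lemma point_word_pres_eq:
  assumes "2 \<le> n" "X = TypeD \<Longrightarrow> 4 \<le> n" "pres_eq (vertices X n) (relations X n) u v"
  shows "point_word X n u = point_word X n v"
  using assms(3)
proof (induction rule: pres_eq.induct)
  case (rel u v)
  then show ?case using point_word_relations[OF assms(1,2)] by auto
next
  case (inv u)
  then obtain A where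
    "\<And>p. point_word X n u (point_word X n (word_inv u) p) = (if p \<in> A then p else 0)"
    "\<And>p. point_word X n u p \<notin> A \<Longrightarrow> point_word X n u p = 0"
    using point_word_proj by meson
  then show ?case by auto
next
  case (idem_comm u v)
  obtain A B where
    "\<And>p. point_word X n u (point_word X n (word_inv u) p) = (if p \<in> A then p else 0)"
    "\<And>p. point_word X n v (point_word X n (word_inv v) p) = (if p \<in> B then p else 0)"
    using point_word_proj[OF idem_comm(1)] point_word_proj[OF idem_comm(2)] by meson
  then show ?case by auto
qed (auto simp: fun_eq_iff)

section \<open>The Boolean reflection monoid\<close>

locale boolean_reflection =
  fixes X :: diagram_type and n :: nat
  assumes n2: "2 \<le> n" and D4: "X = TypeD \<Longrightarrow> 4 \<le> n"
begin

abbreviation "V \<equiv> vertices X n"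
abbreviation "I \<equiv> mutable X n"
abbreviation "M \<equiv> refl_monoid X n"
abbreviation "s \<equiv> gen X n"
abbreviation mul (infixl "\<odot>" 70) where "x \<odot> y \<equiv> x \<otimes>\<^bsub>M\<^esub> y"
abbreviation "Ref \<equiv> reflections X n"

sublocale P: inverse_presentation V "relations X n" .

sublocale M: monoid "refl_monoid X n"
  unfolding refl_monoid_def by (rule P.monoid_PM)

lemma I_less: "i \<in> I \<Longrightarrow> i < n"
  by (cases X) auto

lemma I_V: "i \<in> I \<Longrightarrow> i \<in> V" and n_V [simp]: "n \<in> V" and V_cases: "i \<in> V \<Longrightarrow> i = n \<or> i \<in> I"
  by (auto simp: vertices_def)

lemma pos_I: "1 \<le> i \<Longrightarrow> i < n \<Longrightarrow> i \<in> I"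
  by (cases X) auto

lemma cl_carrier [simp]: "u \<in> words V \<Longrightarrow> P.cl u \<in> carrier M"
  unfolding refl_monoid_def by simp

lemma cl_mul [simp]: "u \<in> words V \<Longrightarrow> v \<in> words V \<Longrightarrow> P.cl u \<odot> P.cl v = P.cl (u @ v)"
  unfolding refl_monoid_def by simp

lemma one_M: "\<one>\<^bsub>M\<^esub> = P.cl []"
  unfolding refl_monoid_def by (rule P.one_PM)

lemma s_carrier [simp]: "i \<in> V \<Longrightarrow> s i \<in> carrier M"
  by (simp add: gen_def)

lemma carrier_cases:
  assumes "x \<in> carrier M"
  obtains w where "w \<in> words V" "x = P.cl w"
  using assms unfolding refl_monoid_def P.carrier_PM by blast

lemma rel_cl: "(u, v) \<in> relations X n \<Longrightarrow> u \<in> words V \<Longrightarrow> v \<in> words V \<Longrightarrow> P.cl u = P.cl v"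
  by (simp add: P.cl_eq_iff pres_eq.rel)

lemma cl_GenInv: "i \<in> V \<Longrightarrow> P.cl [GenInv i] = s i"
proof -
  assume i: "i \<in> V"
  have "P.cl [Gen i, Gen i] = P.cl [] \<or> P.cl [Gen i, Gen i] = P.cl [Gen i]"
  proof (cases "i = n")
    case True
    have "P.cl (gens [n, n]) = P.cl (gens [n])" by (rule rel_cl) (auto simp: relations_def)
    then show ?thesis using True by (simp add: gens_def)
  next
    case False
    then have "i \<in> I" using V_cases i by blast
    then have "P.cl (gens [i, i]) = P.cl []" using i by (intro rel_cl) (auto simp: relations_def)
    then show ?thesis by (simp add: gens_def)
  qed
  then show ?thesis using P.cl_GenInv[OF i] by (simp add: gen_def)
qed

lemma letter_cl:
  assumes "x \<in> Gen ` V \<union> GenInv ` V"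
  shows "P.cl [x] = s (letter_index x)" "letter_index x \<in> V"
  using assms cl_GenInv by (auto simp: gen_def)

lemma cl_Cons: "x # w \<in> words V \<Longrightarrow> P.cl (x # w) = s (letter_index x) \<odot> P.cl w"
  using cl_mul[of "[x]" w] letter_cl[of x] by simp

lemma gen_induct [consumes 1, case_names one mult]:
  assumes "x \<in> carrier M" and one: "Q \<one>\<^bsub>M\<^esub>"
    and mult: "\<And>i y. i \<in> V \<Longrightarrow> y \<in> carrier M \<Longrightarrow> Q y \<Longrightarrow> Q (s i \<odot> y)"
  shows "Q x"
proof -
  have "Q (P.cl w)" if "w \<in> words V" for w
    using that
  proof (induction w)
    case (Cons x w)
    then show ?case using mult[of "letter_index x" "P.cl w"] letter_cl(2)[of x] cl_Cons[of x w] by simp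
  qed (use one in \<open>simp add: one_M\<close>)
  then show ?thesis using assms(1) carrier_cases by blast
qed

text \<open>Left multiplication, extended by the identity outside the carrier. The relations between
generators then hold as equations between maps on a whole type and can be used for rewriting.\<close>

definition L :: "word set \<Rightarrow> word set \<Rightarrow> word set" where
  "L x P = (if P \<in> carrier M then x \<odot> P else P)"

lemma L_mult: "x \<in> carrier M \<Longrightarrow> y \<in> carrier M \<Longrightarrow> L (x \<odot> y) P = L x (L y P)"
  by (simp add: L_def M.m_assoc)

lemma L_one [simp]: "L \<one>\<^bsub>M\<^esub> P = P"
  by (simp add: L_def)

lemma L_inj:
  assumes "x \<in> carrier M" "y \<in> carrier M" "\<And>P. L x P = L y P"
  shows "x = y"
  using assms(3)[of "\<one>\<^bsub>M\<^esub>"] assms(1,2) by (simp add: L_def)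

lemma L_gens: "set xs \<subseteq> V \<Longrightarrow> L (P.cl (gens xs)) P = foldr (\<lambda>i. L (s i)) xs P"
proof (induction xs)
  case Nil
  then show ?case by (simp add: gens_def flip: one_M)
next
  case (Cons i xs)
  have "P.cl (gens (i # xs)) = s i \<odot> P.cl (gens xs)"
  proof -
    have "gens (i # xs) = Gen i # gens xs" by (simp add: gens_def)
    then show ?thesis using Cons.prems cl_Cons[of "Gen i" "gens xs"] by simp
  qed
  then show ?case using Cons by (simp add: L_mult)
qed

lemma L_rel:
  assumes "(gens xs, gens ys) \<in> relations X n" "set xs \<subseteq> V" "set ys \<subseteq> V"
  shows "foldr (\<lambda>i. L (s i)) xs P = foldr (\<lambda>i. L (s i)) ys P"
  using rel_cl[OF assms(1)] assms(2,3) by (simp flip: L_gens)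

lemma L_invol: "i \<in> I \<Longrightarrow> L (s i) (L (s i) P) = P"
  using L_rel[of "[i, i]" "[]" P] by (auto simp: relations_def I_V gens_def)

lemma L_idem: "L (s n) (L (s n) P) = L (s n) P"
  using L_rel[of "[n, n]" "[n]" P] by (auto simp: relations_def)

lemma L_coxeter:
  assumes "i \<in> I" "j \<in> I" "i \<noteq> j"
  shows "foldr (\<lambda>i. L (s i)) (concat (replicate (coxeter_exponent X n i j) [i, j])) P = P"
proof -
  have "word_power (gens [i, j]) m = gens (concat (replicate m [i, j]))" for m
    by (induction m) (auto simp: word_power_def gens_def)
  then have "(gens (concat (replicate (coxeter_exponent X n i j) [i, j])), gens []) \<in> relations X n"
    using assms unfolding relations_def by (force simp: gens_def[THEN fun_cong, of "[]"])
  from L_rel[OF this, of P] show ?thesis using assms I_V by simp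
qed

lemma L_comm:
  assumes "i \<in> I" "j \<in> V" "i \<noteq> j" "diagram X n i j = 0"
  shows "L (s i) (L (s j) P) = L (s j) (L (s i) P)"
proof (cases "j = n")
  case True
  then have "(gens [n, i], gens [i, n]) \<in> relations X n"
    using assms unfolding relations_def by blast
  from L_rel[OF this, of P] show ?thesis using assms I_V True by simp
next
  case False
  then have j: "j \<in> I" using V_cases assms by blast
  have "L (s i) (L (s j) (L (s i) (L (s j) P))) = P" for P
    using L_coxeter[of i j P] assms j by (simp add: coxeter_exponent_def numeral_eq_Suc)
  from this[of "L (s j) (L (s i) P)"] show ?thesis using assms j by (simp add: L_invol)
qed

lemma L_braid:
  assumes "i \<in> I" "j \<in> I" "i \<noteq> j" "diagram X n i j = 1"
  shows "L (s i) (L (s j) (L (s i) P)) = L (s j) (L (s i) (L (s j) P))"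
proof -
  have "L (s i) (L (s j) (L (s i) (L (s j) (L (s i) (L (s j) P))))) = P" for P
    using L_coxeter[of i j P] assms by (simp add: coxeter_exponent_def numeral_eq_Suc)
  (* applied to the right-hand side, the last three letters cancel *)
  from this[of "L (s j) (L (s i) (L (s j) P))"] show ?thesis using assms by (simp add: L_invol)
qed

lemma L_braid4:
  assumes "i \<in> I" "j \<in> I" "i \<noteq> j" "diagram X n i j = 2"
  shows "L (s i) (L (s j) (L (s i) (L (s j) P))) = L (s j) (L (s i) (L (s j) (L (s i) P)))"
proof -
  have "L (s i) (L (s j) (L (s i) (L (s j) (L (s i) (L (s j) (L (s i) (L (s j) P))))))) = P" for P
    using L_coxeter[of i j P] assms by (simp add: coxeter_exponent_def numeral_eq_Suc)
  from this[of "L (s j) (L (s i) (L (s j) (L (s i) P)))"] show ?thesis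
    using assms by (simp add: L_invol)
qed

subsection \<open>Evaluation on signed points\<close>

definition rho :: "word set \<Rightarrow> int \<Rightarrow> int" where
  "rho x = point_word X n (SOME w. w \<in> x)"

lemma rho_cl: "w \<in> words V \<Longrightarrow> rho (P.cl w) = point_word X n w"
  unfolding rho_def using P.lift_cl[of "point_word X n" w] point_word_pres_eq[OF n2 D4] by blast

lemma rho_mult:
  assumes "x \<in> carrier M" "y \<in> carrier M"
  shows "rho (x \<odot> y) p = rho x (rho y p)"
proof -
  obtain u v where "u \<in> words V" "x = P.cl u" "v \<in> words V" "y = P.cl v"
    using assms carrier_cases by metis
  then show ?thesis by (simp add: rho_cl)
qed

lemma rho_one [simp]: "rho \<one>\<^bsub>M\<^esub> p = p"
  by (simp add: one_M rho_cl)

lemma rho_s: "i \<in> V \<Longrightarrow> rho (s i) p = point_gen X n i p"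
  by (simp add: gen_def rho_cl)

lemma rho_s_pos: "1 \<le> i \<Longrightarrow> i < n \<Longrightarrow> rho (s i) p = point_swap i p"
  by (simp add: rho_s I_V pos_I) (simp add: point_gen_def)

lemma rho_s_n: "rho (s n) p = point_kill n p"
  by (simp add: rho_s) (simp add: point_gen_def)

subsection \<open>Units\<close>

lemma s_invol: "i \<in> I \<Longrightarrow> s i \<odot> s i = \<one>\<^bsub>M\<^esub>"
  by (rule L_inj) (simp_all add: L_mult L_invol I_V)

lemma inv_mult:
  assumes "g \<in> Units M" "h \<in> Units M"
  shows "inv\<^bsub>M\<^esub> (g \<odot> h) = inv\<^bsub>M\<^esub> h \<odot> inv\<^bsub>M\<^esub> g"
proof (rule M.inv_unique'[symmetric])
  have "g \<odot> h \<odot> (inv\<^bsub>M\<^esub> h \<odot> inv\<^bsub>M\<^esub> g) = g \<odot> (h \<odot> inv\<^bsub>M\<^esub> h) \<odot> inv\<^bsub>M\<^esub> g"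
    "inv\<^bsub>M\<^esub> h \<odot> inv\<^bsub>M\<^esub> g \<odot> (g \<odot> h) = inv\<^bsub>M\<^esub> h \<odot> (inv\<^bsub>M\<^esub> g \<odot> g) \<odot> h"
    using assms by (simp_all only: M.m_assoc M.Units_closed M.Units_inv_closed M.m_closed)
  then show "g \<odot> h \<odot> (inv\<^bsub>M\<^esub> h \<odot> inv\<^bsub>M\<^esub> g) = \<one>\<^bsub>M\<^esub>" "inv\<^bsub>M\<^esub> h \<odot> inv\<^bsub>M\<^esub> g \<odot> (g \<odot> h) = \<one>\<^bsub>M\<^esub>"
    using assms M.Units_closed by simp_all
qed (use assms M.Units_closed in simp_all)

lemma s_Units: "i \<in> I \<Longrightarrow> s i \<in> Units M"
  using s_invol[of i] s_carrier[of i] I_V by (auto simp: Units_def)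

lemma inv_s: "i \<in> I \<Longrightarrow> inv\<^bsub>M\<^esub> s i = s i"
  using s_invol[of i] s_carrier[of i] I_V[of i] M.inv_unique'[of "s i" "s i"] by simp

lemma rho_inv: "g \<in> Units M \<Longrightarrow> rho (inv\<^bsub>M\<^esub> g) (rho g p) = p"
  using rho_mult[of "inv\<^bsub>M\<^esub> g" g p] M.Units_closed[of g] by simp

lemma rho_inj: "g \<in> Units M \<Longrightarrow> rho g p = rho g q \<longleftrightarrow> p = q"
  using rho_inv by metis

lemma s_n_not_unit: "s n \<notin> Units M"
  using rho_inj[of "s n" "int n" 0] n2 by (auto simp: rho_s_n point_kill_def)

text \<open>A word acting injectively has no letter \<open>n\<close>: the part of the word to the right of the rightmost such
letter acts as a permutation fixing \<open>0\<close>, so its values include both \<open>0\<close> and \<open>n\<close>, which \<open>s n\<close> identifies.\<close>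

lemma inj_word:
  assumes "w \<in> words V" "inj (point_word X n w)"
  shows "letter_index ` set w \<subseteq> I \<and> surj (point_word X n w) \<and> point_word X n w 0 = 0"
  using assms
proof (induction w)
  case Nil
  have "point_word X n [] = id" by auto
  then show ?case by simp
next
  case (Cons x w)
  let ?i = "letter_index x"
  have eq: "point_word X n (x # w) = point_gen X n ?i \<circ> point_word X n w" by auto
  have inj: "inj (point_word X n w)" using Cons.prems(2) unfolding eq by (rule inj_on_imageI2)
  then have IH: "letter_index ` set w \<subseteq> I" "surj (point_word X n w)" "point_word X n w 0 = 0"
    using Cons by auto
  have V: "?i \<in> V" using Cons.prems(1) letter_cl(2) by simp
  have "?i \<noteq> n"
  proof
    assume n: "?i = n"
    obtain q where q: "point_word X n w q = int n" using IH(2) by (metis surjD)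
    then have "point_word X n (x # w) q = point_word X n (x # w) 0"
      using n IH(3) by (simp add: point_gen_def point_kill_def)
    then have "q = 0" by (rule injD[OF Cons.prems(2)])
    then show False using q IH(3) n2 by simp
  qed
  then have i: "?i \<in> I" using V V_cases by blast
  then have "surj (point_gen X n ?i)" using point_gen_invol[OF i] by (metis surjI)
  then have "surj (point_word X n (x # w))" unfolding eq using IH(2) by (rule comp_surj[rotated])
  then show ?case using i IH point_gen_zero[OF V] by simp
qed

text \<open>A unit acts injectively on signed points, so it is a word in the mutable generators.\<close>

lemma Units_induct [consumes 1, case_names one mult]:
  assumes "g \<in> Units M" and one: "Q \<one>\<^bsub>M\<^esub>"
    and mult: "\<And>i h. i \<in> I \<Longrightarrow> h \<in> Units M \<Longrightarrow> Q h \<Longrightarrow> Q (s i \<odot> h)"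
  shows "Q g"
proof -
  have *: "P.cl w \<in> Units M \<and> Q (P.cl w)" if "w \<in> words V" "letter_index ` set w \<subseteq> I" for w
    using that
  proof (induction w)
    case (Cons x w)
    then show ?case
      using mult[of "letter_index x" "P.cl w"] cl_Cons[of x w] s_Units[of "letter_index x"] by simp
  qed (use one in \<open>simp flip: one_M\<close>)
  obtain w where w: "w \<in> words V" "g = P.cl w"
    using assms(1) carrier_cases M.Units_closed by metis
  have "inj (point_word X n w)" using rho_inj[OF assms(1)] w by (auto simp: rho_cl intro: injI)
  then show ?thesis using * w inj_word by blast
qed

lemma Units_induct_right [consumes 1, case_names one mult]:
  assumes "g \<in> Units M" and one: "Q \<one>\<^bsub>M\<^esub>"
    and mult: "\<And>i h. i \<in> I \<Longrightarrow> h \<in> Units M \<Longrightarrow> Q h \<Longrightarrow> Q (h \<odot> s i)"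
  shows "Q g"
proof -
  have "Q (inv\<^bsub>M\<^esub> h)" if "h \<in> Units M" for h
    using that
  proof (induction h rule: Units_induct)
    case (mult i h)
    then show ?case using assms(3)[of i "inv\<^bsub>M\<^esub> h"] s_Units[of i] inv_s[of i]
      by (simp add: inv_mult)
  qed (use one in simp)
  then show ?thesis using assms(1) by (metis M.Units_inv_Units M.Units_inv_inv)
qed

subsection \<open>The conjugates of the idempotent generator\<close>

text \<open>The idempotent \<open>f a\<close> is the identity of the subspace on which the coordinate \<open>a\<close> vanishes. The
recursion runs over the distance \<open>n - a\<close>.\<close>

primrec f_down :: "nat \<Rightarrow> word set" where
  "f_down 0 = s n"
| "f_down (Suc m) = s (n - 1 - m) \<odot> f_down m \<odot> s (n - 1 - m)"

definition f :: "nat \<Rightarrow> word set" where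
  "f a = f_down (n - a)"

lemma f_n: "f n = s n"
  by (simp add: f_def)

lemma f_step: "a < n \<Longrightarrow> f a = s a \<odot> f (Suc a) \<odot> s a"
proof -
  assume "a < n"
  then have "n - a = Suc (n - Suc a)" "n - 1 - (n - Suc a) = a" by auto
  then show ?thesis unfolding f_def by (simp only: f_down.simps)
qed

lemma f_carrier [simp]: "1 \<le> a \<Longrightarrow> a \<le> n \<Longrightarrow> f a \<in> carrier M"
proof (rotate_tac, induction a rule: inc_induct)
  case (step a)
  then show ?case by (simp add: f_step I_V pos_I)
qed (simp add: f_n)

lemma L_f_step: "1 \<le> a \<Longrightarrow> a < n \<Longrightarrow> L (f a) P = L (s a) (L (f (Suc a)) (L (s a) P))"
  by (simp add: f_step L_mult I_V pos_I)

lemma rho_f: "1 \<le> a \<Longrightarrow> a \<le> n \<Longrightarrow> rho (f a) p = point_kill a p"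
proof (rotate_tac, induction a arbitrary: p rule: inc_induct)
  case (step a)
  then show ?case using point_swap_kill[of a p] by (simp add: f_step rho_mult I_V pos_I rho_s_pos)
qed (simp add: f_n rho_s_n)

lemma f_inj: "1 \<le> a \<Longrightarrow> a \<le> n \<Longrightarrow> 1 \<le> b \<Longrightarrow> b \<le> n \<Longrightarrow> f a = f b \<longleftrightarrow> a = b"
proof
  assume *: "1 \<le> a" "a \<le> n" "1 \<le> b" "b \<le> n" "f a = f b"
  then have "point_kill a (int a) = point_kill b (int a)" by (metis rho_f)
  then show "a = b" using * by (auto simp: point_kill_def split: if_splits)
qed simp

lemma unjoined_n: "1 \<le> i \<Longrightarrow> i + 1 < n \<Longrightarrow> diagram X n i n = 0"
  using n2 by (cases X) (auto simp: diagram_def)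

lemma f_unit_conj_f: "1 \<le> a \<Longrightarrow> a \<le> n \<Longrightarrow> \<exists>g\<in>Units M. f a = g \<odot> s n \<odot> inv\<^bsub>M\<^esub> g"
proof (rotate_tac, induction a rule: inc_induct)
  case (step a)
  then obtain g where g: "g \<in> Units M" "f (Suc a) = g \<odot> s n \<odot> inv\<^bsub>M\<^esub> g" by auto
  have a: "a \<in> I" using step pos_I by simp
  have "f a = (s a \<odot> g) \<odot> s n \<odot> inv\<^bsub>M\<^esub> (s a \<odot> g)"
    using step g a s_Units[OF a] inv_s[OF a] I_V[OF a] M.Units_closed[OF g(1)]
    by (simp add: f_step inv_mult M.m_assoc)
  then show ?case using g(1) s_Units[OF a] by blast
next
  case base
  then show ?case by (intro bexI[of _ "\<one>\<^bsub>M\<^esub>"]) (auto simp: f_n)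
qed

subsection \<open>The sign change\<close>

abbreviation "tau \<equiv> transpose 0 (1 :: nat)"

lemma tau_I: "X = TypeD \<Longrightarrow> i \<in> I \<Longrightarrow> tau i \<in> I" and tau_n: "tau n = n"
  using n2 by (auto simp: transpose_def)

lemma tau_V: "X = TypeD \<Longrightarrow> i \<in> V \<Longrightarrow> tau i \<in> V"
  using tau_I tau_n V_cases I_V n_V by metis

lemma tau_diagram:
  assumes "X = TypeD"
  shows "diagram X n (tau i) (tau j) = diagram X n i j"
proof -
  have c: "i = 0 \<or> i = 1 \<or> 2 \<le> i" for i :: nat by linarith
  show ?thesis
    using c[of i] c[of j] assms D4 by (elim disjE) (auto simp: diagram_def)
qed

lemma map_gens: "map (letter_map h) (gens xs) = gens (map h xs)"
  by (simp add: gens_def)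

lemma map_word_power: "map (letter_map h) (word_power w m) = word_power (map (letter_map h) w) m"
  by (simp add: word_power_def map_concat)

text \<open>The exchange of \<open>0\<close> and \<open>1\<close> respects the diagram of type D, hence the Coxeter relations, and it
interchanges the two sides of the special relation.\<close>

lemma tau_relations:
  assumes D: "X = TypeD" and uv: "(u, v) \<in> relations X n"
  shows "(map (letter_map tau) u, map (letter_map tau) v) \<in> relations X n \<or>
    (map (letter_map tau) v, map (letter_map tau) u) \<in> relations X n"
proof -
  have up: "map tau [2..<n] = [2..<n]" by (rule map_idI) simp
  have exp: "coxeter_exponent X n (tau i) (tau j) = coxeter_exponent X n i j" for i j
    by (simp only: coxeter_exponent_def tau_diagram[OF D])
  have near: "diagram X n (tau j) n = diagram X n j n" for j
    using tau_diagram[OF D, of j n] by (simp only: tau_n)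
  from uv consider
      (invol) i where "i \<in> I" "u = gens [i, i]" "v = []"
    | (idem) "u = gens [n, n]" "v = gens [n]"
    | (cox) i j where "i \<in> I" "j \<in> I" "i \<noteq> j"
        "u = word_power (gens [i, j]) (coxeter_exponent X n i j)" "v = []"
    | (far) j where "j \<in> I" "diagram X n j n = 0" "u = gens [n, j]" "v = gens [j, n]"
    | (near1) j where "j \<in> I" "diagram X n j n \<noteq> 0"
        "u = gens [n, j, n]" "v = gens [j, n, j, n]"
    | (near2) j where "j \<in> I" "diagram X n j n \<noteq> 0"
        "u = gens [j, n, j, n]" "v = gens [n, j, n, j]"
    | (special) "(u, v) \<in> special_relations X n"
    unfolding relations_def by blast
  then show ?thesis
  proof cases
    case (invol i)
    have "tau i \<in> I" by (rule tau_I[OF D]) fact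
    then show ?thesis unfolding invol(2,3) map_gens list.map
      by (intro disjI1) (unfold relations_def, blast)
  next
    case idem
    then show ?thesis by (simp only: map_gens list.map tau_n) (simp add: relations_def)
  next
    case (cox i j)
    have "tau i \<in> I" "tau j \<in> I" by (rule tau_I[OF D], fact)+
    moreover have "tau i \<noteq> tau j" using cox(3) by (metis transpose_involutory)
    ultimately show ?thesis
      unfolding cox(4,5) map_word_power map_gens list.map exp[of i j, symmetric]
      by (intro disjI1) (unfold relations_def, blast)
  next
    case (far j)
    have "tau j \<in> I" by (rule tau_I[OF D]) fact
    moreover have "diagram X n (tau j) n = 0" using far near by simp
    ultimately show ?thesis unfolding far(3,4) map_gens list.map tau_n
      by (intro disjI1) (unfold relations_def, blast)
  next
    case (near1 j)
    have "tau j \<in> I" by (rule tau_I[OF D]) fact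
    moreover have "diagram X n (tau j) n \<noteq> 0" using near1 near by simp
    ultimately show ?thesis unfolding near1(3,4) map_gens list.map tau_n
      by (intro disjI1) (unfold relations_def, blast)
  next
    case (near2 j)
    have "tau j \<in> I" by (rule tau_I[OF D]) fact
    moreover have "diagram X n (tau j) n \<noteq> 0" using near2 near by simp
    ultimately show ?thesis unfolding near2(3,4) map_gens list.map tau_n
      by (intro disjI1) (unfold relations_def, blast)
  next
    case special
    have u: "u = gens ([0] @ ([2..<n] @ [n]) @ ([n] @ rev [2..<n]) @ [0])"
      and v: "v = gens ([1] @ ([2..<n] @ [n]) @ ([n] @ rev [2..<n]) @ [1])"
      using special unfolding D by simp_all
    have "map (letter_map tau) u = v" "map (letter_map tau) v = u"
      unfolding u v by (simp_all only: map_gens map_append list.map tau_n rev_map[symmetric] up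
        transpose_apply_first transpose_apply_second)
    then show ?thesis using uv by simp
  qed
qed

definition swap01 :: "word set \<Rightarrow> word set" where
  "swap01 P = P.cl (map (letter_map tau) (SOME w. w \<in> P))"

lemma swap01_cl:
  assumes D: "X = TypeD" and "w \<in> words V"
  shows "swap01 (P.cl w) = P.cl (map (letter_map tau) w)" "map (letter_map tau) w \<in> words V"
proof -
  have V: "tau i \<in> V" if "i \<in> V" for i using tau_V[OF D that] .
  have "P.cl (map (letter_map tau) u) = P.cl (map (letter_map tau) v)"
    if "pres_eq V (relations X n) u v" for u v
  proof -
    have "pres_eq V (relations X n) (map (letter_map tau) u) (map (letter_map tau) v)"
    proof (rule P.pres_eq_letter_map[OF V _ that])
      fix u v assume "(u, v) \<in> relations X n" "u \<in> words V" "v \<in> words V"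
      then show "pres_eq V (relations X n) (map (letter_map tau) u) (map (letter_map tau) v)"
        using tau_relations[OF D, of u v] P.words_letter_map[of tau, OF V]
        by (blast intro: pres_eq.rel pres_eq.sym)
    qed
    then show ?thesis using P.cl_eq_iff pres_eq_words by blast
  qed
  then show "swap01 (P.cl w) = P.cl (map (letter_map tau) w)"
    unfolding swap01_def using assms(2) by (rule P.lift_cl[of "\<lambda>w. P.cl (map (letter_map tau) w)"])
  show "map (letter_map tau) w \<in> words V"
    using P.words_letter_map[of tau, OF V] assms(2) by blast
qed

lemma swap01_closed: "X = TypeD \<Longrightarrow> x \<in> carrier M \<Longrightarrow> swap01 x \<in> carrier M"
  using carrier_cases[of x] swap01_cl by (metis cl_carrier)

lemma swap01_mult:
  assumes "X = TypeD" "x \<in> carrier M" "y \<in> carrier M"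
  shows "swap01 (x \<odot> y) = swap01 x \<odot> swap01 y"
proof -
  obtain u v where "u \<in> words V" "x = P.cl u" "v \<in> words V" "y = P.cl v"
    using assms carrier_cases by metis
  then show ?thesis using swap01_cl[OF assms(1)] by simp
qed

lemma swap01_invol:
  assumes "X = TypeD" "x \<in> carrier M"
  shows "swap01 (swap01 x) = x"
proof -
  have "letter_map tau (letter_map tau y) = y" for y by (cases y) auto
  then have "map (letter_map tau) (map (letter_map tau) w) = w" for w
    by (simp add: map_idI)
  moreover obtain u where "u \<in> words V" "x = P.cl u" using assms carrier_cases by metis
  ultimately show ?thesis using swap01_cl[OF assms(1)] by simp
qed

lemma swap01_s: "X = TypeD \<Longrightarrow> i \<in> V \<Longrightarrow> swap01 (s i) = s (tau i)"
  using swap01_cl(1)[of "[Gen i]"] by (simp add: gen_def)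

lemma swap01_auto:
  assumes D: "X = TypeD"
  shows "restrict swap01 (carrier M) \<in> auto M"
  by (rule M.autoI[where \<beta> = swap01])
     (simp_all add: swap01_closed[OF D] swap01_mult[OF D] swap01_invol[OF D])

text \<open>In type D, \<open>d\<close> is not a left multiplication but an automorphism. It normalizes the left multiplications,
and \<open>L (s 0)\<close> is the conjugate of \<open>L (s 1)\<close> by it, which makes type D look like type B.\<close>

definition d :: "word set \<Rightarrow> word set" where
  "d P = (case X of TypeA \<Rightarrow> P | TypeB \<Rightarrow> L (s 0) P
     | TypeD \<Rightarrow> if P \<in> carrier M then swap01 P else P)"

lemma d_A: "X = TypeA \<Longrightarrow> d P = P"
  and d_B: "X = TypeB \<Longrightarrow> d P = L (s 0) P"
  and d_D: "X = TypeD \<Longrightarrow> d P = (if P \<in> carrier M then swap01 P else P)"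
  unfolding d_def by (simp_all only: diagram_type.case)

lemma d_L_D:
  assumes D: "X = TypeD" and "x \<in> carrier M"
  shows "d (L x P) = L (swap01 x) (d P)"
  using assms(2) by (simp add: d_D[OF D] L_def swap01_mult[OF D] swap01_closed[OF D])

lemma zero_I: "X \<noteq> TypeA \<Longrightarrow> 0 \<in> I"
  using n2 by (cases X) auto

lemma d_invol: "d (d P) = P"
proof (cases X)
  case A: TypeA
  show ?thesis by (simp only: d_A[OF A])
next
  case B: TypeB
  then have "0 \<in> I" by (intro zero_I) simp
  then show ?thesis by (simp only: d_B[OF B] L_invol)
next
  case D: TypeD
  show ?thesis by (simp add: d_D[OF D] swap01_closed[OF D] swap01_invol[OF D])
qed

lemma d_comm_s:
  assumes "2 \<le> i" "i \<le> n"
  shows "d (L (s i) P) = L (s i) (d P)"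
proof (cases X)
  case A: TypeA
  show ?thesis by (simp only: d_A[OF A])
next
  case B: TypeB
  then have 0: "0 \<in> I" by (intro zero_I) simp
  have "i \<in> V" "diagram X n 0 i = 0" using B assms n2 by (auto simp: diagram_def vertices_def)
  then show ?thesis using assms(1) L_comm[OF 0, of i P] by (simp add: d_B[OF B])
next
  case D: TypeD
  then have "i \<in> V" using assms by (auto simp: vertices_def)
  then show ?thesis using assms d_L_D[OF D, of "s i" P] swap01_s[OF D, of i] by simp
qed

lemma L_s0_B: "X = TypeB \<Longrightarrow> L (s 0) P = d P"
  by (rule d_B[symmetric])

lemma L_s0_D:
  assumes D: "X = TypeD"
  shows "L (s 0) P = d (L (s 1) (d P))"
proof -
  have "1 \<in> V" using n2 I_V pos_I[of 1] by simp
  then have "d (L (s 1) (d P)) = L (swap01 (s 1)) (d (d P))"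
    using d_L_D[OF D, of "s 1" "d P"] by simp
  then show ?thesis using swap01_s[OF D \<open>1 \<in> V\<close>] by (simp add: d_invol)
qed

sublocale C: signed_chain n "\<lambda>i. L (s i)" d
proof
  show "L (s i) (L (s i) P) = P" if "1 \<le> i" "i < n" for i P
    using that by (simp add: L_invol pos_I)
  show "L (s i) (L (s j) P) = L (s j) (L (s i) P)" if "1 \<le> i" "i + 1 < j" "j < n" for i j P
    using that by (intro L_comm) (auto simp: pos_I I_V, cases X, auto simp: diagram_def)
  show "L (s i) (L (s (i + 1)) (L (s i) P)) = L (s (i + 1)) (L (s i) (L (s (i + 1)) P))"
    if "1 \<le> i" "i + 1 < n" for i P
    using that by (intro L_braid) (auto simp: pos_I I_V, cases X, auto simp: diagram_def)
  show "d (d P) = P" for P by (rule d_invol)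
  show "d (L (s i) P) = L (s i) (d P)" if "2 \<le> i" "i < n" for i P
    using that by (simp add: d_comm_s)
  show "d (L (s 1) (d (L (s 1) P))) = L (s 1) (d (L (s 1) (d P)))" for P
  proof (cases X)
    case A: TypeA
    show ?thesis by (simp only: d_A[OF A])
  next
    case B: TypeB
    then have "0 \<in> I" "1 \<in> I" "diagram X n 0 1 = 2" using n2 by (auto simp: diagram_def)
    then show ?thesis using L_braid4[of 0 1 P] L_s0_B[OF B] by simp
  next
    case D: TypeD
    then have "0 \<in> I" "1 \<in> I" "1 \<in> V" "diagram X n 0 1 = 0"
      using n2 by (auto simp: diagram_def vertices_def)
    then show ?thesis using L_comm[of 0 1 P] L_s0_D[OF D] by (simp add: d_invol)
  qed
qed

sublocale Pt: signed_chain n point_swap "point_d X"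
  by (rule signed_chain_points)

subsection \<open>Conjugating the idempotents\<close>

lemma L_f_conj:
  assumes "1 \<le> a" "a \<le> n" "1 \<le> i" "i < n"
  shows "L (s i) (L (f a) (L (s i) P)) = L (f (transpose i (Suc i) a)) P"
proof (rule C.conj_down)
  show "L (s i) (L (f n) P) = L (f n) (L (s i) P)" if "1 \<le> i" "i + 1 < n" for i P
    using that L_comm[of i n P] by (simp add: f_n pos_I unjoined_n)
qed (use assms L_f_step in auto)

lemma d_f_high:
  assumes "2 \<le> a" "a \<le> n"
  shows "d (L (f a) P) = L (f a) (d P)"
  using assms(2,1)
proof (induction a arbitrary: P rule: inc_induct)
  case base
  then show ?case by (simp add: f_n d_comm_s)
next
  case (step a)
  then show ?case by (simp add: L_f_step d_comm_s)
qed

lemma L_f_word: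
  assumes "1 \<le> a" "a \<le> n"
  shows "L (f a) P = foldr (\<lambda>i. L (s i)) ([a..<n] @ [n] @ rev [a..<n]) P"
  using assms(2,1)
proof (induction a arbitrary: P rule: inc_induct)
  case base
  then show ?case by (simp add: f_n)
next
  case (step a)
  then have "[a..<n] = a # [Suc a..<n]" by (simp add: upt_conv_Cons)
  then show ?case using step by (simp add: L_f_step)
qed

text \<open>These are the two special relations of type B, since \<open>f 1\<close> is \<open>s 1 \<cdots> s (n - 1) s n s (n - 1) \<cdots> s 1\<close>.\<close>

lemma s0_f1_B:
  assumes B: "X = TypeB"
  shows "L (s 0) (L (f 1) P) = L (f 1) P" "L (f 1) (L (s 0) P) = L (f 1) P"
proof -
  have 0: "[0..<n] = 0 # [1..<n]" using n2 by (simp add: upt_conv_Cons)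
  have "set [0..<n] \<subseteq> V" using B by (auto simp: vertices_def)
  moreover have "set [1..<n] \<subseteq> V" using I_V pos_I by auto
  ultimately have V: "set ([0..<n] @ [n]) \<subseteq> V" "set ([1..<n] @ [n]) \<subseteq> V"
    "set ([n] @ rev [0..<n]) \<subseteq> V" "set ([n] @ rev [1..<n]) \<subseteq> V" by auto
  have r: "(gens ([0..<n] @ [n]), gens ([1..<n] @ [n])) \<in> relations X n"
    "(gens ([n] @ rev [0..<n]), gens ([n] @ rev [1..<n])) \<in> relations X n"
    unfolding relations_def B by simp_all
  note l = L_rel[OF r(1) V(1,2)] and r = L_rel[OF r(2) V(3,4)]
  show "L (s 0) (L (f 1) P) = L (f 1) P"
    using l[of "foldr (\<lambda>i. L (s i)) (rev [1..<n]) P"] n2 by (simp add: L_f_word 0)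
  show "L (f 1) (L (s 0) P) = L (f 1) P"
    using r[of P] n2 by (simp add: L_f_word 0)
qed

text \<open>Sign changes do not affect the subspaces in question. For \<open>a \<ge> 2\<close> the word for \<open>f a\<close> has no letter that
is moved by \<open>d\<close>; for \<open>a = 1\<close> this is what the special relations of types B and D say.\<close>

lemma d_f:
  assumes "1 \<le> a" "a \<le> n"
  shows "d (L (f a) (d P)) = L (f a) P"
proof (cases "a = 1")
  case False
  then show ?thesis using assms d_f_high[of a "d P"] by (simp add: d_invol)
next
  case True
  show ?thesis
  proof (cases X)
    case A: TypeA
    show ?thesis by (simp only: d_A[OF A])
  next
    case B: TypeB
    show ?thesis using True s0_f1_B[OF B] by (simp add: L_s0_B[OF B])
  next
    case TypeD
    have V: "set ([0] @ ([2..<n] @ [n]) @ ([n] @ rev [2..<n]) @ [0]) \<subseteq> V"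
      "set ([1] @ ([2..<n] @ [n]) @ ([n] @ rev [2..<n]) @ [1]) \<subseteq> V"
      using TypeD n2 by (auto simp: vertices_def)
    have "(gens ([0] @ ([2..<n] @ [n]) @ ([n] @ rev [2..<n]) @ [0]),
        gens ([1] @ ([2..<n] @ [n]) @ ([n] @ rev [2..<n]) @ [1])) \<in> relations X n"
      using TypeD unfolding relations_def by simp
    from L_rel[OF this V] have s: "L (s 0) (L (f 2) (L (s 0) P)) = L (s 1) (L (f 2) (L (s 1) P))"
      for P using n2 by (simp add: L_f_word L_idem)
    have f1: "L (f 1) P = L (s 1) (L (f 2) (L (s 1) P))" for P
      using L_f_step[of 1] n2 by (simp add: numeral_2_eq_2)
    have f2: "d (L (f 2) (d P)) = L (f 2) P" for P
      using d_f_high[of 2 "d P"] n2 by (simp add: d_invol)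
    have "d (L (f 1) (d P)) = d (L (s 1) (d (d (L (f 2) (d (d (L (s 1) (d P))))))))"
      by (simp only: f1 d_invol)
    also have "\<dots> = L (s 0) (L (f 2) (L (s 0) P))"
      by (simp only: f2 L_s0_D[OF TypeD])
    also have "\<dots> = L (f 1) P" by (simp only: s f1)
    finally show ?thesis using True by simp
  qed
qed

text \<open>As \<open>d_f\<close>, with the sign change of another coordinate; the two are conjugate along the chain, which
permutes the \<open>f a\<close>.\<close>

lemma neg_f:
  assumes "1 \<le> c" "c \<le> n" "1 \<le> a" "a \<le> n"
  shows "C.neg c (L (f a) (C.neg c P)) = L (f a) P"
  using assms
proof (induction c arbitrary: a P rule: nat_induct_at_least)
  case base
  then show ?case by (simp add: C.neg_1 d_f)
next
  case (Suc c)
  let ?a = "transpose c (Suc c) a"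
  have a: "1 \<le> ?a" "?a \<le> n" using Suc by (auto simp: transpose_def)
  have 1: "L (s c) (L (f a) (L (s c) P)) = L (f ?a) P" for P
    using Suc by (intro L_f_conj) auto
  have 2: "L (s c) (L (f ?a) (L (s c) P)) = L (f a) P" for P
    using L_f_conj[OF a, of c] Suc by simp
  have 3: "C.neg c (L (f ?a) (C.neg c P)) = L (f ?a) P" for P
    using Suc a by simp
  have "C.neg (Suc c) (L (f a) (C.neg (Suc c) P)) =
      L (s c) (C.neg c (L (s c) (L (f a) (L (s c) (C.neg c (L (s c) P))))))"
    using Suc by (simp add: C.neg_step)
  then show ?case by (simp only: 1 2 3)
qed

text \<open>The unsigned permutation of coordinates underlying the generator \<open>s i\<close>.\<close>

definition vperm :: "nat \<Rightarrow> nat \<Rightarrow> nat" where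
  "vperm i = (if i \<noteq> 0 then transpose i (Suc i) else if X = TypeD then transpose 1 2 else id)"

lemma vperm_range: "i \<in> I \<Longrightarrow> 1 \<le> a \<Longrightarrow> a \<le> n \<Longrightarrow> 1 \<le> vperm i a \<and> vperm i a \<le> n"
  using I_less[of i] n2 by (auto simp: vperm_def transpose_def)

lemma f_conj:
  assumes i: "i \<in> I" and a: "1 \<le> a" "a \<le> n"
  shows "s i \<odot> f a \<odot> s i = f (vperm i a)"
proof (rule L_inj)
  have "L (s i) (L (f a) (L (s i) P)) = L (f (vperm i a)) P" for P
  proof (cases "i = 0")
    case False
    then show ?thesis using L_f_conj[OF a, of i] I_less[OF i] by (simp add: vperm_def)
  next
    case True
    then consider "X = TypeB" | "X = TypeD" using i by (cases X) auto
    then show ?thesis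
    proof cases
      case 1
      have "vperm 0 = id" using 1 unfolding vperm_def by simp
      then show ?thesis using True a by (simp add: L_s0_B[OF 1] d_f)
    next
      case 2
      let ?a = "transpose 1 2 a"
      have b: "1 \<le> ?a" "?a \<le> n" using a n2 by (auto simp: transpose_def)
      have "L (s 0) (L (f a) (L (s 0) P)) = d (L (s 1) (d (L (f a) (d (L (s 1) (d P))))))"
        by (simp add: L_s0_D[OF 2])
      also have "\<dots> = d (L (f ?a) (d P))"
        using L_f_conj[OF a, of 1] n2 d_f[OF a] by (simp add: numeral_2_eq_2)
      also have "\<dots> = L (f ?a) P" by (rule d_f[OF b])
      moreover have "vperm 0 = transpose 1 2" using 2 unfolding vperm_def by simp
      ultimately show ?thesis using True by simp
    qed
  qed
  then show "L (s i \<odot> f a \<odot> s i) P = L (f (vperm i a)) P" for P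
    using i a by (simp add: L_mult I_V)
qed (use assms vperm_range I_V in auto)

lemma f_unit_conj:
  assumes "g \<in> Units M" "1 \<le> a" "a \<le> n"
  shows "\<exists>b. 1 \<le> b \<and> b \<le> n \<and> g \<odot> f a \<odot> inv\<^bsub>M\<^esub> g = f b"
  using assms(1)
proof (induction g rule: Units_induct)
  case one
  then show ?case using assms by auto
next
  case (mult i h)
  then obtain b where b: "1 \<le> b" "b \<le> n" "h \<odot> f a \<odot> inv\<^bsub>M\<^esub> h = f b" by auto
  have "(s i \<odot> h) \<odot> f a \<odot> inv\<^bsub>M\<^esub> (s i \<odot> h) = s i \<odot> (h \<odot> f a \<odot> inv\<^bsub>M\<^esub> h) \<odot> s i"
    using mult assms M.Units_closed[of h] s_Units[of i] inv_s[of i] I_V[of i]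
    by (simp add: inv_mult M.m_assoc)
  also have "\<dots> = f (vperm i b)" using b f_conj mult by simp
  finally show ?case using vperm_range[OF mult(1) b(1,2)] by blast
qed

subsection \<open>Reflections\<close>

lemma Ref_gen: "i \<in> I \<Longrightarrow> s i \<in> Ref"
  unfolding reflections_def
  by (intro CollectI exI[of _ "\<one>\<^bsub>M\<^esub>"] exI[of _ i]) (simp add: I_V)

lemma Ref_conj: "r \<in> Ref \<Longrightarrow> g \<in> Units M \<Longrightarrow> g \<odot> r \<odot> inv\<^bsub>M\<^esub> g \<in> Ref"
proof -
  assume "r \<in> Ref" and g: "g \<in> Units M"
  then obtain h i where h: "h \<in> Units M" "i \<in> I" "r = h \<odot> s i \<odot> inv\<^bsub>M\<^esub> h"
    unfolding reflections_def by blast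
  have "g \<odot> r \<odot> inv\<^bsub>M\<^esub> g = (g \<odot> h) \<odot> s i \<odot> inv\<^bsub>M\<^esub> (g \<odot> h)"
    using g h M.Units_closed I_V by (simp add: inv_mult M.m_assoc)
  then show ?thesis unfolding reflections_def using g h by blast
qed

lemma Ref_unit:
  assumes "r \<in> Ref"
  shows "r \<in> Units M" "inv\<^bsub>M\<^esub> r = r" "r \<odot> r = \<one>\<^bsub>M\<^esub>" "r \<in> carrier M"
proof -
  obtain g i where g: "g \<in> Units M" "i \<in> I" "r = g \<odot> s i \<odot> inv\<^bsub>M\<^esub> g"
    using assms unfolding reflections_def by blast
  then show u: "r \<in> Units M" using s_Units by simp
  then show "r \<in> carrier M" by (rule M.Units_closed)
  have "inv\<^bsub>M\<^esub> r = g \<odot> (s i \<odot> inv\<^bsub>M\<^esub> g)"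
    using g s_Units[of i] inv_s[of i] by (simp add: inv_mult)
  then show "inv\<^bsub>M\<^esub> r = r" using g I_V M.Units_closed by (simp add: M.m_assoc)
  then show "r \<odot> r = \<one>\<^bsub>M\<^esub>" using M.Units_r_inv[OF u] by simp
qed

text \<open>\<open>F\<close> and \<open>G\<close> are the same reflection, expressed by the same name in the two instances of
\<open>signed_chain\<close>. Only in type B are the sign changes themselves reflections.\<close>

definition matched :: "(word set \<Rightarrow> word set) \<Rightarrow> (int \<Rightarrow> int) \<Rightarrow> bool" where
  "matched F G \<longleftrightarrow>
     (\<exists>p a b. 1 \<le> a \<and> a \<le> n \<and> 1 \<le> b \<and> b \<le> n \<and> a \<noteq> b \<and> F = C.sswap p a b \<and> G = Pt.sswap p a b) \<or>
     (X = TypeB \<and> (\<exists>a. 1 \<le> a \<and> a \<le> n \<and> F = C.neg a \<and> G = Pt.neg a))"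

lemma matched_s:
  assumes "matched F G" "1 \<le> i" "i < n"
  shows "matched (\<lambda>P. L (s i) (F (L (s i) P))) (\<lambda>p. point_swap i (G (point_swap i p)))"
proof -
  let ?t = "transpose i (Suc i)"
  have range: "1 \<le> ?t a \<and> ?t a \<le> n" if "1 \<le> a" "a \<le> n" for a
    using that assms by (auto simp: transpose_def)
  from assms(1) consider (swap) p a b where "1 \<le> a" "a \<le> n" "1 \<le> b" "b \<le> n" "a \<noteq> b"
      "F = C.sswap p a b" "G = Pt.sswap p a b"
    | (neg) a where "X = TypeB" "1 \<le> a" "a \<le> n" "F = C.neg a" "G = Pt.neg a"
    unfolding matched_def by blast
  then show ?thesis
  proof cases
    case swap
    have "?t a \<noteq> ?t b" using swap by (metis transpose_involutory)
    then have "1 \<le> ?t a \<and> ?t a \<le> n \<and> 1 \<le> ?t b \<and> ?t b \<le> n \<and> ?t a \<noteq> ?t b \<and>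
        (\<lambda>P. L (s i) (F (L (s i) P))) = C.sswap p (?t a) (?t b) \<and>
        (\<lambda>q. point_swap i (G (point_swap i q))) = Pt.sswap p (?t a) (?t b)"
      using range[of a] range[of b] swap assms C.sswap_conj[of a b i p] Pt.sswap_conj[of a b i p]
      by (intro conjI ext) simp_all
    then show ?thesis unfolding matched_def by blast
  next
    case neg
    then have "1 \<le> ?t a \<and> ?t a \<le> n \<and> (\<lambda>P. L (s i) (F (L (s i) P))) = C.neg (?t a) \<and>
        (\<lambda>q. point_swap i (G (point_swap i q))) = Pt.neg (?t a)"
      using range[of a] assms C.neg_conj[of a i] Pt.neg_conj[of a i]
      by (intro conjI ext) simp_all
    then show ?thesis unfolding matched_def using neg(1) by blast
  qed
qed

lemma matched_d:
  assumes "matched F G"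
  shows "matched (\<lambda>P. d (F (d P))) (\<lambda>p. point_d X (G (point_d X p)))"
proof -
  from assms(1) consider (swap) p a b where "1 \<le> a" "a \<le> n" "1 \<le> b" "b \<le> n" "a \<noteq> b"
      "F = C.sswap p a b" "G = Pt.sswap p a b"
    | (neg) a where "X = TypeB" "1 \<le> a" "a \<le> n" "F = C.neg a" "G = Pt.neg a"
    unfolding matched_def by blast
  then show ?thesis
  proof cases
    case swap
    then have "(\<lambda>P. d (F (d P))) = C.sswap (p = (a \<noteq> 1 \<and> b \<noteq> 1)) a b \<and>
        (\<lambda>q. point_d X (G (point_d X q))) = Pt.sswap (p = (a \<noteq> 1 \<and> b \<noteq> 1)) a b"
      using C.sswap_d[of a b p] Pt.sswap_d[of a b p] by (intro conjI ext) simp_all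
    then show ?thesis unfolding matched_def using swap by blast
  next
    case neg
    have "(\<lambda>P. d (F (d P))) = C.neg a \<and> (\<lambda>q. point_d X (G (point_d X q))) = Pt.neg a"
      by (simp only: neg(4,5) C.d_neg_comm[OF neg(2,3)] Pt.d_neg_comm[OF neg(2,3)]
        C.d_invol Pt.d_invol)
    then show ?thesis unfolding matched_def using neg by blast
  qed
qed

lemma rho_s0_B:
  assumes B: "X = TypeB"
  shows "rho (s 0) p = point_d X p"
proof -
  have "point_gen X n 0 p = point_d X p" using B n2 by (simp add: point_gen_def point_d_def)
  then show ?thesis using rho_s[OF I_V[OF zero_I], of p] B by (metis diagram_type.distinct(1))
qed

lemma rho_s0_D:
  assumes D: "X = TypeD"
  shows "rho (s 0) p = point_d X (point_swap 1 (point_d X p))"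
proof -
  have "point_gen X n 0 p = point_d X (point_swap 1 (point_d X p))"
    using D n2 by (simp add: point_gen_def point_d_def)
  then show ?thesis using rho_s[OF I_V[OF zero_I], of p] D by (metis diagram_type.distinct(3))
qed

lemma matched_gen:
  assumes "matched F G" "i \<in> I"
  shows "matched (\<lambda>P. L (s i) (F (L (s i) P))) (\<lambda>p. rho (s i) (G (rho (s i) p)))"
proof (cases "i = 0")
  case False
  then show ?thesis using matched_s[OF assms(1), of i] I_less[OF assms(2)] by (simp add: rho_s_pos)
next
  case True
  then consider (B) "X = TypeB" | (D) "X = TypeD" using assms(2) by (cases X) auto
  then show ?thesis
  proof cases
    case B
    show ?thesis using matched_d[OF assms(1)] unfolding True L_s0_B[OF B] rho_s0_B[OF B] .
  next
    case D
    have "1 < n" using n2 by simp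
    from matched_d[OF matched_s[OF matched_d[OF assms(1)] order.refl this]]
    show ?thesis unfolding True L_s0_D[OF D] rho_s0_D[OF D] .
  qed
qed

lemma matched_s_self: "i \<in> I \<Longrightarrow> matched (L (s i)) (rho (s i))"
proof (cases "i = 0")
  case False
  assume i: "i \<in> I"
  have "L (s i) = C.sswap True i (Suc i)" "rho (s i) = Pt.sswap True i (Suc i)"
    using False I_less[OF i] by (auto simp: C.sswap_def Pt.sswap_def C.swap_Suc Pt.swap_Suc rho_s_pos)
  then show ?thesis unfolding matched_def using False I_less[OF i]
    by (intro disjI1 exI[of _ True] exI[of _ i] exI[of _ "Suc i"]) auto
next
  case True
  assume "i \<in> I"
  then consider (B) "X = TypeB" | (D) "X = TypeD" using True by (cases X) auto
  then show ?thesis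
  proof cases
    case B
    have "L (s 0) = C.neg 1" "rho (s 0) = Pt.neg 1"
      using C.neg_1 Pt.neg_1 L_s0_B[OF B] rho_s0_B[OF B] by auto
    then show ?thesis unfolding matched_def True using B n2
      by (intro disjI2 conjI exI[of _ 1]) auto
  next
    case D
    have "L (s 0) = C.sswap False 1 (Suc 1)" "rho (s 0) = Pt.sswap False 1 (Suc 1)"
      unfolding C.sswap_def Pt.sswap_def C.swap_Suc Pt.swap_Suc
      using C.neg_1 Pt.neg_1 L_s0_D[OF D] rho_s0_D[OF D] by auto
    then show ?thesis unfolding matched_def True using n2
      by (intro disjI1 exI[of _ False] exI[of _ 1] exI[of _ "Suc 1"]) auto
  qed
qed

text \<open>Reflections are obtained from the generators by repeated conjugation with generators, and a step of
this kind changes the names in both instances by the same rule.\<close>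

lemma Ref_matched:
  assumes "r \<in> Ref"
  shows "matched (L r) (rho r)"
proof -
  obtain g i where g: "g \<in> Units M" "i \<in> I" "r = g \<odot> s i \<odot> inv\<^bsub>M\<^esub> g"
    using assms unfolding reflections_def by blast
  have "matched (L (g \<odot> s i \<odot> inv\<^bsub>M\<^esub> g)) (rho (g \<odot> s i \<odot> inv\<^bsub>M\<^esub> g))"
    using g(1)
  proof (induction g rule: Units_induct)
    case one
    then show ?case using matched_s_self[OF g(2)] I_V[OF g(2)] by simp
  next
    case (mult j h)
    let ?r = "h \<odot> s i \<odot> inv\<^bsub>M\<^esub> h"
    have r: "?r \<in> carrier M" "s j \<in> carrier M" using mult g(2) I_V M.Units_closed by auto
    have "(s j \<odot> h) \<odot> s i \<odot> inv\<^bsub>M\<^esub> (s j \<odot> h) = s j \<odot> ?r \<odot> s j"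
      using mult M.Units_closed[of h] s_Units[of j] inv_s[of j] I_V[of j] I_V[OF g(2)]
      by (simp add: inv_mult M.m_assoc)
    moreover have "L (s j \<odot> ?r \<odot> s j) = (\<lambda>P. L (s j) (L ?r (L (s j) P)))"
      "rho (s j \<odot> ?r \<odot> s j) = (\<lambda>p. rho (s j) (rho ?r (rho (s j) p)))"
      using r by (auto simp: L_mult rho_mult)
    ultimately show ?case using matched_gen[OF mult(3,1)] by simp
  qed
  then show ?thesis using g by simp
qed

lemma abs_point_swap: "\<bar>point_swap i p\<bar> = transpose (int i) (int i + 1) \<bar>p\<bar>"
  by (auto simp: point_swap_def transpose_def)

lemma abs_point_d: "\<bar>point_d X p\<bar> = \<bar>p\<bar>"
  by (simp add: point_d_def point_neg_def)

lemma abs_Pt_neg: "\<bar>Pt.neg a p\<bar> = \<bar>p\<bar>"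
proof (induction a arbitrary: p)
  case (Suc a)
  then show ?case
    by (cases "a = 0") (auto simp: Pt.neg_1 Pt.neg_step abs_point_d abs_point_swap)
qed simp

lemma abs_Pt_swap: "a < b \<Longrightarrow> \<bar>Pt.swap a b p\<bar> = transpose (int a) (int b) \<bar>p\<bar>"
proof -
  assume "a < b"
  then have "Suc a \<le> b" by simp
  then show ?thesis
  proof (induction b arbitrary: p rule: nat_induct_at_least)
    case base
    then show ?case by (simp add: Pt.swap_Suc abs_point_swap add.commute)
  next
    case (Suc b)
    then show ?case by (simp add: Pt.swap_step abs_point_swap) (auto simp: transpose_def)
  qed
qed

lemma abs_Pt_sswap:
  assumes "a \<noteq> b"
  shows "\<bar>Pt.sswap p a b q\<bar> = transpose (int a) (int b) \<bar>q\<bar>"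
proof -
  have "\<bar>Pt.swap a b q\<bar> = transpose (int a) (int b) \<bar>q\<bar>" for q
    using abs_Pt_swap[of a b q] abs_Pt_swap[of b a q] assms
    by (cases "a < b") (auto simp: Pt.swap_sym[of a b] transpose_commute[of "int a"])
  then show ?thesis by (simp add: Pt.sswap_def abs_Pt_neg)
qed

lemma Pt_neg_B:
  assumes B: "X = TypeB" and "1 \<le> a"
  shows "Pt.neg a q = (if \<bar>q\<bar> = int a then - q else q)"
  using assms(2)
proof (induction a arbitrary: q rule: nat_induct_at_least)
  case base
  have "point_d X q = (if \<bar>q\<bar> = 1 then - q else q)"
    using B by (simp add: point_d_def point_neg_def)
  then show ?case by (simp add: Pt.neg_1)
next
  case (Suc a)
  consider "q = int a" | "q = int a + 1" | "q = - int a" | "q = - int a - 1"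
    | "q \<notin> {int a, int a + 1, - int a, - int a - 1}" by blast
  then have "point_swap a (if \<bar>point_swap a q\<bar> = int a then - point_swap a q else point_swap a q) =
      (if \<bar>q\<bar> = int (Suc a) then - q else q)"
    using Suc.hyps by cases (auto simp: point_swap_def)
  then show ?case using Suc by (simp add: Pt.neg_step)
qed

subsection \<open>Inner by diagram automorphisms\<close>

definition inner_diagram_autos :: "(word set \<Rightarrow> word set) set" where
  "inner_diagram_autos = {\<alpha>. inner_by_diagram X n \<alpha>}"

definition conjugation :: "word set \<Rightarrow> word set \<Rightarrow> word set" where
  "conjugation g = (\<lambda>t\<in>carrier M. g \<odot> t \<odot> inv\<^bsub>M\<^esub> g)"

lemma conjugation_auto: "g \<in> Units M \<Longrightarrow> conjugation g \<in> auto M"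
proof (rule M.autoI[where \<beta> = "\<lambda>t. inv\<^bsub>M\<^esub> g \<odot> t \<odot> g"])
  assume g: "g \<in> Units M"
  note c = M.Units_closed[OF g] M.Units_inv_closed[OF g]
  have l: "inv\<^bsub>M\<^esub> g \<odot> (g \<odot> t) = t" "g \<odot> (inv\<^bsub>M\<^esub> g \<odot> t) = t" if "t \<in> carrier M" for t
    using g c that by (simp_all flip: M.m_assoc)
  show "conjugation g (x \<odot> y) = conjugation g x \<odot> conjugation g y"
    if "x \<in> carrier M" "y \<in> carrier M" for x y
    using that c l by (simp add: conjugation_def M.m_assoc)
  show "inv\<^bsub>M\<^esub> g \<odot> x \<odot> g \<in> carrier M \<and> conjugation g (inv\<^bsub>M\<^esub> g \<odot> x \<odot> g) = x \<and>
      inv\<^bsub>M\<^esub> g \<odot> conjugation g x \<odot> g = x" if "x \<in> carrier M" for x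
    using that c l g by (simp add: conjugation_def M.m_assoc)
qed (auto simp: conjugation_def)

lemma conjugation_inner_diagram: "g \<in> Units M \<Longrightarrow> conjugation g \<in> inner_diagram_autos"
  using conjugation_auto[of g] unfolding inner_diagram_autos_def inner_by_diagram_def
  by (intro CollectI generate.incl UnI1) (auto simp: inner_automorphisms_def conjugation_def)

lemma inner_diagram_auto: "\<alpha> \<in> inner_diagram_autos \<Longrightarrow> \<alpha> \<in> auto M"
  unfolding inner_diagram_autos_def inner_by_diagram_def
  using group.generate_in_carrier[OF M.group_AutoGroup,
      of "inner_automorphisms X n \<union> diagram_automorphisms X n" \<alpha>]
  by (auto simp: M.AutoGroup_simps inner_automorphisms_def diagram_automorphisms_def)

lemma inner_diagram_compose: "\<alpha> \<in> inner_diagram_autos \<Longrightarrow> \<beta> \<in> inner_diagram_autos \<Longrightarrow> compose (carrier M) \<alpha> \<beta> \<in> inner_diagram_autos"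
  using generate.eng[of \<alpha> "AutoGroup M" _ \<beta>] inner_diagram_auto[of \<alpha>] inner_diagram_auto[of \<beta>]
  by (simp add: inner_diagram_autos_def inner_by_diagram_def M.AutoGroup_simps)

lemma inner_diagram_one: "(\<lambda>x\<in>carrier M. x) \<in> inner_diagram_autos"
  using generate.one[of "AutoGroup M"]
  by (simp add: inner_diagram_autos_def inner_by_diagram_def M.AutoGroup_simps)

text \<open>Conjugation by the map \<open>h\<close> carries left multiplication by \<open>x\<close> to left multiplication by \<open>\<gamma> x\<close>. In this
way the maps of the locale \<open>signed_chain\<close> give rise to inner by diagram automorphisms.\<close>

definition normalizes :: "(word set \<Rightarrow> word set) \<Rightarrow> (word set \<Rightarrow> word set) \<Rightarrow> bool" where
  "normalizes h \<gamma> \<longleftrightarrow> \<gamma> \<in> inner_diagram_autos \<and> (\<forall>r\<in>Ref. \<gamma> r \<in> Ref) \<and>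
     (\<forall>x\<in>carrier M. \<forall>P. h (L x P) = L (\<gamma> x) (h P))"

lemma normalizes_compose:
  assumes "normalizes h \<gamma>" "normalizes h' \<gamma>'"
  shows "normalizes (\<lambda>P. h (h' P)) (compose (carrier M) \<gamma> \<gamma>')"
  unfolding normalizes_def
proof (intro conjI ballI allI)
  show "compose (carrier M) \<gamma> \<gamma>' \<in> inner_diagram_autos" using assms by (simp add: normalizes_def inner_diagram_compose)
qed (use assms Ref_unit(4) M.auto_closed[OF inner_diagram_auto, of \<gamma>'] in
  \<open>auto simp: normalizes_def compose_def\<close>)

lemma normalizes_L:
  assumes g: "g \<in> Units M"
  shows "normalizes (L g) (conjugation g)"
proof -
  note c = M.Units_closed[OF g] M.Units_inv_closed[OF g]
  have "L g (L x P) = L (conjugation g x) (L g P)" if x: "x \<in> carrier M" for x P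
  proof -
    have "L (conjugation g x) (L g P) = L (conjugation g x \<odot> g) P"
      using x c by (simp add: L_mult conjugation_def)
    also have "conjugation g x \<odot> g = g \<odot> x" using x c g by (simp add: conjugation_def M.m_assoc)
    finally show ?thesis using x c by (simp add: L_mult)
  qed
  then show ?thesis
    using conjugation_inner_diagram[OF g] Ref_conj[OF _ g] Ref_unit(4)
    by (auto simp: normalizes_def conjugation_def)
qed

lemma swap01_inner_diagram:
  assumes D: "X = TypeD"
  shows "restrict swap01 (carrier M) \<in> inner_diagram_autos"
proof -
  have "tau permutes I" using n2 D by (intro permutes_swap_id) (auto simp: zero_I pos_I)
  then have "restrict swap01 (carrier M) \<in> diagram_automorphisms X n"
    unfolding diagram_automorphisms_def using swap01_auto[OF D] tau_diagram[OF D] swap01_s[OF D]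
    by (intro CollectI conjI exI[of _ tau]) auto
  then show ?thesis unfolding inner_diagram_autos_def inner_by_diagram_def by (auto intro: generate.incl)
qed

lemma swap01_Ref:
  assumes D: "X = TypeD" and r: "r \<in> Ref"
  shows "swap01 r \<in> Ref"
proof -
  obtain g i where g: "g \<in> Units M" "i \<in> I" "r = g \<odot> s i \<odot> inv\<^bsub>M\<^esub> g"
    using r unfolding reflections_def by blast
  let ?a = "restrict swap01 (carrier M)"
  have a: "?a \<in> auto M" by (rule swap01_auto[OF D])
  have "swap01 g \<in> Units M" "swap01 (inv\<^bsub>M\<^esub> g) = inv\<^bsub>M\<^esub> (swap01 g)"
    using M.auto_Units[OF a g(1)] M.Units_closed[OF g(1)] M.Units_inv_closed[OF g(1)] by auto
  moreover have "swap01 r = swap01 g \<odot> swap01 (s i) \<odot> swap01 (inv\<^bsub>M\<^esub> g)"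
    using g M.Units_closed[OF g(1)] M.Units_inv_closed[OF g(1)] I_V[OF g(2)]
    by (simp add: swap01_mult[OF D])
  moreover have "swap01 (s i) = s (tau i)" using swap01_s[OF D I_V[OF g(2)]] .
  moreover have "tau i \<in> I" by (rule tau_I[OF D g(2)])
  ultimately show ?thesis unfolding reflections_def by auto
qed

lemma normalizes_d: "\<exists>\<gamma>. normalizes d \<gamma>"
proof (cases X)
  case A: TypeA
  have "normalizes d (\<lambda>x\<in>carrier M. x)"
    using inner_diagram_one Ref_unit(4) by (auto simp: normalizes_def d_A[OF A])
  then show ?thesis by blast
next
  case B: TypeB
  have "0 \<in> I" by (rule zero_I) (simp add: B)
  from normalizes_L[OF s_Units[OF this]] have "normalizes d (conjugation (s 0))"
    using L_s0_B[OF B] by (simp add: normalizes_def)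
  then show ?thesis by blast
next
  case D: TypeD
  have "normalizes d (restrict swap01 (carrier M))"
    using swap01_inner_diagram[OF D] swap01_Ref[OF D] d_L_D[OF D] Ref_unit(4) by (auto simp: normalizes_def)
  then show ?thesis by blast
qed

lemma normalizes_neg:
  assumes "1 \<le> a" "a \<le> n"
  shows "\<exists>\<gamma>. normalizes (C.neg a) \<gamma>"
  using assms
proof (induction a rule: nat_induct_at_least)
  case base
  then show ?case using normalizes_d by (simp add: C.neg_1)
next
  case (Suc a)
  then obtain \<gamma> where "normalizes (C.neg a) \<gamma>" by auto
  moreover have L: "normalizes (L (s a)) (conjugation (s a))"
    using Suc by (intro normalizes_L s_Units pos_I) auto
  ultimately have "normalizes (\<lambda>P. L (s a) (C.neg a (L (s a) P)))
      (compose (carrier M) (conjugation (s a)) (compose (carrier M) \<gamma> (conjugation (s a))))"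
    by (intro normalizes_compose)
  moreover have "C.neg (Suc a) = (\<lambda>P. L (s a) (C.neg a (L (s a) P)))"
    using Suc by (auto simp: C.neg_step)
  ultimately show ?case by auto
qed

lemma normalizes_conj:
  assumes "normalizes h \<gamma>" "x \<in> carrier M" "\<And>P. h (h P) = P"
  shows "h (L x (h P)) = L (\<gamma> x) P"
  using assms by (simp add: normalizes_def)

lemma auto_gen_eqI:
  assumes a: "\<alpha> \<in> auto M" and fixed: "\<And>i. i \<in> V \<Longrightarrow> \<alpha> (s i) = s i" and x: "x \<in> carrier M"
  shows "\<alpha> x = x"
  using x by (induction x rule: gen_induct) (simp_all add: M.auto_one[OF a] M.auto_mult[OF a] fixed)

lemma rho_Ref_0: "r \<in> Ref \<Longrightarrow> rho r 0 = 0"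
proof -
  assume "r \<in> Ref"
  from Ref_matched[OF this] consider (swap) p a b where "1 \<le> a" "1 \<le> b" "a \<noteq> b"
      "rho r = Pt.sswap p a b"
    | (neg) a where "rho r = Pt.neg a"
    unfolding matched_def by blast
  then show ?thesis
  proof cases
    case swap
    then show ?thesis using abs_Pt_sswap[OF swap(3), of p 0] by (simp add: transpose_def)
  next
    case neg
    then show ?thesis using abs_Pt_neg[of a 0] by simp
  qed
qed

text \<open>The action on signed points shows which two points \<open>r\<close> exchanges, up to sign; the sign is not
determined.\<close>

lemma adjacent_reflection:
  assumes r: "r \<in> Ref" and i: "1 \<le> i" "i < n" and conj: "r \<odot> f i \<odot> r = f (Suc i)"
  shows "r = s i \<or> (\<forall>P. L r P = C.neg (Suc i) (L (s i) (C.neg (Suc i) P)))"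
proof -
  have c: "f i \<in> carrier M" "r \<in> carrier M" "f (Suc i) \<in> carrier M" "s i \<in> carrier M"
    using i Ref_unit(4)[OF r] I_V pos_I by auto
  have "r \<odot> f i = f (Suc i) \<odot> r"
    using c Ref_unit(3)[OF r] by (simp add: M.m_assoc flip: conj)
  then have "rho r (rho (f i) (int i)) = rho (f (Suc i)) (rho r (int i))"
    using c by (metis rho_mult)
  then have "point_kill (Suc i) (rho r (int i)) = 0"
    using i by (simp add: rho_f rho_Ref_0[OF r] point_kill_def[of i])
  then have k: "rho r (int i) = 0 \<or> \<bar>rho r (int i)\<bar> = int i + 1"
    by (auto simp: point_kill_def split: if_splits)
  from Ref_matched[OF r] consider (swap) p a b where "1 \<le> a" "a \<le> n" "1 \<le> b" "b \<le> n" "a \<noteq> b"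
      "L r = C.sswap p a b" "rho r = Pt.sswap p a b"
    | (neg) a where "rho r = Pt.neg a"
    unfolding matched_def by blast
  then show ?thesis
  proof cases
    case swap
    have "\<bar>rho r (int i)\<bar> = transpose (int a) (int b) (int i)"
      using abs_Pt_sswap[OF swap(5)] swap(7) by simp
    then have "transpose (int a) (int b) (int i) = int i + 1"
      using k swap(1,3) i by (auto simp: transpose_def split: if_splits)
    then have "(a = i \<and> b = Suc i) \<or> (a = Suc i \<and> b = i)"
      by (auto simp: transpose_def split: if_splits)
    then have L: "L r = C.sswap p (Suc i) i"
      using swap C.sswap_sym[of a b p] by auto
    have sw: "C.swap (Suc i) i = L (s i)" using C.swap_Suc[of i] C.swap_sym[of i "Suc i"] by simp
    show ?thesis
    proof (cases p)
      case True
      then have "r = s i" using L sw c by - (rule L_inj; auto simp: C.sswap_def)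
      then show ?thesis by simp
    next
      case False
      then show ?thesis using L sw by (simp add: C.sswap_def)
    qed
  next
    case neg
    then show ?thesis using k abs_Pt_neg[of a "int i"] i by auto
  qed
qed

lemma auto_f_conj:
  assumes a: "\<alpha> \<in> auto M" and fx: "\<And>b. 1 \<le> b \<Longrightarrow> b \<le> n \<Longrightarrow> \<alpha> (f b) = f b"
    and i: "i \<in> I" and b: "1 \<le> b" "b \<le> n"
  shows "\<alpha> (s i) \<odot> f b \<odot> \<alpha> (s i) = f (vperm i b)"
proof -
  have "\<alpha> (s i \<odot> f b \<odot> s i) = \<alpha> (s i) \<odot> f b \<odot> \<alpha> (s i)"
    using I_V[OF i] b by (simp add: M.auto_mult[OF a] fx)
  then show ?thesis using f_conj[OF i b] fx vperm_range[OF i b] by simp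
qed

text \<open>In type B the relation \<open>s 0 f 1 = f 1\<close> leaves the sign change of the first coordinate as the only
candidate for the image of \<open>s 0\<close>. In type D the candidates are \<open>s 0\<close> and \<open>s 1\<close>, and the second one is
already the image of \<open>s 1\<close>.\<close>

lemma fixes_s0:
  assumes a: "\<alpha> \<in> auto M" and R: "\<And>i. i \<in> I \<Longrightarrow> \<alpha> (s i) \<in> Ref"
    and fx: "\<And>b. 1 \<le> b \<Longrightarrow> b \<le> n \<Longrightarrow> \<alpha> (f b) = f b"
    and s1: "\<alpha> (s 1) = s 1" and i: "0 \<in> I"
  shows "\<alpha> (s 0) = s 0"
proof -
  let ?y = "\<alpha> (s 0)"
  have y: "?y \<in> Ref" "?y \<in> carrier M" "s 0 \<in> carrier M" using R[OF i] Ref_unit(4) I_V[OF i] by auto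
  have f1: "f 1 \<in> carrier M" using n2 by simp
  from i consider (B) "X = TypeB" | (D) "X = TypeD" by (cases X) auto
  then show ?thesis
  proof cases
    case B
    have "s 0 \<odot> f 1 = f 1"
      by (rule L_inj) (use f1 y s0_f1_B(1)[OF B] in \<open>simp_all add: L_mult\<close>)
    then have "?y \<odot> f 1 = f 1"
      using M.auto_mult[OF a, of "s 0" "f 1"] f1 y fx[of 1] n2 by simp
    then have "rho ?y (rho (f 1) p) = rho (f 1) p" for p
      using rho_mult[OF y(2) f1, of p] by simp
    then have k: "rho ?y (point_kill 1 p) = point_kill 1 p" for p
      using n2 by (simp add: rho_f)
    have fixed: "rho ?y (int c) = int c" if "c \<noteq> 1" for c
      using k[of "int c"] that by (simp add: point_kill_def)
    from Ref_matched[OF y(1)] consider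
        (swap) p a b where "1 \<le> a" "1 \<le> b" "a \<noteq> b" "rho ?y = Pt.sswap p a b"
      | (neg) a where "1 \<le> a" "a \<le> n" "L ?y = C.neg a" "rho ?y = Pt.neg a"
      unfolding matched_def by blast
    then show ?thesis
    proof cases
      case swap
      have "\<bar>rho ?y (int c)\<bar> = transpose (int a) (int b) (int c)" for c
        using abs_Pt_sswap[OF swap(3)] swap(4) by simp
      then have ab: "\<bar>rho ?y (int a)\<bar> = int b" "\<bar>rho ?y (int b)\<bar> = int a" by simp_all
      have "a = 1"
      proof (rule ccontr)
        assume "a \<noteq> 1"
        then show False using ab(1) fixed[of a] swap(3) by simp
      qed
      moreover have "b = 1"
      proof (rule ccontr)
        assume "b \<noteq> 1"
        then show False using ab(2) fixed[of b] swap(3) by simp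
      qed
      ultimately show ?thesis using swap(3) by simp
    next
      case neg
      have "a = 1"
      proof (rule ccontr)
        assume "a \<noteq> 1"
        then show False using fixed[of a] neg(1) Pt_neg_B[OF B neg(1), of "int a"] neg(4) by simp
      qed
      then have "L ?y P = L (s 0) P" for P using neg(3) C.neg_1 L_s0_B[OF B] by simp
      then show ?thesis by (rule L_inj[OF y(2,3)])
    qed
  next
    case D
    have "vperm 0 1 = Suc 1" using D unfolding vperm_def by simp
    then have "?y \<odot> f 1 \<odot> ?y = f (Suc 1)" using auto_f_conj[OF a fx i, of 1] n2 by simp
    then consider "?y = s 1" | "\<forall>P. L ?y P = C.neg (Suc 1) (L (s 1) (C.neg (Suc 1) P))"
      using adjacent_reflection[OF y(1), of 1] n2 by auto
    then show ?thesis
    proof cases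
      case 1
      have 1: "1 \<in> I" using n2 by (intro pos_I) auto
      have "s 0 = s 1" using 1 s1 M.auto_inj[OF a y(3) s_carrier[OF I_V[OF 1]]] \<open>?y = s 1\<close> by simp
      then have "rho (s 0) 1 = rho (s 1) 1" by simp
      moreover have "point_d X 1 = -1" "point_d X (-2) = -2"
        using D by (auto simp: point_d_def point_neg_def)
      ultimately show ?thesis using n2 rho_s_pos[of 1 1] rho_s0_D[OF D, of 1]
        by (simp add: point_swap_def)
    next
      case 2
      have "C.neg (Suc 1) (C.swap 1 (Suc 1) (C.neg (Suc 1) P)) = C.neg 1 (C.swap 1 (Suc 1) (C.neg 1 P))"
        for P using C.neg_swap_sym[of "Suc 1" 1 P] n2 C.swap_sym[of 1 "Suc 1"] by simp
      then have "L ?y P = L (s 0) P" for P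
        using 2 C.swap_Suc[of 1] C.neg_1 L_s0_D[OF D] by simp
      then show ?thesis by (rule L_inj[OF y(2,3)])
    qed
  qed
qed

text \<open>The automorphism is corrected at \<open>s k\<close> by the sign change of the coordinate \<open>k + 1\<close>. It fixes
\<open>s 1, \<dots>, s (k - 1)\<close> and all \<open>f b\<close>; its effect on \<open>s (k + 1)\<close> is dealt with in the next step.\<close>

lemma inner_diagram_if_fixes_f:
  assumes "k \<le> n" "1 \<le> k" "\<alpha> \<in> auto M" "\<And>i. i \<in> I \<Longrightarrow> \<alpha> (s i) \<in> Ref"
    and "\<And>b. 1 \<le> b \<Longrightarrow> b \<le> n \<Longrightarrow> \<alpha> (f b) = f b"
    and "\<And>i. 1 \<le> i \<Longrightarrow> i < k \<Longrightarrow> \<alpha> (s i) = s i"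
  shows "\<alpha> \<in> inner_diagram_autos"
  using assms
proof (induction k arbitrary: \<alpha> rule: inc_induct)
  case base
  note a = \<open>\<alpha> \<in> auto M\<close>
  have "\<alpha> (s i) = s i" if iV: "i \<in> V" for i
  proof -
    consider "i = n" | "i \<in> I" "1 \<le> i" | "i \<in> I" "i = 0" using V_cases[OF iV] by fastforce
    then show ?thesis
    proof cases
      case 1
      then show ?thesis using base(4)[of n] n2 by (simp add: f_n)
    next
      case 2
      then show ?thesis using base(5)[of i] I_less by simp
    next
      case 3
      then show ?thesis using fixes_s0[OF a base(3,4)] base(5)[of 1] n2 by simp
    qed
  qed
  then have "\<alpha> = (\<lambda>x\<in>carrier M. x)"
    using auto_gen_eqI[OF a] by (intro M.auto_eqI a inner_diagram_auto[OF inner_diagram_one]) auto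
  then show ?case using inner_diagram_one by (simp only:)
next
  case (step k)
  note a = \<open>\<alpha> \<in> auto M\<close>
  have kI: "k \<in> I" using step by (intro pos_I)
  have "vperm k k = Suc k" using step by (simp add: vperm_def)
  then have "\<alpha> (s k) \<odot> f k \<odot> \<alpha> (s k) = f (Suc k)"
    using auto_f_conj[OF a step.prems(4) kI, of k] step by simp
  then consider "\<alpha> (s k) = s k"
    | "\<forall>P. L (\<alpha> (s k)) P = C.neg (Suc k) (L (s k) (C.neg (Suc k) P))"
    using adjacent_reflection[OF step.prems(3)[OF kI]] step by auto
  then show ?case
  proof cases
    case 1
    show ?thesis
    proof (rule step.IH)
      show "\<alpha> (s i) = s i" if "1 \<le> i" "i < Suc k" for i
        using that 1 step.prems(5)[of i] by (cases "i = k") auto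
    qed (use step.prems in auto)
  next
    case 2
    let ?z = "C.neg (Suc k)"
    have z: "?z (?z P) = P" for P using C.neg_invol[of "Suc k"] step by simp
    obtain \<gamma> where \<gamma>: "normalizes ?z \<gamma>" using normalizes_neg[of "Suc k"] step by auto
    have \<gamma>I: "\<gamma> \<in> inner_diagram_autos" and \<gamma>R: "\<And>r. r \<in> Ref \<Longrightarrow> \<gamma> r \<in> Ref"
      using \<gamma> by (auto simp: normalizes_def)
    note \<gamma>a = inner_diagram_auto[OF \<gamma>I]
    have conj: "L (\<gamma> x) P = ?z (L x (?z P))" if "x \<in> carrier M" for x P
      using normalizes_conj[OF \<gamma> that z] by simp
    have \<gamma>\<gamma>: "\<gamma> (\<gamma> x) = x" if "x \<in> carrier M" for x
      using that M.auto_closed[OF \<gamma>a] by - (rule L_inj; simp add: conj z)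
    have \<gamma>f: "\<gamma> (f b) = f b" if "1 \<le> b" "b \<le> n" for b
      using that M.auto_closed[OF \<gamma>a] neg_f[of "Suc k" b] step by - (rule L_inj; simp add: conj)
    have \<gamma>s: "\<gamma> (s i) = s i" if "1 \<le> i" "i < k" for i
    proof (rule L_inj)
      have "?z (C.swap i (Suc i) (?z P)) = C.swap i (Suc i) P" for P
        by (rule C.neg_swap_disjoint) (use that step in auto)
      then show "L (\<gamma> (s i)) P = L (s i) P" for P
        using that step I_V pos_I by (simp add: conj C.swap_Suc)
    qed (use that step I_V pos_I M.auto_closed[OF \<gamma>a] in auto)
    have \<gamma>k: "\<gamma> (\<alpha> (s k)) = s k"
      using 2 M.auto_closed[OF \<gamma>a] M.auto_closed[OF a] I_V[OF kI] by - (rule L_inj; simp add: conj z)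
    let ?b = "compose (carrier M) \<gamma> \<alpha>"
    have b: "?b x = \<gamma> (\<alpha> x)" if "x \<in> carrier M" for x using that by (simp add: compose_def)
    have "?b \<in> inner_diagram_autos"
    proof (rule step.IH)
      show "?b \<in> auto M" by (rule M.auto_compose[OF \<gamma>a a])
      show "?b (s i) \<in> Ref" if "i \<in> I" for i
        using that I_V step.prems(3) by (simp add: b \<gamma>R)
      show "?b (f c) = f c" if "1 \<le> c" "c \<le> n" for c
        using that step.prems(4) by (simp add: b \<gamma>f)
      show "?b (s i) = s i" if "1 \<le> i" "i < Suc k" for i
      proof (cases "i = k")
        case True
        then show ?thesis using \<gamma>k I_V[OF kI] by (simp add: b)
      next
        case False
        then have "1 \<le> i" "i < k" "i \<in> V" using that step I_V[OF pos_I, of i] by auto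
        then show ?thesis using step.prems(5)[of i] by (simp add: b \<gamma>s)
      qed
    qed simp
    then have "compose (carrier M) \<gamma> ?b \<in> inner_diagram_autos" by (rule inner_diagram_compose[OF \<gamma>I])
    moreover have "compose (carrier M) \<gamma> ?b = \<alpha>"
      using M.auto_compose[OF \<gamma>a M.auto_compose[OF \<gamma>a a]] a M.auto_closed[OF a]
      by (intro M.auto_eqI) (simp_all add: compose_def \<gamma>\<gamma>)
    ultimately show ?thesis by simp
  qed
qed

text \<open>Conjugation by \<open>s j\<close> moves the image \<open>f j\<close> of \<open>f k\<close> one step closer to \<open>f k\<close> and keeps the \<open>f b\<close> with
\<open>b > k\<close> fixed, because \<open>j + 1 \<le> k\<close>.\<close>

lemma inner_diagram_if_fixes_f_above:
  assumes H: "\<And>\<beta>. \<beta> \<in> auto M \<Longrightarrow> (\<And>i. i \<in> I \<Longrightarrow> \<beta> (s i) \<in> Ref) \<Longrightarrow>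
      (\<And>b. k \<le> b \<Longrightarrow> b \<le> n \<Longrightarrow> \<beta> (f b) = f b) \<Longrightarrow> \<beta> \<in> inner_diagram_autos"
    and "k \<le> n" "j \<le> k" "1 \<le> j" "\<alpha> \<in> auto M" "\<And>i. i \<in> I \<Longrightarrow> \<alpha> (s i) \<in> Ref"
    and "\<And>b. k < b \<Longrightarrow> b \<le> n \<Longrightarrow> \<alpha> (f b) = f b" "\<alpha> (f k) = f j"
  shows "\<alpha> \<in> inner_diagram_autos"
  using assms(3-8)
proof (induction j arbitrary: \<alpha> rule: inc_induct)
  case base
  then show ?case by (intro H) (metis le_neq_implies_less)+
next
  case (step j)
  note a = \<open>\<alpha> \<in> auto M\<close>
  have j: "j \<in> I" "j \<in> V" using step \<open>k \<le> n\<close> pos_I I_V by auto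
  let ?c = "conjugation (s j)"
  have cI: "?c \<in> inner_diagram_autos" by (rule conjugation_inner_diagram[OF s_Units[OF j(1)]])
  note ca = inner_diagram_auto[OF cI]
  have c: "?c x = s j \<odot> x \<odot> s j" if "x \<in> carrier M" for x
    using that inv_s[OF j(1)] by (simp add: conjugation_def)
  have cc: "?c (?c x) = x" if "x \<in> carrier M" for x
  proof -
    have "?c (?c x) = (s j \<odot> s j) \<odot> x \<odot> (s j \<odot> s j)" using that j by (simp add: c M.m_assoc)
    then show ?thesis using that by (simp add: s_invol[OF j(1)])
  qed
  have cf: "?c (f b) = f (transpose j (Suc j) b)" if "1 \<le> b" "b \<le> n" for b
    using that f_conj[OF j(1) that] step by (simp add: c vperm_def)
  let ?b = "compose (carrier M) ?c \<alpha>"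
  have b: "?b x = ?c (\<alpha> x)" if "x \<in> carrier M" for x using that by (simp add: compose_def)
  have "?b \<in> inner_diagram_autos"
  proof (rule step.IH)
    show "?b \<in> auto M" by (rule M.auto_compose[OF ca a])
    show "?b (s i) \<in> Ref" if "i \<in> I" for i
      using Ref_conj[OF step.prems(3)[OF that] s_Units[OF j(1)]] I_V[OF that] M.auto_closed[OF a]
      by (simp add: b c inv_s[OF j(1)])
    show "?b (f c) = f c" if "k < c" "c \<le> n" for c
      using that step cf[of c] by (simp add: b)
    show "?b (f k) = f (Suc j)"
      using step \<open>k \<le> n\<close> cf[of j] by (simp add: b)
  qed simp
  then have "compose (carrier M) ?c ?b \<in> inner_diagram_autos" by (rule inner_diagram_compose[OF cI])
  moreover have "compose (carrier M) ?c ?b = \<alpha>"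
    using M.auto_compose[OF ca M.auto_compose[OF ca a]] a M.auto_closed[OF a]
    by (intro M.auto_eqI) (simp_all add: compose_def cc)
  ultimately show ?case by simp
qed

text \<open>Once \<open>f n, \<dots>, f (k + 1)\<close> are fixed, \<open>f k\<close> can only go to some \<open>f j\<close> with \<open>j \<le> k\<close>: its image is
conjugate to that of \<open>f n\<close>, hence one of the \<open>f j\<close>, and the others are taken.\<close>

lemma inner_diagram_if_reflections:
  assumes "k \<le> n" "1 \<le> k" "1 \<le> j" "j \<le> k" "\<alpha> \<in> auto M" "\<And>i. i \<in> I \<Longrightarrow> \<alpha> (s i) \<in> Ref"
    and "\<And>b. k < b \<Longrightarrow> b \<le> n \<Longrightarrow> \<alpha> (f b) = f b" "\<alpha> (f k) = f j"
  shows "\<alpha> \<in> inner_diagram_autos"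
  using \<open>1 \<le> k\<close> assms(1,3-8)
proof (induction k arbitrary: j \<alpha> rule: nat_induct_at_least)
  case base
  show ?case
  proof (rule inner_diagram_if_fixes_f_above[of 1 j])
    show "\<beta> \<in> inner_diagram_autos" if "\<beta> \<in> auto M" "\<And>i. i \<in> I \<Longrightarrow> \<beta> (s i) \<in> Ref"
      "\<And>b. 1 \<le> b \<Longrightarrow> b \<le> n \<Longrightarrow> \<beta> (f b) = f b" for \<beta>
      by (rule inner_diagram_if_fixes_f[of 1]) (use n2 that in auto)
  qed (use base in auto)
next
  case (Suc k)
  show ?case
  proof (rule inner_diagram_if_fixes_f_above[of "Suc k" j])
    fix \<beta> assume b: "\<beta> \<in> auto M" "\<And>i. i \<in> I \<Longrightarrow> \<beta> (s i) \<in> Ref"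
      "\<And>b. Suc k \<le> b \<Longrightarrow> b \<le> n \<Longrightarrow> \<beta> (f b) = f b"
    have k: "1 \<le> k" "k \<le> n" using Suc by auto
    obtain g where g: "g \<in> Units M" "f k = g \<odot> s n \<odot> inv\<^bsub>M\<^esub> g" using f_unit_conj_f[OF k] by auto
    have "\<beta> (f k) = \<beta> g \<odot> f n \<odot> inv\<^bsub>M\<^esub> (\<beta> g)"
      using g M.Units_closed[OF g(1)] M.auto_Units[OF b(1) g(1)] b(3)[of n] Suc
      by (simp add: M.auto_mult[OF b(1)] f_n)
    moreover have "\<beta> g \<in> Units M" by (rule M.auto_Units(1)[OF b(1) g(1)])
    ultimately obtain c where c: "1 \<le> c" "c \<le> n" "\<beta> (f k) = f c"
      using f_unit_conj[of "\<beta> g" n] n2 by auto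
    have "c \<le> k"
    proof (rule ccontr)
      assume "\<not> c \<le> k"
      then have "\<beta> (f k) = \<beta> (f c)" using b(3)[of c] c by simp
      then have "f k = f c" using M.auto_inj[OF b(1) f_carrier[OF k] f_carrier[OF c(1,2)]] by simp
      then show False using f_inj k c \<open>\<not> c \<le> k\<close> by auto
    qed
    then show "\<beta> \<in> inner_diagram_autos" using c b k by (intro Suc.IH[of c]) auto
  qed (use Suc in auto)
qed

subsection \<open>Mutations of attached elements\<close>

text \<open>Each mutation conjugates attached elements by the reflection attached to the vertex of mutation, and
reflections are self-inverse units.\<close>

lemma mutation_elements:
  assumes "mutates_to X n Q Q' x"
  shows "(\<forall>i\<in>I. x i \<in> Ref) \<and> (\<exists>a. 1 \<le> a \<and> a \<le> n \<and> x n = f a)"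
proof -
  have "(mutation_step X n)\<^sup>*\<^sup>* (Q, s) (Q', x)" using assms by (simp add: mutates_to_def)
  then show ?thesis
  proof (induction "(Q', x)" arbitrary: Q' x rule: rtranclp_induct)
    case base
    then show ?case using Ref_gen f_n n2 by (auto intro: exI[of _ n])
  next
    case (step qy)
    from step(2) obtain k q y where k: "k \<in> I" "qy = (q, y)" "x = mutate_elems X n k q y"
      by (auto elim: mutation_step.cases)
    from step(3)[OF k(2)] obtain a where a: "1 \<le> a" "a \<le> n" "y n = f a" and y: "\<forall>i\<in>I. y i \<in> Ref"
      by auto
    have yk: "y k \<in> Units M" "inv\<^bsub>M\<^esub> (y k) = y k" using y k(1) Ref_unit by auto
    have "y k \<odot> y i \<odot> y k \<in> Ref" if "i \<in> I" for i
      using Ref_conj[of "y i" "y k"] y that yk by simp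
    moreover have "\<exists>b. 1 \<le> b \<and> b \<le> n \<and> y k \<odot> y n \<odot> y k = f b"
      using f_unit_conj[OF yk(1) a(1,2)] yk(2) a(3) by simp
    ultimately show ?case using y a by (auto simp: k(3) mutate_elems_def)
  qed
qed

text \<open>Two mutations at \<open>k\<close> conjugate the elements at all neighbours of \<open>k\<close> exactly once, since every edge at
\<open>k\<close> points towards \<open>k\<close> before exactly one of the two. Seen from the generators, conjugating by
\<open>x k = h s\<^sub>k h\<^sup>-\<close> turns \<open>h\<close> into \<open>h s\<^sub>k\<close>.\<close>

lemma reach_conjugate:
  assumes Q: "delta_quiver X n Q" and g: "g \<in> Units M"
  shows "\<exists>x. mutates_to X n Q Q x \<and> (\<forall>i\<in>V. x i = g \<odot> s i \<odot> inv\<^bsub>M\<^esub> g)"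
  using g
proof (induction g rule: Units_induct_right)
  case one
  have "mutates_to X n Q Q s" by (simp add: mutates_to_def)
  then show ?case by (intro exI[of _ s]) simp
next
  case (mult k h)
  then obtain x where x: "mutates_to X n Q Q x" "\<And>i. i \<in> V \<Longrightarrow> x i = h \<odot> s i \<odot> inv\<^bsub>M\<^esub> h" by auto
  have kV: "k \<in> V" using mult I_V by simp
  let ?Q = "acyclic_mutation k Q"
  let ?y = "mutate_elems X n k Q x"
  let ?z = "mutate_elems X n k ?Q ?y"
  have steps: "mutation_step X n (Q, x) (?Q, ?y)" "mutation_step X n (?Q, ?y) (Q, ?z)"
    by (rule mutation_step.intros[OF mult(1)], rule delta_quiver_mutation[OF Q kV])+
  have "(mutation_step X n)\<^sup>*\<^sup>* (Q, s) (Q, x)" using x(1) by (simp add: mutates_to_def)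
  then have "(mutation_step X n)\<^sup>*\<^sup>* (Q, s) (?Q, ?y)"
    using steps(1) by (rule rtranclp.rtrancl_into_rtrancl)
  then have "(mutation_step X n)\<^sup>*\<^sup>* (Q, s) (Q, ?z)"
    using steps(2) by (rule rtranclp.rtrancl_into_rtrancl)
  then have "mutates_to X n Q Q ?z" unfolding mutates_to_def .
  moreover have "?z i = (h \<odot> s k) \<odot> s i \<odot> inv\<^bsub>M\<^esub> (h \<odot> s k)" if i: "i \<in> V" for i
  proof -
    have q: "is_quiver V Q" using Q by (simp add: delta_quiver_def)
    note qc = is_quiver_cases[OF q]
    note hc = M.Units_closed[OF mult(2)] M.Units_inv_closed[OF mult(2)]
    have l: "inv\<^bsub>M\<^esub> h \<odot> (h \<odot> t) = t" if "t \<in> carrier M" for t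
      using that hc mult(2) by (simp flip: M.m_assoc)
    have rhs: "(h \<odot> s k) \<odot> s i \<odot> inv\<^bsub>M\<^esub> (h \<odot> s k) = h \<odot> (s k \<odot> s i \<odot> s k) \<odot> inv\<^bsub>M\<^esub> h"
      using hc mult s_Units[OF mult(1)] inv_s[OF mult(1)] kV i by (simp add: inv_mult M.m_assoc)
    have lhs: "x k \<odot> x i \<odot> x k = h \<odot> (s k \<odot> s i \<odot> s k) \<odot> inv\<^bsub>M\<^esub> h"
      using hc kV i x(2) by (simp add: M.m_assoc l)
    have z: "?z i = (if Q k i > 0 \<or> Q i k > 0 then x k \<odot> x i \<odot> x k else x i)"
      using qc(1)[of k] qc(2)[of i k] by (simp add: mutate_elems_def acyclic_mutation_def)
    show ?thesis
    proof (cases "Q k i > 0 \<or> Q i k > 0")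
      case True
      then show ?thesis using z lhs rhs by simp
    next
      case False
      have "s k \<odot> s i \<odot> s k = s i"
      proof (cases "i = k")
        case True
        then show ?thesis using s_invol[OF mult(1)] kV by simp
      next
        case ne: False
        have "diagram X n k i = 0"
          using Q False kV i by (force simp: delta_quiver_def edge_weight_def)
        then have "L (s k) (L (s i) P) = L (s i) (L (s k) P)" for P
          using L_comm[OF mult(1) i] ne by simp
        then show ?thesis
          using kV i L_invol[OF mult(1)] by - (rule L_inj; simp add: L_mult)
      qed
      then show ?thesis using z rhs x(2)[OF i] False by simp
    qed
  qed
  ultimately show ?case by blast
qed

text \<open>Diagram automorphisms permute \<open>S\<close>, and automorphisms carry conjugates of \<open>S\<close> to conjugates of its
image; so the automorphisms with this property are closed under composition and inverses.\<close>

lemma inner_diagram_image: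
  assumes "\<alpha> \<in> inner_diagram_autos"
  shows "\<exists>g\<in>Units M. \<alpha> ` s ` V = (\<lambda>t. g \<odot> t \<odot> inv\<^bsub>M\<^esub> g) ` s ` V"
proof -
  let ?A = "inner_automorphisms X n \<union> diagram_automorphisms X n"
  let ?P = "\<lambda>\<alpha>. \<alpha> \<in> auto M \<and> (\<exists>g\<in>Units M. \<alpha> ` s ` V = (\<lambda>t. g \<odot> t \<odot> inv\<^bsub>M\<^esub> g) ` s ` V)"
  have S: "s ` V \<subseteq> carrier M" by auto
  have conj_image: "\<alpha> ` (\<lambda>t. g \<odot> t \<odot> inv\<^bsub>M\<^esub> g) ` s ` V =
      (\<lambda>t. \<alpha> g \<odot> t \<odot> inv\<^bsub>M\<^esub> (\<alpha> g)) ` \<alpha> ` s ` V" if "\<alpha> \<in> auto M" "g \<in> Units M" for \<alpha> g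
    using S M.auto_mult[OF that(1)] M.auto_Units[OF that] M.Units_closed[OF that(2)]
      M.Units_inv_closed[OF that(2)]
    by (simp add: image_image)
  have conj_mult: "(\<lambda>t. g \<odot> t \<odot> inv\<^bsub>M\<^esub> g) ` (\<lambda>t. h \<odot> t \<odot> inv\<^bsub>M\<^esub> h) ` s ` V =
      (\<lambda>t. (g \<odot> h) \<odot> t \<odot> inv\<^bsub>M\<^esub> (g \<odot> h)) ` s ` V" if "g \<in> Units M" "h \<in> Units M" for g h
    using that M.Units_closed[OF that(1)] M.Units_closed[OF that(2)]
      M.Units_inv_closed[OF that(1)] M.Units_inv_closed[OF that(2)]
    by (simp add: image_image inv_mult M.m_assoc)
  have one_conj: "(\<lambda>t. \<one>\<^bsub>M\<^esub> \<odot> t \<odot> inv\<^bsub>M\<^esub> \<one>\<^bsub>M\<^esub>) ` s ` V = s ` V"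
    by (simp add: image_image)
  have base: "?P \<alpha>" if "\<alpha> \<in> ?A" for \<alpha>
  proof (cases "\<alpha> \<in> inner_automorphisms X n")
    case True
    then obtain g where g: "\<alpha> \<in> auto M" "g \<in> Units M"
        "\<And>t. t \<in> carrier M \<Longrightarrow> \<alpha> t = g \<odot> t \<odot> inv\<^bsub>M\<^esub> g"
      unfolding inner_automorphisms_def by blast
    have "\<alpha> ` s ` V = (\<lambda>t. g \<odot> t \<odot> inv\<^bsub>M\<^esub> g) ` s ` V"
      by (rule image_cong[OF HOL.refl]) (use S g(3) in blast)
    then show ?thesis using g(1,2) by blast
  next
    case False
    then have "\<alpha> \<in> diagram_automorphisms X n" using that by blast
    then obtain \<pi> where a: "\<alpha> \<in> auto M" and p: "\<pi> permutes I"
      and e: "\<And>i. i \<in> V \<Longrightarrow> \<alpha> (s i) = s (\<pi> i)"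
      unfolding diagram_automorphisms_def by blast
    have "\<pi> permutes V" using p by (rule permutes_subset) (auto simp: vertices_def)
    then have "\<pi> ` V = V" by (rule permutes_image)
    moreover have "\<alpha> ` s ` V = s ` \<pi> ` V"
      unfolding image_image by (rule image_cong[OF HOL.refl e])
    ultimately have "\<alpha> ` s ` V = (\<lambda>t. \<one>\<^bsub>M\<^esub> \<odot> t \<odot> inv\<^bsub>M\<^esub> \<one>\<^bsub>M\<^esub>) ` s ` V"
      unfolding one_conj by simp
    then show ?thesis using a M.Units_one_closed by blast
  qed
  have "?P \<alpha>" if "\<alpha> \<in> generate (AutoGroup M) ?A" for \<alpha>
    using that
  proof (induction \<alpha> rule: generate.induct)
    case one
    have "(\<lambda>x\<in>carrier M. x) ` s ` V = (\<lambda>x. x) ` s ` V"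
      by (rule image_cong[OF HOL.refl]) (use S in \<open>auto intro: restrict_apply'\<close>)
    then have "(\<lambda>x\<in>carrier M. x) ` s ` V = (\<lambda>t. \<one>\<^bsub>M\<^esub> \<odot> t \<odot> inv\<^bsub>M\<^esub> \<one>\<^bsub>M\<^esub>) ` s ` V"
      unfolding one_conj image_ident .
    then show ?case using inner_diagram_auto[OF inner_diagram_one] M.Units_one_closed
      unfolding M.AutoGroup_simps by blast
  next
    case (incl h)
    then show ?case by (rule base)
  next
    case (inv h)
    interpret A: group "AutoGroup M" by (rule M.group_AutoGroup)
    obtain g where h: "h \<in> auto M" "g \<in> Units M" "h ` s ` V = (\<lambda>t. g \<odot> t \<odot> inv\<^bsub>M\<^esub> g) ` s ` V"
      using base[OF inv] by auto
    let ?k = "inv\<^bsub>AutoGroup M\<^esub> h"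
    have k: "?k \<in> auto M" using A.inv_closed[of h] h by (simp add: M.AutoGroup_simps)
    have "compose (carrier M) ?k h = (\<lambda>x\<in>carrier M. x)"
      using A.l_inv[of h] h k by (simp add: M.AutoGroup_simps)
    then have "?k (h x) = x" if "x \<in> carrier M" for x
      using that compose_eq[of x "carrier M" ?k h] by simp
    then have "s ` V = ?k ` h ` s ` V" by (simp add: image_image)
    also have "\<dots> = (\<lambda>t. ?k g \<odot> t \<odot> inv\<^bsub>M\<^esub> (?k g)) ` ?k ` s ` V"
      unfolding h(3) by (rule conj_image[OF k h(2)])
    finally have eq: "s ` V = (\<lambda>t. ?k g \<odot> t \<odot> inv\<^bsub>M\<^esub> (?k g)) ` ?k ` s ` V" .
    have u: "?k g \<in> Units M" by (rule M.auto_Units(1)[OF k h(2)])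
    let ?i = "inv\<^bsub>M\<^esub> (?k g)"
    have "?i \<odot> (?k g \<odot> t \<odot> ?i) \<odot> inv\<^bsub>M\<^esub> ?i = t" if t: "t \<in> carrier M" for t
    proof -
      have "?i \<odot> (?k g \<odot> t) = (?i \<odot> ?k g) \<odot> t"
        using M.Units_closed[OF u] M.Units_inv_closed[OF u] t by (simp only: M.m_assoc)
      then have "?i \<odot> (?k g \<odot> t) = t" using u t by simp
      then show ?thesis
        using u M.Units_closed[OF u] M.Units_inv_closed[OF u] t by (simp add: M.m_assoc)
    qed
    then have "?k ` s ` V = (\<lambda>t. ?i \<odot> t \<odot> inv\<^bsub>M\<^esub> ?i) ` (\<lambda>t. ?k g \<odot> t \<odot> inv\<^bsub>M\<^esub> (?k g)) ` ?k ` s ` V"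
      using M.auto_closed[OF k] by (simp add: image_image)
    then have "?k ` s ` V = (\<lambda>t. ?i \<odot> t \<odot> inv\<^bsub>M\<^esub> ?i) ` s ` V" unfolding eq[symmetric] .
    then show ?case using k M.Units_inv_Units[OF u] by blast
  next
    case (eng h1 h2)
    then obtain g1 g2 where h: "h1 \<in> auto M" "h2 \<in> auto M" "g1 \<in> Units M" "g2 \<in> Units M"
      "h1 ` s ` V = (\<lambda>t. g1 \<odot> t \<odot> inv\<^bsub>M\<^esub> g1) ` s ` V"
      "h2 ` s ` V = (\<lambda>t. g2 \<odot> t \<odot> inv\<^bsub>M\<^esub> g2) ` s ` V" by auto
    have u: "h1 g2 \<in> Units M" by (rule M.auto_Units(1)[OF h(1,4)])
    have "compose (carrier M) h1 h2 ` s ` V = (\<lambda>t. h1 (h2 t)) ` s ` V"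
      by (rule image_cong[OF HOL.refl]) (use S in \<open>auto simp: compose_eq\<close>)
    also have "\<dots> = h1 ` h2 ` s ` V" by (simp only: image_image)
    also have "\<dots> = (\<lambda>t. (h1 g2 \<odot> g1) \<odot> t \<odot> inv\<^bsub>M\<^esub> (h1 g2 \<odot> g1)) ` s ` V"
      using conj_mult[OF u h(3)] by (simp only: h(6) conj_image[OF h(1,4)] h(5))
    finally have "compose (carrier M) h1 h2 ` s ` V =
        (\<lambda>t. (h1 g2 \<odot> g1) \<odot> t \<odot> inv\<^bsub>M\<^esub> (h1 g2 \<odot> g1)) ` s ` V" .
    then show ?case using M.auto_compose[OF h(1,2)] M.Units_m_closed[OF u h(3)]
      unfolding M.AutoGroup_simps(3)[OF h(1,2)] by blast
  qed
  then show ?thesis using assms by (auto simp: inner_diagram_autos_def inner_by_diagram_def)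
qed

lemma inner_diagram_iff_mutations:
  assumes Q: "delta_quiver X n Q" and a: "\<alpha> \<in> auto M"
  shows "\<alpha> \<in> inner_diagram_autos \<longleftrightarrow> (\<exists>Q' x. mutates_to X n Q Q' x \<and> has_underlying_diagram X n Q' \<and>
    x ` V = \<alpha> ` s ` V)"
proof
  assume "\<alpha> \<in> inner_diagram_autos"
  from inner_diagram_image[OF this] obtain g where
    g: "g \<in> Units M" "\<alpha> ` s ` V = (\<lambda>t. g \<odot> t \<odot> inv\<^bsub>M\<^esub> g) ` s ` V"
    by (elim bexE)
  obtain x where x: "mutates_to X n Q Q x" "\<forall>i\<in>V. x i = g \<odot> s i \<odot> inv\<^bsub>M\<^esub> g"
    using reach_conjugate[OF Q g(1)] by (elim exE conjE)
  have "has_underlying_diagram X n Q"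
    using Q permutes_id[of I] unfolding has_underlying_diagram_def delta_quiver_def
    by (intro exI[of _ id]) simp
  moreover have "x ` V = \<alpha> ` s ` V"
    unfolding g(2) unfolding image_image by (rule image_cong[OF HOL.refl]) (use x(2) in blast)
  ultimately show "\<exists>Q' x. mutates_to X n Q Q' x \<and> has_underlying_diagram X n Q' \<and>
    x ` V = \<alpha> ` s ` V" using x(1) by blast
next
  assume "\<exists>Q' x. mutates_to X n Q Q' x \<and> has_underlying_diagram X n Q' \<and> x ` V = \<alpha> ` s ` V"
  then obtain Q' x where x: "mutates_to X n Q Q' x" "x ` V = \<alpha> ` s ` V" by (elim exE conjE)
  obtain c where R: "\<And>i. i \<in> I \<Longrightarrow> x i \<in> Ref" and c: "1 \<le> c" "c \<le> n" "x n = f c"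
    using mutation_elements[OF x(1)] by auto
  \<comment> \<open>units go to units, so \<open>\<alpha>\<close> matches the one attached non-unit with \<open>s n\<close>\<close>
  have not_unit: "f c \<notin> Units M"
    using rho_inj[of "f c" "int c" 0] c by (auto simp: rho_f point_kill_def)
  have unit_iff: "y \<in> Units M" if ay: "\<alpha> y \<in> Units M" and y: "y \<in> carrier M" for y
  proof -
    have "inv\<^bsub>M\<^esub> (\<alpha> y) \<in> \<alpha> ` carrier M"
      unfolding M.auto_surj[OF a] by (rule M.Units_inv_closed[OF ay])
    then obtain t where t: "t \<in> carrier M" "\<alpha> t = inv\<^bsub>M\<^esub> (\<alpha> y)"
      by (elim imageE) (metis that)
    have "\<alpha> (y \<odot> t) = \<alpha> \<one>\<^bsub>M\<^esub>" "\<alpha> (t \<odot> y) = \<alpha> \<one>\<^bsub>M\<^esub>"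
      using t ay y by (simp_all add: M.auto_mult[OF a] M.auto_one[OF a])
    then have "y \<odot> t = \<one>\<^bsub>M\<^esub>" "t \<odot> y = \<one>\<^bsub>M\<^esub>"
      using M.auto_inj[OF a, of "y \<odot> t" "\<one>\<^bsub>M\<^esub>"] M.auto_inj[OF a, of "t \<odot> y" "\<one>\<^bsub>M\<^esub>"] t(1) y
      by simp_all
    then show ?thesis using t(1) y unfolding Units_def by blast
  qed
  have "\<alpha> (s i) \<in> Ref" if "i \<in> I" for i
  proof -
    have "\<alpha> (s i) \<in> x ` V" unfolding x(2) using I_V[OF that] by blast
    then obtain j where j: "j \<in> V" "\<alpha> (s i) = x j" by auto
    moreover have "\<alpha> (s i) \<in> Units M" by (rule M.auto_Units(1)[OF a s_Units[OF that]])
    ultimately have "j \<noteq> n" using not_unit c(3) by auto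
    then show ?thesis using j R V_cases by auto
  qed
  moreover have "\<alpha> (f n) = f c"
  proof -
    have "\<alpha> (s n) \<in> x ` V" unfolding x(2) using n_V by blast
    then obtain j where j: "j \<in> V" "\<alpha> (s n) = x j" by auto
    have "j \<notin> I"
    proof
      assume "j \<in> I"
      then have "\<alpha> (s n) \<in> Units M" using j R Ref_unit(1) by simp
      then show False using unit_iff s_n_not_unit by simp
    qed
    then show ?thesis using j V_cases c(3) by (auto simp: f_n)
  qed
  ultimately show "\<alpha> \<in> inner_diagram_autos" using a c n2 by (intro inner_diagram_if_reflections[of n c]) auto
qed

end

section \<open>Inner by diagram automorphisms and mutations\<close>

theorem theorem4p12:
  fixes X :: diagram_type and n :: nat and Q :: quiver
  assumes "n \<ge> 2" and "X = TypeD \<Longrightarrow> n \<ge> 4"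
    and "delta_quiver X n Q"
  shows "(\<forall>\<alpha>\<in>auto (refl_monoid X n).
            inner_by_diagram X n \<alpha> \<longleftrightarrow>
            (\<exists>Q' x. mutates_to X n Q Q' x \<and> has_underlying_diagram X n Q' \<and>
                    x ` vertices X n = \<alpha> ` gen X n ` vertices X n)) \<and>
         (\<forall>r\<in>reflections X n. \<exists>Q' x. mutates_to X n Q Q' x \<and> r \<in> x ` vertices X n) \<and>
         (\<forall>g\<in>Units (refl_monoid X n). \<exists>Q' x. mutates_to X n Q Q' x \<and>
            g \<otimes>\<^bsub>refl_monoid X n\<^esub> gen X n n \<otimes>\<^bsub>refl_monoid X n\<^esub> inv\<^bsub>refl_monoid X n\<^esub> g
              \<in> x ` vertices X n)"
proof -
  interpret boolean_reflection X n by unfold_locales (use assms in auto)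
  have reach: "\<exists>Q' x. mutates_to X n Q Q' x \<and> g \<odot> s i \<odot> inv\<^bsub>M\<^esub> g \<in> x ` V"
    if gi: "g \<in> Units M" "i \<in> V" for g i
  proof -
    obtain x where x: "mutates_to X n Q Q x" "\<forall>i\<in>V. x i = g \<odot> s i \<odot> inv\<^bsub>M\<^esub> g"
      using reach_conjugate[OF assms(3) gi(1)] by (elim exE conjE)
    have "g \<odot> s i \<odot> inv\<^bsub>M\<^esub> g \<in> x ` V" using x(2) gi(2) by (intro image_eqI[of _ x i]) simp_all
    with x(1) show ?thesis by (intro exI conjI)
  qed
  show ?thesis
  proof (intro conjI ballI)
    show "inner_by_diagram X n \<alpha> \<longleftrightarrow> (\<exists>Q' x. mutates_to X n Q Q' x \<and>
        has_underlying_diagram X n Q' \<and> x ` V = \<alpha> ` s ` V)" if "\<alpha> \<in> auto M" for \<alpha>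
      using inner_diagram_iff_mutations[OF assms(3) that] by (simp add: inner_diagram_autos_def)
    show "\<exists>Q' x. mutates_to X n Q Q' x \<and> r \<in> x ` V" if "r \<in> Ref" for r
      using that reach I_V unfolding reflections_def by blast
    show "\<exists>Q' x. mutates_to X n Q Q' x \<and> g \<odot> s n \<odot> inv\<^bsub>M\<^esub> g \<in> x ` V" if "g \<in> Units M" for g
      using reach[OF that n_V] .
  qed
qed

end
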